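(* Let $\gamma_1(u,v)$, $\gamma_2(u,v)$, $a(u,v)$, $\alpha(u,v)$ be smooth real functions in a neighbourhood $D$ of a point $(u_0,v_0)\in\mathbb R^2$. Suppose that the functions $$ f=\tfrac12\left(\log\sqrt{1+a^2}-\log|\alpha|\right), $$ $$ \Phi=\frac{a_ua_v+(1+a^2)^2f_uf_v}{(1+a^2)\left(-a_v\gamma_1+(1+a^2)f_v\gamma_2\right)},\qquad \Psi=\frac{a_ua_v+(1+a^2)^2f_uf_v}{(1+a^2)\left(a_u\gamma_2+(1+a^2)f_u\gamma_1\right)} $$ are well defined in $D$ (that is, $\alpha$ and the denominators of $\Phi$ and $\Psi$ do not vanish) and that $\Phi>0$, $\Psi>0$ in $D$. Suppose that the following equations hold in $D$: $$ \frac{(\gamma_2)_u}{\Phi}-\frac{(\gamma_1)_v}{\Psi}-2a\gamma_1\gamma_2-\gamma_1^2+\gamma_2^2-\gamma_1\frac{a_u}{(1+a^2)\Phi}-\gamma_2\frac{a_v}{(1+a^2)\Psi}-\frac{a_{uv}}{(1+a^2)\Phi\Psi}+\frac{a\,a_ua_v}{(1+a^2)^2\Phi\Psi}+\frac{\alpha^2}{1+a^2}=0, $$ $$ (\log\Phi)_v+af_u\,\frac{a_v\gamma_1-(1+a^2)f_v\gamma_2}{a_u\gamma_2+(1+a^2)f_u\gamma_1}=f_v, $$ $$ (\log\Psi)_u+af_v\,\frac{a_u\gamma_2+(1+a^2)f_u\gamma_1}{-a_v\gamma_1+(1+a^2)f_v\gamma_2}=f_u. $$ Then there exists a unique (up to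 a motion) time-like surface $z=z(u,v)$ in $\mathbb R^3_1$, defined in a neighbourhood of $(u_0,v_0)$, whose basic asymptotic invariants are the given functions $\gamma_1,\gamma_2,a,\alpha$. Moreover, $(u,v)$ are asymptotic parameters of this surface.
   Context: $\mathbb R^3_1$ is $\mathbb R^3$ with the scalar product $\langle x,y\rangle=x_1y_1+x_2y_2-x_3y_3$; write $x^2=\langle x,x\rangle$. A vector $x$ is space-like, time-like or light-like if $\langle x,x\rangle$ is $>0$, $<0$ or $=0$. A (smooth, regular, parametrized) surface $z=z(u,v)$ in $\mathbb R^3_1$ is time-like if its normal vector is space-like at every point (equivalently, the induced metric is Lorentzian). Let $E=z_u^2$, $F=\langle z_u,z_v\rangle$, $G=z_v^2$; let $n$ be the unit normal ($n^2=1$) such that $\{z_u,z_v,n\}$ is positively oriented; let $L=\langle n,z_{uu}\rangle$, $M=\langle n,z_{uv}\rangle$, $N=\langle n,z_{vv}\rangle$. The Gauss and mean curvatures are $K=\frac{LN-M^2}{EG-F^2}$ and $H=\frac{EN-2FM+GL}{2(EG-F^2)}$. The parameters $(u,v)$ are asymptotic if $L=N=0$. The surfaces considered are time-like with $K-H^2>0$, parametrized by asymptotic parameters $(u,v)$ with $E>0$, $G<0$. For such a parametrized surface put $$ a=\frac{F}{\sqrt E\sqrt{-G}},\qquad \alpha=\frac{M}{\sqrt E\sqrt{-G}}, $$ $$ \gamma_1=-\frac1{1+a^2}\left(\frac{a_u}{\sqrt E}+a\frac{(\sqrt{-G})_u}{\sqrt E\sqrt{-G}}-\frac{(\sqrt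 E)_v}{\sqrt E\sqrt{-G}}\right),\qquad \gamma_2=\frac1{1+a^2}\left(\frac{a_v}{\sqrt{-G}}+a\frac{(\sqrt E)_v}{\sqrt E\sqrt{-G}}+\frac{(\sqrt{-G})_u}{\sqrt E\sqrt{-G}}\right). $$ The functions $\gamma_1,\gamma_2,a,\alpha$ are called the basic asymptotic invariants of the surface. The statement is local: the surface is defined on a possibly smaller neighbourhood of $(u_0,v_0)$, and uniqueness is among time-like surfaces in $\mathbb R^3_1$ with $K-H^2>0$ for which $(u,v)$ are asymptotic parameters with $E>0$, $G<0$ (on a common connected neighbourhood). A motion is a map $p\mapsto Ap+b$ where $A$ is a linear isometry of $\mathbb R^3_1$ with $\det A=1$. *)

theory Defs
  imports "HOL-Analysis.Analysis"
begin

section \<open>Functions of two real variables\<close>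

definition du :: "(real \<times> real \<Rightarrow> 'b::real_normed_vector) \<Rightarrow> real \<times> real \<Rightarrow> 'b" where
  "du f p = frechet_derivative f (at p) (1, 0)"

definition dv :: "(real \<times> real \<Rightarrow> 'b::real_normed_vector) \<Rightarrow> real \<times> real \<Rightarrow> 'b" where
  "dv f p = frechet_derivative f (at p) (0, 1)"

text \<open>Only used for open sets: \<open>f\<close> is \<open>k\<close> times continuously differentiable on \<open>S\<close>.\<close>

primrec Ck_on :: "nat \<Rightarrow> 'a::real_normed_vector set \<Rightarrow> ('a \<Rightarrow> 'b::real_normed_vector) \<Rightarrow> bool" where
  "Ck_on 0 S f \<longleftrightarrow> continuous_on S f"
| "Ck_on (Suc k) S f \<longleftrightarrow>
     (\<forall>x\<in>S. f differentiable (at x)) \<and> (\<forall>h. Ck_on k S (\<lambda>x. frechet_derivative f (at x) h))"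

definition smooth_on :: "'a::real_normed_vector set \<Rightarrow> ('a \<Rightarrow> 'b::real_normed_vector) \<Rightarrow> bool" where
  "smooth_on S f \<longleftrightarrow> (\<forall>k. Ck_on k S f)"

section \<open>Minkowski space and its motions\<close>

definition mink :: "real^3 \<Rightarrow> real^3 \<Rightarrow> real" where
  "mink x y = x$1 * y$1 + x$2 * y$2 - x$3 * y$3"

definition spacelike :: "real^3 \<Rightarrow> bool" where
  "spacelike x \<longleftrightarrow> mink x x > 0"

definition motion :: "(real^3 \<Rightarrow> real^3) \<Rightarrow> bool" where
  "motion T \<longleftrightarrow> (\<exists>(A :: real^3^3) b. (\<forall>x y. mink (A *v x) (A *v y) = mink x y) \<and> det A = 1 \<and>
                   (\<forall>p. T p = A *v p + b))"

section \<open>Parametrized surfaces\<close>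

type_synonym surface = "real \<times> real \<Rightarrow> real^3"

definition regular_surface :: "(real \<times> real) set \<Rightarrow> surface \<Rightarrow> bool" where
  "regular_surface W z \<longleftrightarrow> smooth_on W z \<and> (\<forall>p\<in>W. inj (frechet_derivative z (at p)))"

definition normal_vector :: "surface \<Rightarrow> real \<times> real \<Rightarrow> real^3 \<Rightarrow> bool" where
  "normal_vector z p m \<longleftrightarrow> m \<noteq> 0 \<and> mink m (du z p) = 0 \<and> mink m (dv z p) = 0"

text \<open>At a regular point the normal vectors are the nonzero multiples of a single vector, so it
  does not matter which of them is tested.\<close>

definition timelike_surface :: "(real \<times> real) set \<Rightarrow> surface \<Rightarrow> bool" where
  "timelike_surface W z \<longleftrightarrow>
     regular_surface W z \<and> (\<forall>p\<in>W. \<forall>m. normal_vector z p m \<longrightarrow> spacelike m)"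

definition unit_normal :: "surface \<Rightarrow> real \<times> real \<Rightarrow> real^3" where
  "unit_normal z p = (THE m. normal_vector z p m \<and> mink m m = 1 \<and>
                             det (vector [du z p, dv z p, m] :: real^3^3) > 0)"

definition coeff_E :: "surface \<Rightarrow> real \<times> real \<Rightarrow> real" where
  "coeff_E z p = mink (du z p) (du z p)"

definition coeff_F :: "surface \<Rightarrow> real \<times> real \<Rightarrow> real" where
  "coeff_F z p = mink (du z p) (dv z p)"

definition coeff_G :: "surface \<Rightarrow> real \<times> real \<Rightarrow> real" where
  "coeff_G z p = mink (dv z p) (dv z p)"

definition coeff_L :: "surface \<Rightarrow> real \<times> real \<Rightarrow> real" where
  "coeff_L z p = mink (unit_normal z p) (du (du z) p)"

definition coeff_M :: "surface \<Rightarrow> real \<times> real \<Rightarrow> real" where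
  "coeff_M z p = mink (unit_normal z p) (dv (du z) p)"

definition coeff_N :: "surface \<Rightarrow> real \<times> real \<Rightarrow> real" where
  "coeff_N z p = mink (unit_normal z p) (dv (dv z) p)"

definition gauss_curvature :: "surface \<Rightarrow> real \<times> real \<Rightarrow> real" where
  "gauss_curvature z p =
     (coeff_L z p * coeff_N z p - (coeff_M z p)\<^sup>2) / (coeff_E z p * coeff_G z p - (coeff_F z p)\<^sup>2)"

definition mean_curvature :: "surface \<Rightarrow> real \<times> real \<Rightarrow> real" where
  "mean_curvature z p =
     (coeff_E z p * coeff_N z p - 2 * coeff_F z p * coeff_M z p + coeff_G z p * coeff_L z p) /
     (2 * (coeff_E z p * coeff_G z p - (coeff_F z p)\<^sup>2))"

definition asymptotic_parameters :: "(real \<times> real) set \<Rightarrow> surface \<Rightarrow> bool" where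
  "asymptotic_parameters W z \<longleftrightarrow> (\<forall>p\<in>W. coeff_L z p = 0 \<and> coeff_N z p = 0)"

definition admissible_surface :: "(real \<times> real) set \<Rightarrow> surface \<Rightarrow> bool" where
  "admissible_surface W z \<longleftrightarrow>
     timelike_surface W z \<and> asymptotic_parameters W z \<and>
     (\<forall>p\<in>W. gauss_curvature z p - (mean_curvature z p)\<^sup>2 > 0 \<and> coeff_E z p > 0 \<and> coeff_G z p < 0)"

section \<open>Basic asymptotic invariants\<close>

definition sqrt_E :: "surface \<Rightarrow> real \<times> real \<Rightarrow> real" where
  "sqrt_E z p = sqrt (coeff_E z p)"

definition sqrt_mG :: "surface \<Rightarrow> real \<times> real \<Rightarrow> real" where
  "sqrt_mG z p = sqrt (- coeff_G z p)"

definition inv_a :: "surface \<Rightarrow> real \<times> real \<Rightarrow> real" where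
  "inv_a z p = coeff_F z p / (sqrt_E z p * sqrt_mG z p)"

definition inv_alpha :: "surface \<Rightarrow> real \<times> real \<Rightarrow> real" where
  "inv_alpha z p = coeff_M z p / (sqrt_E z p * sqrt_mG z p)"

definition inv_gamma1 :: "surface \<Rightarrow> real \<times> real \<Rightarrow> real" where
  "inv_gamma1 z p = - (1 / (1 + (inv_a z p)\<^sup>2)) *
     (du (inv_a z) p / sqrt_E z p
      + inv_a z p * (du (sqrt_mG z) p / (sqrt_E z p * sqrt_mG z p))
      - dv (sqrt_E z) p / (sqrt_E z p * sqrt_mG z p))"

definition inv_gamma2 :: "surface \<Rightarrow> real \<times> real \<Rightarrow> real" where
  "inv_gamma2 z p = (1 / (1 + (inv_a z p)\<^sup>2)) *
     (dv (inv_a z) p / sqrt_mG z p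
      + inv_a z p * (dv (sqrt_E z) p / (sqrt_E z p * sqrt_mG z p))
      + du (sqrt_mG z) p / (sqrt_E z p * sqrt_mG z p))"

definition has_invariants ::
  "(real \<times> real) set \<Rightarrow> surface \<Rightarrow> (real \<times> real \<Rightarrow> real) \<Rightarrow> (real \<times> real \<Rightarrow> real) \<Rightarrow>
   (real \<times> real \<Rightarrow> real) \<Rightarrow> (real \<times> real \<Rightarrow> real) \<Rightarrow> bool" where
  "has_invariants W z \<gamma>1 \<gamma>2 a \<alpha> \<longleftrightarrow>
     (\<forall>p\<in>W. inv_gamma1 z p = \<gamma>1 p \<and> inv_gamma2 z p = \<gamma>2 p \<and> inv_a z p = a p \<and> inv_alpha z p = \<alpha> p)"

end

(*
  Along a surface in asymptotic parameters take the orthonormal frame x = z_u / s,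
  w = (z_v / t - a x) / sqrt (1 + a^2), n, where s = sqrt E and t = sqrt (-G). By the definition of
  the invariants the coefficients of its frame equations are expressions in gamma1, gamma2, a, alpha,
  s and t alone. Once the derivatives of s and t are eliminated, the Codazzi equations become two
  linear equations for 1/s and 1/t whose only solution is s = Phi, t = Psi. So two surfaces with the
  same invariants satisfy the same linear total system; the Minkowski pairing of their two frames is
  constant, and they differ by a motion.

  Conversely, with s = Phi and t = Psi the three equations of the theorem are exactly the Gauss and
  Codazzi equations, i.e. the integrability conditions of the linear total system for (z, x, w, n).
  That system is solved by a contraction on a small rectangle with initial values at its corner, and
  the same pairing argument shows that the solution frame stays orthonormal.
*)
theory Submission
  imports Defs
begin

section \<open>Functions with partial derivatives\<close>

text \<open>Frames are compared through the pairing
  \<open>x$i * x'$j - w$i * w'$j + n$i * n'$j\<close>, not through Gram matrices. The Gram matrix of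
  a solution only satisfies another linear system, so its constancy would call for a uniqueness
  theorem. The derivative of the pairing cancels term by term for any two solutions, and an
  inverse-matrix identity turns the pairing back into orthonormality.

  The formulas for \<Phi> and \<Psi> are Cramer's rule. With c = 1 + a^2 the two linear equations
  are t (s \<gamma>1 + a_u / c) = s f_v and s (t \<gamma>2 - a_v / c) = t f_u; divided by s t they
  are linear in 1/s and 1/t with determinant (a_u a_v + c^2 f_u f_v) / c^2.

  The total system is solved by integrating to the right and upwards only, which is why the initial
  point is a corner. Differentiability is obtained in the open rectangle, and continuity up to the
  boundary carries the initial values inside.\<close>

definition has_partials ::
  "(real \<times> real \<Rightarrow> 'b::real_normed_vector) \<Rightarrow> 'b \<Rightarrow> 'b \<Rightarrow> real \<times> real \<Rightarrow> bool" where
  "has_partials g gu gv p \<longleftrightarrow> (g has_derivative (\<lambda>h. fst h *\<^sub>R gu + snd h *\<^sub>R gv)) (at p)"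

lemma has_partials_frechet:
  "has_partials g gu gv p \<Longrightarrow> frechet_derivative g (at p) = (\<lambda>h. fst h *\<^sub>R gu + snd h *\<^sub>R gv)"
  unfolding has_partials_def by (metis frechet_derivative_at)

lemma has_partials_du: "has_partials g gu gv p \<Longrightarrow> du g p = gu"
  and has_partials_dv: "has_partials g gu gv p \<Longrightarrow> dv g p = gv"
  by (simp_all add: du_def dv_def has_partials_frechet)

lemma has_partials_differentiable: "has_partials g gu gv p \<Longrightarrow> g differentiable at p"
  unfolding has_partials_def differentiable_def by blast

lemma has_partials_continuous: "has_partials g gu gv p \<Longrightarrow> isCont g p"
  using has_partials_differentiable differentiable_imp_continuous_within by blast

lemma has_partials_iff:
  "has_partials g gu gv p \<longleftrightarrow> g differentiable at p \<and> du g p = gu \<and> dv g p = gv"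
proof safe
  assume "g differentiable at p"
  then have D: "(g has_derivative frechet_derivative g (at p)) (at p)"
    by (simp add: frechet_derivative_works)
  then interpret bounded_linear "frechet_derivative g (at p)"
    by (rule has_derivative_bounded_linear)
  have eq: "frechet_derivative g (at p) h = fst h *\<^sub>R du g p + snd h *\<^sub>R dv g p" for h
  proof -
    have h: "h = fst h *\<^sub>R (1, 0) + snd h *\<^sub>R (0, 1)"
      by (cases h) auto
    show ?thesis
      by (subst h) (simp only: add scaleR du_def dv_def)
  qed
  from D show "has_partials g (du g p) (dv g p) p"
    unfolding has_partials_def by (rule has_derivative_eq_rhs) (rule ext, rule eq)
qed (auto simp: has_partials_du has_partials_dv has_partials_differentiable)

lemma has_partialsI: "g differentiable at p \<Longrightarrow> has_partials g (du g p) (dv g p) p"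
  by (simp add: has_partials_iff)

lemma has_partials_cong:
  assumes "has_partials g gu gv p" "open S" "p \<in> S" "\<And>q. q \<in> S \<Longrightarrow> g q = h q"
  shows "has_partials h gu gv p"
  using has_derivative_transform_within_open[OF assms(1)[unfolded has_partials_def] assms(2-4)]
  by (simp add: has_partials_def)

lemma has_partials_const: "has_partials (\<lambda>_. c) 0 0 p"
  by (simp add: has_partials_def)

lemma has_partials_add:
  "has_partials g gu gv p \<Longrightarrow> has_partials h hu hv p \<Longrightarrow>
   has_partials (\<lambda>q. g q + h q) (gu + hu) (gv + hv) p"
  unfolding has_partials_def
  by (drule (1) has_derivative_add) (simp add: algebra_simps)

lemma has_partials_minus:
  "has_partials g gu gv p \<Longrightarrow> has_partials (\<lambda>q. - g q) (- gu) (- gv) p"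
  unfolding has_partials_def
  by (drule has_derivative_minus) (simp add: algebra_simps)

lemma has_partials_diff:
  "has_partials g gu gv p \<Longrightarrow> has_partials h hu hv p \<Longrightarrow>
   has_partials (\<lambda>q. g q - h q) (gu - hu) (gv - hv) p"
  unfolding has_partials_def
  by (drule (1) has_derivative_diff) (simp add: algebra_simps)

lemma (in bounded_linear) has_partials:
  "has_partials g gu gv p \<Longrightarrow> has_partials (\<lambda>q. f (g q)) (f gu) (f gv) p"
  unfolding has_partials_def
  by (drule has_derivative) (simp add: add scaleR)

lemma (in bounded_bilinear) has_partials:
  "has_partials g gu gv p \<Longrightarrow> has_partials h hu hv p \<Longrightarrow>
   has_partials (\<lambda>q. prod (g q) (h q)) (prod (g p) hu + prod gu (h p)) (prod (g p) hv + prod gv (h p)) p"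
  unfolding has_partials_def
  by (drule (1) FDERIV) (simp add: add_left add_right scaleR_left scaleR_right algebra_simps)

lemmas has_partials_mult =
  bounded_bilinear.has_partials[OF bounded_bilinear_mult]
lemmas has_partials_scaleR = bounded_bilinear.has_partials[OF bounded_bilinear_scaleR]
lemmas has_partials_vec_nth = bounded_linear.has_partials[OF bounded_linear_vec_nth]

lemma has_partials_Pair:
  "has_partials g gu gv p \<Longrightarrow> has_partials h hu hv p \<Longrightarrow>
   has_partials (\<lambda>q. (g q, h q)) (gu, hu) (gv, hv) p"
  unfolding has_partials_def by (drule (1) has_derivative_Pair) simp

lemmas has_partials_fst = bounded_linear.has_partials[OF bounded_linear_fst]
lemmas has_partials_snd = bounded_linear.has_partials[OF bounded_linear_snd]

lemma has_partials_Pair_iff: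
  "has_partials (\<lambda>q. (g q, h q)) (gu, hu) (gv, hv) p \<longleftrightarrow> has_partials g gu gv p \<and> has_partials h hu hv p"
  using has_partials_Pair[of g gu gv p h hu hv]
    has_partials_fst[of "\<lambda>q. (g q, h q)" "(gu, hu)" "(gv, hv)" p]
    has_partials_snd[of "\<lambda>q. (g q, h q)" "(gu, hu)" "(gv, hv)" p] by auto

lemma has_partials_compose_real:
  fixes g :: "real \<times> real \<Rightarrow> real"
  assumes "has_partials g gu gv p" "(\<phi> has_field_derivative d) (at (g p))"
  shows "has_partials (\<lambda>q. \<phi> (g q)) (d * gu) (d * gv) p"
  using has_derivative_compose[OF assms(1)[unfolded has_partials_def]
      assms(2)[unfolded has_field_derivative_def]]
  by (simp add: has_partials_def algebra_simps)

lemma has_partials_inverse: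
  fixes g :: "real \<times> real \<Rightarrow> real"
  assumes "has_partials g gu gv p" "g p \<noteq> 0"
  shows "has_partials (\<lambda>q. inverse (g q)) (- gu / (g p)\<^sup>2) (- gv / (g p)\<^sup>2) p"
  using has_partials_compose_real[OF assms(1) DERIV_inverse[OF assms(2)]]
  by (simp add: power2_eq_square divide_simps)

lemma has_partials_divide:
  fixes g h :: "real \<times> real \<Rightarrow> real"
  assumes "has_partials g gu gv p" "has_partials h hu hv p" "h p \<noteq> 0"
  shows "has_partials (\<lambda>q. g q / h q)
    ((gu * h p - g p * hu) / (h p)\<^sup>2) ((gv * h p - g p * hv) / (h p)\<^sup>2) p"
  using has_partials_mult[OF assms(1) has_partials_inverse[OF assms(2,3)]] assms(3)
  by (simp add: has_partials_iff field_simps power2_eq_square)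

lemma has_partials_sqrt:
  assumes "has_partials g gu gv p" "g p > 0"
  shows "has_partials (\<lambda>q. sqrt (g q)) (gu / (2 * sqrt (g p))) (gv / (2 * sqrt (g p))) p"
proof -
  have "inverse (sqrt (g p)) / 2 * d = d / (2 * sqrt (g p))" for d
    by (simp add: field_simps)
  then show ?thesis
    using has_partials_compose_real[OF assms(1) DERIV_real_sqrt[OF assms(2)]] by metis
qed

lemma has_partials_ln:
  fixes g :: "real \<times> real \<Rightarrow> real"
  assumes "has_partials g gu gv p" "g p > 0"
  shows "has_partials (\<lambda>q. ln (g q)) (gu / g p) (gv / g p) p"
  using has_partials_compose_real[OF assms(1) DERIV_ln[OF assms(2)]]
  by (simp add: divide_simps)

section \<open>Smooth functions\<close>

lemma Ck_on_cong:
  "Ck_on k S f \<Longrightarrow> open S \<Longrightarrow> (\<And>x. x \<in> S \<Longrightarrow> f x = g x) \<Longrightarrow> Ck_on k S g"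
proof (induction k arbitrary: f g)
  case 0
  then show ?case by (simp cong: continuous_on_cong)
next
  case (Suc k)
  have d: "(g has_derivative frechet_derivative f (at x)) (at x)" if "x \<in> S" for x
    by (rule has_derivative_transform_within_open[of f _ _ _ S])
       (use Suc.prems that in \<open>auto simp: frechet_derivative_works[symmetric]\<close>)
  have "frechet_derivative f (at x) = frechet_derivative g (at x)" if "x \<in> S" for x
    using d[OF that] by (metis frechet_derivative_at)
  then have "Ck_on k S (\<lambda>x. frechet_derivative g (at x) h)" for h
    using Suc.IH[of "\<lambda>x. frechet_derivative f (at x) h"] Suc.prems(1,2) by simp
  moreover have "g differentiable at x" if "x \<in> S" for x
    using d[OF that] differentiable_def by blast
  ultimately show ?case by simp
qed

text \<open>\<open>Ck_on\<close> refers to \<open>frechet_derivative\<close>; this form accepts any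
  known derivative formula on an open set, so that the closure properties below follow by induction
  from the rules of differentiation.\<close>

lemma Ck_on_SucI:
  assumes "open S" "\<And>x. x \<in> S \<Longrightarrow> (f has_derivative f' x) (at x)" "\<And>h. Ck_on k S (\<lambda>x. f' x h)"
  shows "Ck_on (Suc k) S f"
proof -
  have "frechet_derivative f (at x) = f' x" if "x \<in> S" for x
    using assms(2)[OF that] by (metis frechet_derivative_at)
  then have "Ck_on k S (\<lambda>x. frechet_derivative f (at x) h)" for h
    by (intro Ck_on_cong[OF assms(3)]) (use assms in auto)
  moreover have "f differentiable at x" if "x \<in> S" for x
    using assms(2)[OF that] differentiable_def by blast
  ultimately show ?thesis by simp
qed

lemma Ck_on_continuous: "Ck_on k S f \<Longrightarrow> continuous_on S f"
  by (cases k) (auto intro!: continuous_at_imp_continuous_on differentiable_imp_continuous_within)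

lemma Ck_on_SucD: "Ck_on (Suc k) S f \<Longrightarrow> Ck_on k S (\<lambda>x. frechet_derivative f (at x) h)"
  by simp

lemma Ck_on_Suc_imp: "Ck_on (Suc k) S f \<Longrightarrow> Ck_on k S f"
proof (induction k arbitrary: f)
  case 0
  then show ?case using Ck_on_continuous[of "Suc 0"] by simp
next
  case (Suc k)
  have "Ck_on k S (\<lambda>x. frechet_derivative f (at x) h)" for h
    by (rule Suc.IH[OF Ck_on_SucD[OF Suc.prems]])
  with Suc.prems show ?case by simp
qed

lemma Ck_on_has_derivative:
  "Ck_on (Suc k) S f \<Longrightarrow> x \<in> S \<Longrightarrow> (f has_derivative frechet_derivative f (at x)) (at x)"
  by (simp add: frechet_derivative_works[symmetric])

lemma Ck_on_const: "open S \<Longrightarrow> Ck_on k S (\<lambda>_. c)"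
proof (induction k arbitrary: c)
  case (Suc k)
  show ?case by (rule Ck_on_SucI[OF Suc.prems has_derivative_const]) (use Suc in auto)
qed simp

lemma Ck_on_add:
  "open S \<Longrightarrow> Ck_on k S f \<Longrightarrow> Ck_on k S g \<Longrightarrow> Ck_on k S (\<lambda>x. f x + g x)"
proof (induction k arbitrary: f g)
  case (Suc k)
  show ?case
    by (rule Ck_on_SucI[OF \<open>open S\<close> has_derivative_add[OF Ck_on_has_derivative[OF Suc.prems(2)]
          Ck_on_has_derivative[OF Suc.prems(3)]]])
      (use Suc.prems in \<open>auto simp del: Ck_on.simps intro!: Suc.IH Ck_on_SucD\<close>)
qed (auto intro: continuous_intros)

lemma (in bounded_linear) Ck_on:
  "open S \<Longrightarrow> Ck_on k S g \<Longrightarrow> Ck_on k S (\<lambda>x. f (g x))"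
proof (induction k arbitrary: g)
  case (Suc k)
  show ?case
    by (rule Ck_on_SucI[OF \<open>open S\<close> has_derivative[OF Ck_on_has_derivative[OF Suc.prems(2)]]])
      (use Suc.prems in \<open>auto simp del: Ck_on.simps intro!: Suc.IH Ck_on_SucD\<close>)
qed (auto intro: continuous_on)

lemma (in bounded_bilinear) Ck_on:
  "open S \<Longrightarrow> Ck_on k S f \<Longrightarrow> Ck_on k S g \<Longrightarrow> Ck_on k S (\<lambda>x. prod (f x) (g x))"
proof (induction k arbitrary: f g)
  case (Suc k)
  show ?case
    by (rule Ck_on_SucI[OF \<open>open S\<close> FDERIV[OF Ck_on_has_derivative[OF Suc.prems(2)]
          Ck_on_has_derivative[OF Suc.prems(3)]]])
      (assumption | intro Ck_on_add Suc.IH \<open>open S\<close> Ck_on_SucD[OF Suc.prems(2)] Ck_on_SucD[OF Suc.prems(3)]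
         Ck_on_Suc_imp[OF Suc.prems(2)] Ck_on_Suc_imp[OF Suc.prems(3)])+
qed (auto intro: continuous_on)

lemma Ck_on_Pair:
  "open S \<Longrightarrow> Ck_on k S f \<Longrightarrow> Ck_on k S g \<Longrightarrow> Ck_on k S (\<lambda>x. (f x, g x))"
proof (induction k arbitrary: f g)
  case (Suc k)
  show ?case
    by (rule Ck_on_SucI[OF \<open>open S\<close> has_derivative_Pair[OF Ck_on_has_derivative[OF Suc.prems(2)]
          Ck_on_has_derivative[OF Suc.prems(3)]]])
      (use Suc.prems in \<open>auto simp del: Ck_on.simps intro!: Suc.IH Ck_on_SucD\<close>)
qed (auto intro: continuous_intros)

text \<open>The derivative of the inverse is a polynomial in the inverse itself and the derivative
  of \<open>g\<close>, so one order of smoothness of the inverse yields the next.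
  \<open>Ck_on_sqrt\<close> bootstraps in the same way; \<open>Ck_on_ln\<close> falls back on the
  inverse.\<close>

lemma Ck_on_inverse:
  fixes g :: "'a::real_normed_vector \<Rightarrow> real"
  assumes "open S" "\<And>x. x \<in> S \<Longrightarrow> g x \<noteq> 0"
  shows "Ck_on k S g \<Longrightarrow> Ck_on k S (\<lambda>x. inverse (g x))"
proof (induction k)
  case (Suc k)
  note m = bounded_bilinear.Ck_on[OF bounded_bilinear_mult \<open>open S\<close>]
  note neg = bounded_linear.Ck_on[OF bounded_linear_minus[OF bounded_linear_ident] \<open>open S\<close>]
  note IH = Suc.IH[OF Ck_on_Suc_imp[OF Suc.prems]]
  show ?case
    by (rule Ck_on_SucI[OF \<open>open S\<close> Deriv.has_derivative_inverse[OF assms(2) Ck_on_has_derivative[OF Suc.prems]]])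
       (assumption | intro neg m IH Ck_on_SucD[OF Suc.prems])+
qed (use assms in \<open>auto intro: continuous_on_inverse\<close>)

lemma Ck_on_ln:
  fixes g :: "'a::real_normed_vector \<Rightarrow> real"
  assumes "open S" "\<And>x. x \<in> S \<Longrightarrow> g x > 0"
  shows "Ck_on k S g \<Longrightarrow> Ck_on k S (\<lambda>x. ln (g x))"
proof (induction k)
  case (Suc k)
  note m = bounded_bilinear.Ck_on[OF bounded_bilinear_mult \<open>open S\<close>]
  have nz: "g x \<noteq> 0" if "x \<in> S" for x
    using assms(2)[OF that] by simp
  have "((\<lambda>x. ln (g x)) has_derivative (\<lambda>h. frechet_derivative g (at x) h * inverse (g x))) (at x)"
    if "x \<in> S" for x
    using has_derivative_ln[OF assms(2)[OF that] Ck_on_has_derivative[OF Suc.prems that]]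
    by (simp add: divide_inverse)
  then show ?case
    by (rule Ck_on_SucI[OF \<open>open S\<close>])
       (assumption | intro m Ck_on_inverse[OF \<open>open S\<close> nz] Ck_on_SucD[OF Suc.prems]
          Ck_on_Suc_imp[OF Suc.prems])+
qed (use assms in \<open>force intro!: continuous_on_ln\<close>)

lemma Ck_on_sqrt:
  fixes g :: "'a::real_normed_vector \<Rightarrow> real"
  assumes "open S" "\<And>x. x \<in> S \<Longrightarrow> g x > 0"
  shows "Ck_on k S g \<Longrightarrow> Ck_on k S (\<lambda>x. sqrt (g x))"
proof (induction k)
  case (Suc k)
  note m = bounded_bilinear.Ck_on[OF bounded_bilinear_mult \<open>open S\<close>]
  note IH = Suc.IH[OF Ck_on_Suc_imp[OF Suc.prems]]
  have nz: "sqrt (g x) \<noteq> 0" if "x \<in> S" for x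
    using assms(2)[OF that] by simp
  have "((\<lambda>x. sqrt (g x)) has_derivative
      (\<lambda>h. frechet_derivative g (at x) h * (inverse (sqrt (g x)) * (1/2)))) (at x)"
    if "x \<in> S" for x
    by (rule has_derivative_eq_rhs[OF has_derivative_real_sqrt[OF assms(2)[OF that]
          Ck_on_has_derivative[OF Suc.prems that]]]) (simp add: fun_eq_iff field_simps)
  then show ?case
    by (rule Ck_on_SucI[OF \<open>open S\<close>])
       (assumption | intro m Ck_on_inverse[OF \<open>open S\<close> nz] Ck_on_const[OF \<open>open S\<close>] IH
          Ck_on_SucD[OF Suc.prems])+
qed (auto intro: continuous_intros)

lemma smooth_on_cong:
  "smooth_on S f \<Longrightarrow> open S \<Longrightarrow> (\<And>x. x \<in> S \<Longrightarrow> f x = g x) \<Longrightarrow> smooth_on S g"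
  unfolding smooth_on_def using Ck_on_cong by blast

lemma smooth_on_subset:
  assumes "smooth_on S f" "T \<subseteq> S"
  shows "smooth_on T f"
proof -
  have "Ck_on k S g \<Longrightarrow> Ck_on k T g" for k and g :: "'a \<Rightarrow> 'b"
    using assms(2) by (induction k arbitrary: g) (auto intro: continuous_on_subset)
  with assms(1) show ?thesis by (simp add: smooth_on_def)
qed

lemma smooth_on_const: "open S \<Longrightarrow> smooth_on S (\<lambda>_. c)"
  by (simp add: smooth_on_def Ck_on_const)

lemma smooth_on_add:
  "open S \<Longrightarrow> smooth_on S f \<Longrightarrow> smooth_on S g \<Longrightarrow> smooth_on S (\<lambda>x. f x + g x)"
  by (simp add: smooth_on_def Ck_on_add)

lemma (in bounded_linear) smooth_on:
  "open S \<Longrightarrow> smooth_on S g \<Longrightarrow> smooth_on S (\<lambda>x. f (g x))"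
  by (simp add: smooth_on_def Ck_on)

lemma (in bounded_bilinear) smooth_on:
  "open S \<Longrightarrow> smooth_on S f \<Longrightarrow> smooth_on S g \<Longrightarrow> smooth_on S (\<lambda>x. prod (f x) (g x))"
  by (simp add: smooth_on_def Ck_on)

lemma smooth_on_minus: "open S \<Longrightarrow> smooth_on S f \<Longrightarrow> smooth_on S (\<lambda>x. - f x)"
  by (rule bounded_linear.smooth_on[OF bounded_linear_minus[OF bounded_linear_ident]])

lemma smooth_on_diff:
  "open S \<Longrightarrow> smooth_on S f \<Longrightarrow> smooth_on S g \<Longrightarrow> smooth_on S (\<lambda>x. f x - g x)"
  using smooth_on_add[of S f "\<lambda>x. - g x"] by (simp add: smooth_on_minus)

lemmas smooth_on_mult = bounded_bilinear.smooth_on[OF bounded_bilinear_mult]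
lemmas smooth_on_scaleR = bounded_bilinear.smooth_on[OF bounded_bilinear_scaleR]

lemma smooth_on_Pair:
  "open S \<Longrightarrow> smooth_on S f \<Longrightarrow> smooth_on S g \<Longrightarrow> smooth_on S (\<lambda>x. (f x, g x))"
  by (simp add: smooth_on_def Ck_on_Pair)

lemma smooth_on_power:
  fixes f :: "'a::real_normed_vector \<Rightarrow> real"
  shows "open S \<Longrightarrow> smooth_on S f \<Longrightarrow> smooth_on S (\<lambda>x. f x ^ n)"
  by (induction n) (auto intro: smooth_on_const smooth_on_mult)

lemma smooth_on_divide:
  fixes f g :: "'a::real_normed_vector \<Rightarrow> real"
  shows "open S \<Longrightarrow> smooth_on S f \<Longrightarrow> smooth_on S g \<Longrightarrow> (\<And>x. x \<in> S \<Longrightarrow> g x \<noteq> 0) \<Longrightarrow>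
    smooth_on S (\<lambda>x. f x / g x)"
  unfolding divide_inverse by (rule smooth_on_mult) (auto simp: smooth_on_def Ck_on_inverse)

lemma smooth_on_sqrt:
  fixes g :: "'a::real_normed_vector \<Rightarrow> real"
  shows "open S \<Longrightarrow> smooth_on S g \<Longrightarrow> (\<And>x. x \<in> S \<Longrightarrow> g x > 0) \<Longrightarrow> smooth_on S (\<lambda>x. sqrt (g x))"
  by (simp add: smooth_on_def Ck_on_sqrt)

lemma smooth_on_ln:
  fixes g :: "'a::real_normed_vector \<Rightarrow> real"
  shows "open S \<Longrightarrow> smooth_on S g \<Longrightarrow> (\<And>x. x \<in> S \<Longrightarrow> g x > 0) \<Longrightarrow> smooth_on S (\<lambda>x. ln (g x))"
  by (simp add: smooth_on_def Ck_on_ln)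

lemma smooth_on_differentiable: "smooth_on S f \<Longrightarrow> p \<in> S \<Longrightarrow> f differentiable at p"
  unfolding smooth_on_def by (metis Ck_on.simps(2))

lemma smooth_on_continuous: "smooth_on S f \<Longrightarrow> continuous_on S f"
  unfolding smooth_on_def by (metis Ck_on.simps(1))

lemma smooth_on_du: "smooth_on S f \<Longrightarrow> smooth_on S (du f)"
  and smooth_on_dv: "smooth_on S f \<Longrightarrow> smooth_on S (dv f)"
  unfolding smooth_on_def du_def[abs_def] dv_def[abs_def] by (metis Ck_on.simps(2))+

lemma smooth_on_has_partials: "smooth_on S f \<Longrightarrow> p \<in> S \<Longrightarrow> has_partials f (du f p) (dv f p) p"
  by (simp add: has_partialsI smooth_on_differentiable)

lemmas smooth_on_intros =
  smooth_on_const smooth_on_add smooth_on_minus smooth_on_diff smooth_on_mult smooth_on_scaleR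
  smooth_on_power smooth_on_divide smooth_on_sqrt smooth_on_ln smooth_on_du smooth_on_dv

section \<open>Symmetry of second derivatives\<close>

lemma has_partials_has_vector_derivative_fst:
  assumes "has_partials g gu gv (x, y)"
  shows "((\<lambda>s. g (s, y)) has_vector_derivative gu) (at x within T)"
proof -
  have "((\<lambda>s. (s, y)) has_derivative (\<lambda>h. (h, 0))) (at x within T)"
    by (auto intro!: derivative_eq_intros)
  from has_derivative_compose[OF this assms[unfolded has_partials_def]] show ?thesis
    by (simp add: has_vector_derivative_def)
qed

lemma has_partials_has_vector_derivative_snd:
  assumes "has_partials g gu gv (x, y)"
  shows "((\<lambda>s. g (x, s)) has_vector_derivative gv) (at y within T)"
proof -
  have "((\<lambda>s. (x, s)) has_derivative (\<lambda>h. (0, h))) (at y within T)"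
    by (auto intro!: derivative_eq_intros)
  from has_derivative_compose[OF this assms[unfolded has_partials_def]] show ?thesis
    by (simp add: has_vector_derivative_def)
qed

lemma open_contains_rectangle:
  fixes D :: "(real \<times> real) set"
  assumes "open D" "(u, v) \<in> D"
  obtains d where "d > 0" "{u - d..u + d} \<times> {v - d..v + d} \<subseteq> D"
proof -
  obtain U V where "open U" "open V" "(u, v) \<in> U \<times> V" "U \<times> V \<subseteq> D"
    using open_prod_elim[OF assms] by metis
  moreover then obtain e1 e2 where "e1 > 0" "cball u e1 \<subseteq> U" "e2 > 0" "cball v e2 \<subseteq> V"
    using open_contains_cball by (metis mem_Sigma_iff)
  ultimately show ?thesis
    by (intro that[of "min e1 e2"]) (force simp: cball_def dist_real_def)+
qed

text \<open>One-sided derivatives at the ends of the parameter interval suffice; in the construction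
  of solutions below nothing more is available there.\<close>

lemma has_vector_derivative_integral_param:
  fixes g :: "real \<times> real \<Rightarrow> 'b::banach"
  assumes "\<And>x t. x \<in> {l..r} \<Longrightarrow> t \<in> {k..m} \<Longrightarrow>
      ((\<lambda>x. g (x, t)) has_vector_derivative g' (x, t)) (at x within {l..r})"
    and "continuous_on ({l..r} \<times> {k..m}) g" "continuous_on ({l..r} \<times> {k..m}) g'"
    and "x \<in> {l..r}" "y \<in> {k..m}"
  shows "((\<lambda>x. integral {k..y} (\<lambda>t. g (x, t))) has_vector_derivative
           integral {k..y} (\<lambda>t. g' (x, t))) (at x within {l..r})"
proof -
  have "((\<lambda>x. integral (cbox k y) (\<lambda>t. g (x, t))) has_vector_derivative
           integral (cbox k y) (\<lambda>t. g' (x, t))) (at x within {l..r})"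
  proof (rule leibniz_rule_vector_derivative)
    show "(\<lambda>t. g (x, t)) integrable_on cbox k y" if "x \<in> {l..r}" for x
      using that assms(5)
      by (intro integrable_continuous continuous_on_compose2[OF assms(2)] continuous_intros) auto
    show "continuous_on ({l..r} \<times> cbox k y) (\<lambda>(x, t). g' (x, t))"
      using assms(5) by (auto intro!: continuous_on_subset[OF assms(3)])
  qed (use assms in auto)
  then show ?thesis by simp
qed

text \<open>Write g as its value on a lower edge plus the integral of \<open>dv g\<close> in y.
  Differentiating under the integral sign in x gives \<open>du g\<close> as an integral of
  \<open>du (dv g)\<close>, and the fundamental theorem of calculus then differentiates this in
  y.\<close>

lemma dv_du_commute:
  fixes g :: "real \<times> real \<Rightarrow> 'b::banach"
  assumes "open S" "p \<in> S" and g: "smooth_on S g"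
  shows "dv (du g) p = du (dv g) p"
proof -
  obtain u v where p: "p = (u, v)" by force
  obtain d where d: "d > 0" "{u - d..u + d} \<times> {v - d..v + d} \<subseteq> S"
    using open_contains_rectangle assms p by blast
  define X Y where "X = {u - d..u + d}" and "Y = {v - d..v + d}"
  have XY: "(x, y) \<in> S" if "x \<in> X" "y \<in> Y" for x y
    using d that by (auto simp: X_def Y_def)
  note hp = smooth_on_has_partials[OF _ XY]
  have c: "continuous_on (X \<times> Y) h" if "smooth_on S h" for h :: "real \<times> real \<Rightarrow> 'b"
    using d smooth_on_continuous[OF that] continuous_on_subset by (force simp: X_def Y_def)
  have cy: "continuous_on Y (\<lambda>t. h (x, t))" if "smooth_on S h" "x \<in> X" for h :: "real \<times> real \<Rightarrow> 'b" and x
    by (rule continuous_on_compose2[OF c[OF that(1)]]) (use that in \<open>auto intro!: continuous_intros\<close>)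
  have int: "g (x, y) = g (x, v - d) + integral {v - d..y} (\<lambda>t. dv g (x, t))" if "x \<in> X" "y \<in> Y" for x y
  proof -
    have "((\<lambda>t. dv g (x, t)) has_integral g (x, y) - g (x, v - d)) {v - d..y}"
      by (rule fundamental_theorem_of_calculus)
        (use that in \<open>auto simp: Y_def X_def intro!: has_partials_has_vector_derivative_snd hp[OF g]\<close>)
    then show ?thesis by (simp add: integral_unique)
  qed
  have du: "du g (u, y) = du g (u, v - d) + integral {v - d..y} (\<lambda>t. du (dv g) (u, t))"
    if "y \<in> Y" for y
  proof -
    have u: "u \<in> X" "v - d \<in> Y" using d by (auto simp: X_def Y_def)
    have "((\<lambda>x. g (x, v - d) + integral {v - d..y} (\<lambda>t. dv g (x, t))) has_vector_derivative
        du g (u, v - d) + integral {v - d..y} (\<lambda>t. du (dv g) (u, t))) (at u within X)"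
      unfolding X_def
      by (intro has_vector_derivative_add has_partials_has_vector_derivative_fst[OF hp[OF g u]]
          has_vector_derivative_integral_param[where m = "v + d"])
        (use that hp[OF g] hp[OF smooth_on_dv[OF g]] c[OF smooth_on_dv[OF g]]
             c[OF smooth_on_du[OF smooth_on_dv[OF g]]] u
          in \<open>auto simp: X_def Y_def intro!: has_partials_has_vector_derivative_fst\<close>)
    then have "((\<lambda>x. g (x, y)) has_vector_derivative
        du g (u, v - d) + integral {v - d..y} (\<lambda>t. du (dv g) (u, t))) (at u within X)"
      by (rule has_vector_derivative_transform[OF u(1), rotated]) (use that int in auto)
    moreover have "((\<lambda>x. g (x, y)) has_vector_derivative du g (u, y)) (at u within X)"
      by (rule has_partials_has_vector_derivative_fst[OF hp[OF g u(1) that]])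
    moreover have "at u within X \<noteq> bot"
      unfolding X_def using d by (auto simp: trivial_limit_within)
    ultimately show ?thesis
      using vector_derivative_unique_within by blast
  qed
  have v: "v \<in> Y" using d by (auto simp: Y_def)
  have "((\<lambda>y. du g (u, v - d) + integral {v - d..y} (\<lambda>t. du (dv g) (u, t))) has_vector_derivative
      du (dv g) (u, v)) (at v within Y)"
    unfolding Y_def
    by (rule has_vector_derivative_eq_rhs[OF has_vector_derivative_add[OF has_vector_derivative_const
          integral_has_vector_derivative]])
      (use v cy[OF smooth_on_du[OF smooth_on_dv[OF g]], of u] d in \<open>auto simp: X_def Y_def\<close>)
  then have "((\<lambda>y. du g (u, y)) has_vector_derivative du (dv g) (u, v)) (at v within Y)"
    by (rule has_vector_derivative_transform[OF v, rotated]) (use du in auto)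
  moreover have "((\<lambda>y. du g (u, y)) has_vector_derivative dv (du g) (u, v)) (at v within Y)"
    by (rule has_partials_has_vector_derivative_snd[OF hp[OF smooth_on_du[OF g] _ v]])
      (use d in \<open>auto simp: X_def\<close>)
  moreover have "at v within Y \<noteq> bot"
    unfolding Y_def using d by (auto simp: trivial_limit_within)
  ultimately show ?thesis
    using vector_derivative_unique_within p by blast
qed

section \<open>Linear total differential systems\<close>

text \<open>The variable upper limit is traded for a fixed one: integrate
  \<open>h (x, min t y)\<close>, which is continuous in all variables, over \<open>{k..m}\<close>
  and subtract the surplus \<open>(m - y) *\<^sub>R h (x, y)\<close> collected beyond y.\<close>

lemma continuous_on_integral_upto:
  fixes h :: "real \<times> real \<Rightarrow> 'b::banach"
  assumes "continuous_on (X \<times> {k..m}) h"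
  shows "continuous_on (X \<times> {k..m}) (\<lambda>(x, y). integral {k..y} (\<lambda>t. h (x, t)))"
proof -
  have eq: "integral {k..m} (\<lambda>t. h (x, min t y)) - (m - y) *\<^sub>R h (x, y) = integral {k..y} (\<lambda>t. h (x, t))"
    if "x \<in> X" "y \<in> {k..m}" for x y
  proof -
    have "continuous_on {k..m} (\<lambda>t. h (x, min t y))"
      by (rule continuous_on_compose2[OF assms]) (use that in \<open>auto intro!: continuous_intros\<close>)
    then have "integral {k..m} (\<lambda>t. h (x, min t y)) =
        integral {k..y} (\<lambda>t. h (x, min t y)) + integral {y..m} (\<lambda>t. h (x, min t y))"
      using that by (intro Henstock_Kurzweil_Integration.integral_combine[symmetric] integrable_continuous_real) auto
    also have "integral {k..y} (\<lambda>t. h (x, min t y)) = integral {k..y} (\<lambda>t. h (x, t))"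
      by (rule integral_cong) auto
    also have "integral {y..m} (\<lambda>t. h (x, min t y)) = integral {y..m} (\<lambda>t. h (x, y))"
      by (rule integral_cong) auto
    finally show ?thesis using that by simp
  qed
  have "continuous_on (X \<times> {k..m}) (\<lambda>p. integral (cbox k m) (\<lambda>t. h (fst p, min t (snd p))))"
    by (rule integral_continuous_on_param)
      (auto simp: case_prod_unfold intro!: continuous_intros continuous_on_compose2[OF assms])
  then have "continuous_on (X \<times> {k..m})
      (\<lambda>p. integral {k..m} (\<lambda>t. h (fst p, min t (snd p))) - (m - snd p) *\<^sub>R h p)"
    using assms by (auto intro!: continuous_intros)
  then show ?thesis
    by (rule continuous_on_eq) (use eq in auto)
qed

text \<open>Frobenius' theorem for a linear system on a small rectangle. Each of the two integrals
  in the fixed-point map has Lipschitz constant at most \<open>K * e\<close>, so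
  \<open>K * e \<le> 1 / 4\<close> makes the map a contraction with factor 1/2. The same bound, with
  \<open>e \<le> 1\<close> for a nested integral, kills the defect of the first equation;
  \<open>Bu\<close> is bounded as well because it is the kernel of the integral equation for that
  defect.\<close>

lemma linear_total_system_on_rectangle:
  fixes prod :: "'a::real_normed_vector \<Rightarrow> 'b::banach \<Rightarrow> 'b" (infixl "\<star>" 70)
    and A B Au Av Bu Bv :: "real \<times> real \<Rightarrow> 'a" and l r k m e K :: real
  defines "R \<equiv> {l..r} \<times> {k..m}"
  assumes prod: "bounded_bilinear prod"
    and A: "\<And>p. p \<in> R \<Longrightarrow> has_partials A (Au p) (Av p) p"
    and B: "\<And>p. p \<in> R \<Longrightarrow> has_partials B (Bu p) (Bv p) p"
    and cont: "continuous_on R Av" "continuous_on R Bu"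
    and compat: "\<And>p \<xi>. p \<in> R \<Longrightarrow> Av p \<star> \<xi> + A p \<star> (B p \<star> \<xi>) = Bu p \<star> \<xi> + B p \<star> (A p \<star> \<xi>)"
    and bound: "\<And>p \<xi>. p \<in> R \<Longrightarrow> norm (A p \<star> \<xi>) \<le> K * norm \<xi>"
      "\<And>p \<xi>. p \<in> R \<Longrightarrow> norm (B p \<star> \<xi>) \<le> K * norm \<xi>"
      "\<And>p \<xi>. p \<in> R \<Longrightarrow> norm (Bu p \<star> \<xi>) \<le> K * norm \<xi>"
    and small: "l \<le> r" "k \<le> m" "r - l \<le> e" "m - k \<le> e" "0 \<le> K" "K * e \<le> 1 / 4" "e \<le> 1"
  obtains \<sigma> where "continuous_on R \<sigma>" "\<sigma> (l, k) = \<xi>0"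
    "\<And>p. p \<in> {l<..<r} \<times> {k<..<m} \<Longrightarrow> has_partials \<sigma> (A p \<star> \<sigma> p) (B p \<star> \<sigma> p) p"
proof -
  interpret prod: bounded_bilinear prod by (rule prod)
  have cA: "continuous_on R A" and cB: "continuous_on R B"
    using has_partials_continuous[OF A] has_partials_continuous[OF B]
    by (auto intro: continuous_at_imp_continuous_on)
  have slice: "continuous_on {k..m} (\<lambda>t. h (x, t))" "continuous_on {l..r} (\<lambda>s. h (s, y))"
    if "continuous_on R h" "x \<in> {l..r}" "y \<in> {k..m}" for h :: "real \<times> real \<Rightarrow> 'b" and x y
    using that by (auto simp: R_def intro!: continuous_on_compose2[OF that(1)] continuous_intros)
  \<comment> \<open>Integration along the broken path from (l, k) horizontally to (x, k) and then
    vertically to (x, y).\<close>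
  define F where "F \<phi> = (\<lambda>(x, y). \<xi>0 + integral {l..x} (\<lambda>s. A (s, k) \<star> \<phi> (s, k))
    + integral {k..y} (\<lambda>t. B (x, t) \<star> \<phi> (x, t)))" for \<phi> :: "real \<times> real \<Rightarrow> 'b"
  have cF: "continuous_on R (F \<phi>)" if "continuous_on R \<phi>" for \<phi>
  proof -
    have cA\<phi>: "continuous_on R (\<lambda>p. A p \<star> \<phi> p)" and cB\<phi>: "continuous_on R (\<lambda>p. B p \<star> \<phi> p)"
      using that cA cB by (auto intro!: prod.continuous_on)
    have "continuous_on {l..r} (\<lambda>x. integral {l..x} (\<lambda>s. A (s, k) \<star> \<phi> (s, k)))"
      by (rule indefinite_integral_continuous_1[OF integrable_continuous_real])
        (use slice(2)[OF cA\<phi>] small in auto)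
    then have 1: "continuous_on R (\<lambda>p. integral {l..fst p} (\<lambda>s. A (s, k) \<star> \<phi> (s, k)))"
      by (rule continuous_on_compose2) (auto simp: R_def intro!: continuous_intros)
    have 2: "continuous_on R (\<lambda>p. integral {k..snd p} (\<lambda>t. B (fst p, t) \<star> \<phi> (fst p, t)))"
      using continuous_on_integral_upto[OF cB\<phi>[unfolded R_def]] by (simp add: R_def case_prod_unfold)
    show ?thesis
      unfolding F_def case_prod_unfold by (intro continuous_intros 1 2)
  qed
  have cbox: "cbox (l, k) (r, m) = R"
    by (simp add: R_def cbox_Pair_eq)
  have int_bound: "norm (integral {a..b} h) \<le> c * e"
    if "continuous_on {a..b} h" "\<And>t. t \<in> {a..b} \<Longrightarrow> norm (h t) \<le> c" "a \<le> b" "b - a \<le> e" "0 \<le> c"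
    for a b c and h :: "real \<Rightarrow> 'b"
    using integral_bound[OF that(3,1,2)] mult_left_mono[OF that(4,5)] by linarith
  \<comment> \<open>The complete space used consists of bounded continuous functions on the whole
    plane; \<open>clamp\<close> retracts the plane onto the rectangle and thereby extends
    \<open>F \<phi>\<close>.\<close>
  have "\<exists>g :: (real \<times> real) \<Rightarrow>\<^sub>C 'b. \<forall>p. g p = F (apply_bcontfun \<phi>) (clamp (l, k) (r, m) p)" for \<phi> :: "(real \<times> real) \<Rightarrow>\<^sub>C 'b"
    using continuous_on_cbox_bcontfunE[of "(l, k)" "(r, m)" "F (apply_bcontfun \<phi>)"] cF[of "apply_bcontfun \<phi>"] cbox
    by (metis continuous_on_apply_bcontfun)
  then obtain T where T: "\<And>\<phi> p. apply_bcontfun (T \<phi>) p = F (apply_bcontfun \<phi>) (clamp (l, k) (r, m) p)"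
    by metis
  \<comment> \<open>A fixed point satisfies the first equation on the edge \<open>y = k\<close> and the second one everywhere.\<close>
  have "\<exists>!\<phi>. T \<phi> = \<phi>"
  proof (rule banach_fix_type[of "1/2"])
    show "\<forall>\<phi> \<psi>. dist (T \<phi>) (T \<psi>) \<le> 1 / 2 * dist \<phi> \<psi>"
    proof (intro allI dist_bound)
      fix \<phi> \<psi> :: "(real \<times> real) \<Rightarrow>\<^sub>C 'b" and p
      obtain x y where xy: "clamp (l, k) (r, m) p = (x, y)" by force
      have "clamp (l, k) (r, m) p \<in> R"
        unfolding cbox[symmetric] by (rule clamp_in_interval) (use small in \<open>auto simp: Basis_prod_def\<close>)
      then have x: "x \<in> {l..r}" and y: "y \<in> {k..m}" by (auto simp: xy R_def)
      have k: "k \<in> {k..m}" using small by auto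
      have c: "continuous_on R (\<lambda>p. C p \<star> \<eta> p)"
        if "continuous_on R C" for C and \<eta> :: "(real \<times> real) \<Rightarrow>\<^sub>C 'b"
        using that by (auto intro!: prod.continuous_on)
      have d: "norm (C p \<star> (\<phi> p - \<psi> p)) \<le> K * dist \<phi> \<psi>"
        if "p \<in> R" "\<And>p \<xi>. p \<in> R \<Longrightarrow> norm (C p \<star> \<xi>) \<le> K * norm \<xi>" for C p
        using that(2)[OF that(1), of "\<phi> p - \<psi> p"] dist_bounded[of \<phi> p \<psi>] small
        by (smt (verit, ccfv_SIG) dist_norm mult_left_mono)
      have sub: "{l..x} \<subseteq> {l..r}" "{k..y} \<subseteq> {k..m}" using x y by auto
      note slices = slice(2)[OF c[OF cA] x k, THEN continuous_on_subset, OF sub(1)]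
        slice(1)[OF c[OF cB] x y, THEN continuous_on_subset, OF sub(2)]
      have "F (apply_bcontfun \<phi>) (x, y) - F (apply_bcontfun \<psi>) (x, y) =
          integral {l..x} (\<lambda>s. A (s, k) \<star> (\<phi> (s, k) - \<psi> (s, k))) +
          integral {k..y} (\<lambda>t. B (x, t) \<star> (\<phi> (x, t) - \<psi> (x, t)))"
        unfolding F_def prod.diff_right
        by (subst (1 2) integral_diff) (auto intro!: integrable_continuous_real slices)
      also have "norm \<dots> \<le> K * dist \<phi> \<psi> * e + K * dist \<phi> \<psi> * e"
      proof (rule norm_triangle_mono; rule int_bound)
        show "continuous_on {l..x} (\<lambda>s. A (s, k) \<star> (\<phi> (s, k) - \<psi> (s, k)))"
          "continuous_on {k..y} (\<lambda>t. B (x, t) \<star> (\<phi> (x, t) - \<psi> (x, t)))"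
          unfolding prod.diff_right by (intro continuous_on_diff slices)+
      qed (use x y small in \<open>auto simp: R_def intro!: d bound\<close>)
      also have "\<dots> = 2 * (K * e) * dist \<phi> \<psi>" by simp
      also have "\<dots> \<le> 1 / 2 * dist \<phi> \<psi>"
        by (rule mult_right_mono) (use small in auto)
      finally show "dist (T \<phi> p) (T \<psi> p) \<le> 1 / 2 * dist \<phi> \<psi>"
        by (simp add: T xy dist_norm)
    qed
  qed auto
  then obtain \<phi> where "T \<phi> = \<phi>" by blast
  define \<sigma> where "\<sigma> = apply_bcontfun \<phi>"
  have c\<sigma>: "continuous_on R \<sigma>" by (simp add: \<sigma>_def)
  have \<sigma>: "\<sigma> p = F \<sigma> p" if "p \<in> R" for p
    using T[of \<phi> p] that \<open>T \<phi> = \<phi>\<close> cbox by (simp add: \<sigma>_def)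
  have lk: "l \<in> {l..r}" "k \<in> {k..m}" using small by auto
  define \<tau> where "\<tau> p = A p \<star> \<sigma> p" for p
  have c\<tau>: "continuous_on R \<tau>" and cB\<sigma>: "continuous_on R (\<lambda>p. B p \<star> \<sigma> p)"
    unfolding \<tau>_def using cA cB c\<sigma> by (auto intro!: prod.continuous_on)
  have \<sigma>v: "((\<lambda>y. \<sigma> (x, y)) has_vector_derivative B (x, y) \<star> \<sigma> (x, y)) (at y within {k..m})"
    if "x \<in> {l..r}" "y \<in> {k..m}" for x y
  proof (rule has_vector_derivative_transform[OF that(2)])
    show "\<sigma> (x, y) = F \<sigma> (x, y)" if "y \<in> {k..m}" for y
      using \<sigma> that \<open>x \<in> {l..r}\<close> by (simp add: R_def)
    show "((\<lambda>y. F \<sigma> (x, y)) has_vector_derivative B (x, y) \<star> \<sigma> (x, y)) (at y within {k..m})"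
      unfolding F_def prod.case
      by (rule has_vector_derivative_eq_rhs[OF has_vector_derivative_add[OF has_vector_derivative_const
          integral_has_vector_derivative]]) (use slice(1)[OF cB\<sigma>] that in auto)
  qed
  have \<tau>v: "((\<lambda>y. \<tau> (x, y)) has_vector_derivative
      Av (x, y) \<star> \<sigma> (x, y) + A (x, y) \<star> (B (x, y) \<star> \<sigma> (x, y))) (at y within {k..m})"
    if "x \<in> {l..r}" "y \<in> {k..m}" for x y
    unfolding \<tau>_def
    using prod.has_vector_derivative[OF has_partials_has_vector_derivative_snd[OF A] \<sigma>v[OF that]] that
    by (simp add: R_def add.commute)
  \<comment> \<open>\<open>\<rho>\<close> agrees with \<open>\<sigma>\<close> on the left edge and
    has u-derivative \<open>\<tau>\<close> everywhere, so the first equation for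
    \<open>\<sigma>\<close> amounts to \<open>\<rho> = \<sigma>\<close>.\<close>
  define \<rho> where "\<rho> = (\<lambda>(x, y). \<sigma> (l, y) + integral {l..x} (\<lambda>s. \<tau> (s, y)))"
  have c\<rho>: "continuous_on R \<rho>"
  proof -
    have "continuous_on ({k..m} \<times> {l..r}) (\<lambda>q. \<tau> (snd q, fst q))"
      by (rule continuous_on_compose2[OF c\<tau>]) (auto simp: R_def intro!: continuous_intros)
    from continuous_on_integral_upto[OF this]
    have "continuous_on ({k..m} \<times> {l..r}) (\<lambda>q. integral {l..snd q} (\<lambda>s. \<tau> (s, fst q)))"
      by (simp add: case_prod_unfold)
    moreover have "continuous_on R (\<lambda>p. (snd p, fst p))" "(\<lambda>p. (snd p, fst p)) ` R \<subseteq> {k..m} \<times> {l..r}"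
      by (auto simp: R_def intro!: continuous_intros)
    ultimately have "continuous_on R (\<lambda>p. integral {l..fst p} (\<lambda>s. \<tau> (s, snd p)))"
      by (auto dest: continuous_on_compose2)
    moreover have "continuous_on R (\<lambda>p. \<sigma> (l, snd p))"
      by (rule continuous_on_compose2[OF c\<sigma>]) (use lk in \<open>auto simp: R_def intro!: continuous_intros\<close>)
    ultimately show ?thesis
      unfolding \<rho>_def case_prod_unfold by (auto intro!: continuous_intros)
  qed
  have \<rho>u: "((\<lambda>x. \<rho> (x, y)) has_vector_derivative \<tau> (x, y)) (at x within {l..r})"
    if "x \<in> {l..r}" "y \<in> {k..m}" for x y
    unfolding \<rho>_def prod.case
    by (rule has_vector_derivative_eq_rhs[OF has_vector_derivative_add[OF has_vector_derivative_const
          integral_has_vector_derivative]]) (use slice(2)[OF c\<tau>] that in auto)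
  \<comment> \<open>\<open>\<rho>\<close> satisfies the first equation up to replacing \<open>\<sigma>\<close> by \<open>\<rho>\<close>; by the compatibility condition \<open>d\<close> solves
    a homogeneous linear Volterra equation, so it vanishes on a small rectangle.\<close>
  define d where "d p = \<rho> p - \<sigma> p" for p
  have cd: "continuous_on R d"
    unfolding d_def by (intro continuous_on_diff c\<rho> c\<sigma>)
  have cBu: "continuous_on R (\<lambda>p. Bu p \<star> \<eta> p)" if "continuous_on R \<eta>" for \<eta>
    using that cont by (auto intro!: prod.continuous_on)
  have dv: "((\<lambda>y. d (x, y)) has_vector_derivative
      B (x, y) \<star> d (x, y) - integral {l..x} (\<lambda>s. Bu (s, y) \<star> d (s, y))) (at y within {k..m})"
    if x: "x \<in> {l..r}" and y: "y \<in> {k..m}" for x y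
  proof -
    have sub: "{l..x} \<subseteq> {l..r}" using x by auto
    let ?g = "\<lambda>p. Av p \<star> \<sigma> p + A p \<star> (B p \<star> \<sigma> p)"
    have cg: "continuous_on R ?g"
      by (intro continuous_on_add prod.continuous_on cont cA cB c\<sigma>)
    \<comment> \<open>The parameter-integral lemma integrates over the second coordinate; the
      integral here runs over the first, hence the exchange of coordinates.\<close>
    have swap: "continuous_on ({k..m} \<times> {l..r}) (\<lambda>q. h (snd q, fst q))" if "continuous_on R h" for h :: "real \<times> real \<Rightarrow> 'b"
      by (rule continuous_on_compose2[OF that]) (auto simp: R_def intro!: continuous_intros)
    have "((\<lambda>y. integral {l..x} (\<lambda>s. \<tau> (s, y))) has_vector_derivative
        integral {l..x} (\<lambda>s. ?g (s, y))) (at y within {k..m})"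
      using has_vector_derivative_integral_param[where g="\<lambda>q. \<tau> (snd q, fst q)"
          and g'="\<lambda>q. ?g (snd q, fst q)" and l=k and r=m and k=l and m=r, OF _ swap[OF c\<tau>] swap[OF cg] y x] \<tau>v
      by simp
    from has_vector_derivative_diff[OF has_vector_derivative_add[OF \<sigma>v[OF lk(1) y] this] \<sigma>v[OF x y]]
    have 1: "((\<lambda>y. d (x, y)) has_vector_derivative
        B (l, y) \<star> \<sigma> (l, y) + integral {l..x} (\<lambda>s. ?g (s, y)) - B (x, y) \<star> \<sigma> (x, y)) (at y within {k..m})"
      by (simp add: d_def \<rho>_def)
    \<comment> \<open>\<open>?h\<close> is the u-derivative of \<open>B \<star> \<rho>\<close>.
      Compatibility cancels its difference from \<open>?g\<close> except for \<open>Bu\<close>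
      applied to \<open>\<rho> - \<sigma>\<close>, which is what makes the equation for
      \<open>d\<close> homogeneous.\<close>
    let ?h = "\<lambda>s. Bu (s, y) \<star> \<rho> (s, y) + B (s, y) \<star> \<tau> (s, y)"
    have "(?h has_integral B (x, y) \<star> \<rho> (x, y) - B (l, y) \<star> \<rho> (l, y)) {l..x}"
    proof (rule fundamental_theorem_of_calculus)
      fix s assume "s \<in> {l..x}"
      then have s: "s \<in> {l..r}" using x by auto
      have "has_partials B (Bu (s, y)) (Bv (s, y)) (s, y)"
        by (rule B) (use s y in \<open>auto simp: R_def\<close>)
      from prod.has_vector_derivative[OF has_partials_has_vector_derivative_fst[OF this]
          has_vector_derivative_within_subset[OF \<rho>u[OF s y] sub]]
      show "((\<lambda>s. B (s, y) \<star> \<rho> (s, y)) has_vector_derivative ?h s) (at s within {l..x})"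
        by (simp add: add.commute)
    qed (use x in auto)
    then have 2: "B (x, y) \<star> \<rho> (x, y) - B (l, y) \<star> \<sigma> (l, y) = integral {l..x} ?h"
      by (simp add: integral_unique \<rho>_def)
    have "integral {l..x} ?h - integral {l..x} (\<lambda>s. ?g (s, y)) = integral {l..x} (\<lambda>s. ?h s - ?g (s, y))"
      by (intro integral_diff[symmetric] integrable_continuous_real)
        (use slice(2)[OF cg x y, THEN continuous_on_subset, OF sub]
           slice(2)[OF cBu[OF c\<rho>] x y, THEN continuous_on_subset, OF sub]
           slice(2)[OF prod.continuous_on[OF cB c\<tau>] x y, THEN continuous_on_subset, OF sub]
         in \<open>auto intro!: continuous_on_add\<close>)
    also have "\<dots> = integral {l..x} (\<lambda>s. Bu (s, y) \<star> d (s, y))"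
    proof (rule integral_cong)
      fix s assume "s \<in> {l..x}"
      then have "(s, y) \<in> R" using x y by (auto simp: R_def)
      from compat[OF this] show "?h s - ?g (s, y) = Bu (s, y) \<star> d (s, y)"
        by (simp add: \<tau>_def d_def prod.diff_right)
    qed
    finally have "B (l, y) \<star> \<sigma> (l, y) + integral {l..x} (\<lambda>s. ?g (s, y)) - B (x, y) \<star> \<sigma> (x, y) =
      B (x, y) \<star> d (x, y) - integral {l..x} (\<lambda>s. Bu (s, y) \<star> d (s, y))"
      using 2 by (simp add: d_def prod.diff_right algebra_simps)
    with 1 show ?thesis by simp
  qed
  have dk: "d (x, k) = 0" if "x \<in> {l..r}" for x
    using that \<sigma>[of "(x, k)"] \<sigma>[of "(l, k)"] lk by (simp add: d_def \<rho>_def F_def \<tau>_def R_def)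
  \<comment> \<open>At a maximum point of the norm of \<open>d\<close>, integrating the equation
    upwards from the bottom edge, where \<open>d\<close> vanishes, gives N <= 2 K e N <= N /
    2.\<close>
  have "compact R" "R \<noteq> {}"
    using small by (auto simp: R_def compact_Times)
  then obtain q where q: "q \<in> R" "\<And>p. p \<in> R \<Longrightarrow> norm (d p) \<le> norm (d q)"
    using continuous_attains_sup[OF _ _ continuous_on_norm[OF cd]] by blast
  define N where "N = norm (d q)"
  have "N \<ge> 0" by (simp add: N_def)
  obtain x y where xy: "q = (x, y)" "x \<in> {l..r}" "y \<in> {k..m}" using q by (auto simp: R_def)
  let ?d' = "\<lambda>t. B (x, t) \<star> d (x, t) - integral {l..x} (\<lambda>s. Bu (s, t) \<star> d (s, t))"
  have "(?d' has_integral d (x, y) - d (x, k)) {k..y}"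
    by (rule fundamental_theorem_of_calculus)
      (use xy in \<open>auto intro!: has_vector_derivative_within_subset[OF dv]\<close>)
  moreover have "norm (?d' t) \<le> 2 * K * N" if "t \<in> {k..y}" for t
  proof -
    have p: "(s, t) \<in> R" if "s \<in> {l..x}" for s
      using that \<open>t \<in> {k..y}\<close> xy by (auto simp: R_def)
    have KN: "norm (C (s, t) \<star> d (s, t)) \<le> K * N"
      if "s \<in> {l..x}" "\<And>p \<xi>. p \<in> R \<Longrightarrow> norm (C p \<star> \<xi>) \<le> K * norm \<xi>" for C s
      using that(2)[OF p[OF that(1)], of "d (s, t)"] mult_left_mono[OF q(2)[OF p[OF that(1)]] \<open>0 \<le> K\<close>]
      by (simp add: N_def)
    have "norm (integral {l..x} (\<lambda>s. Bu (s, t) \<star> d (s, t))) \<le> K * N * e"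
    proof (rule int_bound)
      show "continuous_on {l..x} (\<lambda>s. Bu (s, t) \<star> d (s, t))"
        using slice(2)[OF cBu[OF cd], of x t] xy \<open>t \<in> {k..y}\<close>
        by (auto elim!: continuous_on_subset)
    qed (use xy small \<open>N \<ge> 0\<close> KN bound in auto)
    also have "\<dots> \<le> K * N * 1"
      by (rule mult_left_mono) (use small \<open>N \<ge> 0\<close> in auto)
    finally show ?thesis
      using KN[of x B] bound xy norm_triangle_ineq4[of "B (x, t) \<star> d (x, t)"
        "integral {l..x} (\<lambda>s. Bu (s, t) \<star> d (s, t))"] by simp
  qed
  ultimately have "norm (d (x, y) - d (x, k)) \<le> 2 * K * N * (y - k)"
    using has_integral_bound_real[of "2 * K * N" "{}" ?d' "d (x, y) - d (x, k)" k y] small \<open>N \<ge> 0\<close> xy by simp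
  also have "\<dots> \<le> 2 * K * N * e"
    by (rule mult_left_mono) (use small xy \<open>N \<ge> 0\<close> in auto)
  finally have "N \<le> 2 * (K * e) * N"
    using dk[OF xy(2)] by (simp add: N_def xy mult_ac)
  also have "\<dots> \<le> 1 / 2 * N"
    by (rule mult_right_mono) (use small \<open>N \<ge> 0\<close> in auto)
  finally have "N = 0" using \<open>N \<ge> 0\<close> by simp
  then have \<rho>\<sigma>: "\<rho> p = \<sigma> p" if "p \<in> R" for p
    using q(2)[OF that] by (simp add: N_def d_def)
  have \<sigma>u: "((\<lambda>x. \<sigma> (x, y)) has_vector_derivative A (x, y) \<star> \<sigma> (x, y)) (at x within {l..r})"
    if "x \<in> {l..r}" "y \<in> {k..m}" for x y
    using that by (intro has_vector_derivative_transform[OF _ _ \<rho>u[OF that, unfolded \<tau>_def]])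
      (auto simp: \<rho>\<sigma> R_def)
  have "has_partials \<sigma> (A p \<star> \<sigma> p) (B p \<star> \<sigma> p) p" if p: "p \<in> {l<..<r} \<times> {k<..<m}" for p
  proof -
    obtain x y where xy: "p = (x, y)" "x \<in> {l<..<r}" "y \<in> {k<..<m}" using p by blast
    \<comment> \<open>Only one-sided partial derivatives are known so far. Continuity of the second
      one makes them a total derivative within the closed rectangle, which at interior points is the
      ordinary derivative.\<close>
    have "((\<lambda>(x, y). \<sigma> (x, y)) has_derivative
       (\<lambda>(tx, ty). tx *\<^sub>R (A p \<star> \<sigma> p) + blinfun_scaleR_left (B (x, y) \<star> \<sigma> (x, y)) ty))
       (at (x, y) within {l..r} \<times> {k..m})"
    proof (rule has_derivative_partialsI)
      show "continuous (at (x, y) within {l..r} \<times> {k..m})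
          (\<lambda>(x, y). blinfun_scaleR_left (B (x, y) \<star> \<sigma> (x, y)))"
        using xy cB\<sigma> unfolding case_prod_unfold R_def
        by (intro bounded_linear.continuous[OF bounded_linear_blinfun_scaleR_left])
          (auto simp: continuous_on_eq_continuous_within)
    qed (use xy \<sigma>u \<sigma>v in \<open>auto simp: has_vector_derivative_def\<close>)
    moreover have "at (x, y) within {l..r} \<times> {k..m} = at (x, y)"
    proof (rule at_within_interior)
      show "(x, y) \<in> interior ({l..r} \<times> {k..m})"
        using xy by (simp add: interior_Times)
    qed
    ultimately show ?thesis
      by (simp add: has_partials_def xy case_prod_unfold)
  qed
  moreover have "\<sigma> (l, k) = \<xi>0"
    using \<sigma>[of "(l, k)"] lk by (simp add: F_def R_def)
  ultimately show ?thesis using that c\<sigma> by blast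
qed

theorem linear_total_system:
  fixes prod :: "'a::real_normed_vector \<Rightarrow> 'b::banach \<Rightarrow> 'b" (infixl "\<star>" 70)
    and A B :: "real \<times> real \<Rightarrow> 'a"
  assumes prod: "bounded_bilinear prod"
    and D: "open D" "(u0, v0) \<in> D"
    and smooth: "smooth_on D A" "smooth_on D B"
    and compat: "\<And>p \<xi>. p \<in> D \<Longrightarrow> dv A p \<star> \<xi> + A p \<star> (B p \<star> \<xi>) = du B p \<star> \<xi> + B p \<star> (A p \<star> \<xi>)"
  obtains l r k m \<sigma> where "u0 \<in> {l<..<r}" "v0 \<in> {k<..<m}" "{l..r} \<times> {k..m} \<subseteq> D"
    "continuous_on ({l..r} \<times> {k..m}) \<sigma>" "\<sigma> (l, k) = \<xi>0"
    "\<And>p. p \<in> {l<..<r} \<times> {k<..<m} \<Longrightarrow> has_partials \<sigma> (A p \<star> \<sigma> p) (B p \<star> \<sigma> p) p"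
proof -
  obtain d where d: "d > 0" "{u0 - d..u0 + d} \<times> {v0 - d..v0 + d} \<subseteq> D"
    using open_contains_rectangle[OF D] by blast
  let ?R0 = "{u0 - d..u0 + d} \<times> {v0 - d..v0 + d}"
  have bdd: "\<exists>M. \<forall>p\<in>?R0. norm (C p) \<le> M" if "smooth_on D C" for C :: "real \<times> real \<Rightarrow> 'a"
  proof -
    have "compact (C ` ?R0)"
      using smooth_on_continuous[OF that] d(2)
      by (intro compact_continuous_image compact_Times) (auto intro: continuous_on_subset)
    then show ?thesis using compact_imp_bounded bounded_iff by (metis imageI)
  qed
  obtain M1 M2 M3 where M: "\<forall>p\<in>?R0. norm (A p) \<le> M1" "\<forall>p\<in>?R0. norm (B p) \<le> M2"
      "\<forall>p\<in>?R0. norm (du B p) \<le> M3"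
    using bdd[OF smooth(1)] bdd[OF smooth(2)] bdd[OF smooth_on_du[OF smooth(2)]] by blast
  define M where "M = max 1 (max M1 (max M2 M3))"
  obtain L where L: "L > 0" "\<And>a b. norm (a \<star> b) \<le> norm a * norm b * L"
    using bounded_bilinear.pos_bounded[OF prod] by blast
  define K where "K = M * L"
  have K: "K > 0" using L by (simp add: K_def M_def)
  have KI: "norm (c \<star> \<xi>) \<le> K * norm \<xi>" if "norm c \<le> M" for c \<xi>
  proof -
    have "norm c * norm \<xi> * L \<le> M * norm \<xi> * L"
      by (intro mult_right_mono that) (use L in auto)
    also have "\<dots> = K * norm \<xi>" by (simp add: K_def)
    finally show ?thesis using L(2)[of c \<xi>] by linarith
  qed
  have MI: "norm (A p) \<le> M" "norm (B p) \<le> M" "norm (du B p) \<le> M" if "p \<in> ?R0" for p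
    using M that unfolding M_def by (meson le_max_iff_disj)+
  \<comment> \<open>The side of a square centred at (u0, v0): \<open>2 * d\<close> keeps it inside
    \<open>?R0\<close>, the other two bounds are the smallness conditions of the preceding lemma.
    The given point is the centre and not the corner, so that the solution is differentiable around
    it.\<close>
  define e where "e = min (2 * d) (min 1 (1 / (4 * K)))"
  have e: "e > 0" "e \<le> 2 * d" "e \<le> 1" using d K by (auto simp: e_def)
  have "K * e \<le> K * (1 / (4 * K))"
    by (rule mult_left_mono) (use K in \<open>auto simp: e_def\<close>)
  then have Ke: "K * e \<le> 1 / 4" using K by simp
  let ?l = "u0 - e / 2" and ?r = "u0 + e / 2" and ?k = "v0 - e / 2" and ?m = "v0 + e / 2"
  have sub: "{?l..?r} \<times> {?k..?m} \<subseteq> ?R0"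
    using e by auto
  then have subD: "{?l..?r} \<times> {?k..?m} \<subseteq> D" using d(2) by blast
  have hA: "has_partials A (du A p) (dv A p) p" and hB: "has_partials B (du B p) (dv B p) p"
    if "p \<in> {?l..?r} \<times> {?k..?m}" for p
    using that subD smooth smooth_on_has_partials by blast+
  have c: "continuous_on ({?l..?r} \<times> {?k..?m}) (dv A)" "continuous_on ({?l..?r} \<times> {?k..?m}) (du B)"
    using smooth_on_continuous[OF smooth_on_dv[OF smooth(1)]]
      smooth_on_continuous[OF smooth_on_du[OF smooth(2)]] subD continuous_on_subset by blast+
  obtain \<sigma> where "continuous_on ({?l..?r} \<times> {?k..?m}) \<sigma>" "\<sigma> (?l, ?k) = \<xi>0"
    "\<And>p. p \<in> {?l<..<?r} \<times> {?k<..<?m} \<Longrightarrow> has_partials \<sigma> (A p \<star> \<sigma> p) (B p \<star> \<sigma> p) p"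
  proof (rule linear_total_system_on_rectangle[OF prod hA hB c, where K = K and e = e])
    show "norm (A p \<star> \<xi>) \<le> K * norm \<xi>" "norm (B p \<star> \<xi>) \<le> K * norm \<xi>" "norm (du B p \<star> \<xi>) \<le> K * norm \<xi>"
      if "p \<in> {?l..?r} \<times> {?k..?m}" for p \<xi>
      using KI MI that sub by blast+
    show "dv A p \<star> \<xi> + A p \<star> (B p \<star> \<xi>) = du B p \<star> \<xi> + B p \<star> (A p \<star> \<xi>)"
      if "p \<in> {?l..?r} \<times> {?k..?m}" for p \<xi>
      using compat subD that by blast
  qed (use e K Ke in auto)
  with e subD show ?thesis
    by (intro that[of ?l ?r ?k ?m \<sigma>]) auto
qed

text \<open>Bootstrapping: if \<open>\<sigma>\<close> is of class C^k, so is the right-hand side of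
  the system, that is, the derivative of \<open>\<sigma>\<close>.\<close>

lemma linear_total_system_smooth:
  fixes mul :: "'a::real_normed_vector \<Rightarrow> 'b::real_normed_vector \<Rightarrow> 'b"
  assumes mul: "bounded_bilinear mul" and W: "open W" and smooth: "smooth_on W A" "smooth_on W B"
    and sys: "\<And>p. p \<in> W \<Longrightarrow> has_partials \<sigma> (mul (A p) (\<sigma> p)) (mul (B p) (\<sigma> p)) p"
  shows "smooth_on W \<sigma>"
proof -
  have "Ck_on k W \<sigma>" for k
  proof (induction k)
    case 0
    then show ?case
      using has_partials_continuous[OF sys] by (auto intro: continuous_at_imp_continuous_on)
  next
    case (Suc k)
    note m = bounded_bilinear.Ck_on[OF mul W _ Suc]
    show ?case
      by (rule Ck_on_SucI[OF W sys[unfolded has_partials_def]], assumption)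
        (intro Ck_on_add[OF W] bounded_linear.Ck_on[OF bounded_linear_scaleR_right W] m;
         use smooth in \<open>simp add: smooth_on_def\<close>)
  qed
  then show ?thesis by (simp add: smooth_on_def)
qed

section \<open>Orthonormal frames of Minkowski space\<close>

lemma mink_commute: "mink x y = mink y x"
  by (simp add: mink_def mult.commute)

lemma bounded_bilinear_mink: "bounded_bilinear mink"
  unfolding bilinear_conv_bounded_bilinear[symmetric]
  by (auto simp: bilinear_def mink_def intro!: linearI) (simp_all add: algebra_simps)

interpretation mink: bounded_bilinear mink
  by (rule bounded_bilinear_mink)

lemmas mink_linear = mink.add_left mink.add_right mink.diff_left mink.diff_right
  mink.scaleR_left mink.scaleR_right mink.minus_left mink.minus_right mink.zero_left mink.zero_right

definition mink_frame :: "real^3 \<Rightarrow> real^3 \<Rightarrow> real^3 \<Rightarrow> bool" where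
  "mink_frame x w n \<longleftrightarrow> mink x x = 1 \<and> mink w w = -1 \<and> mink n n = 1 \<and>
     mink x w = 0 \<and> mink x n = 0 \<and> mink w n = 0"

lemma mink_frame_simps:
  assumes "mink_frame x w n"
  shows "mink x x = 1" "mink w w = -1" "mink n n = 1" "mink x w = 0" "mink x n = 0" "mink w n = 0"
    "mink w x = 0" "mink n x = 0" "mink n w = 0"
  using assms unfolding mink_frame_def by (simp_all add: mink_commute)

definition mink_coeff :: "3 \<Rightarrow> 3 \<Rightarrow> real" where
  "mink_coeff i j = (if i = j then if i = 3 then -1 else 1 else 0)"

text \<open>With M the matrix of rows x, w, n, orthonormality says that X is a right inverse of M,
  hence also a left inverse. The entries of X M are, up to the sign of the third row, products
  summed over the frame instead of over the coordinates; this is the form that the frame equations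
  conserve. \<open>mink_coeff\<close> is the matrix diag(1, 1, -1) of the scalar product.\<close>

lemma mink_frame_iff:
  "mink_frame x w n \<longleftrightarrow> (\<forall>i j. x$i * x$j - w$i * w$j + n$i * n$j = mink_coeff i j)"
proof -
  define M :: "real^3^3" where "M = vector [x, w, n]"
  define X :: "real^3^3" where "X = vector [vector [x$1, - w$1, n$1], vector [x$2, - w$2, n$2],
    vector [- x$3, w$3, - n$3]]"
  have "mink_frame x w n \<longleftrightarrow> M ** X = mat 1"
    by (auto simp: mink_frame_def mink_def M_def X_def vec_eq_iff matrix_matrix_mult_def mat_def
        forall_3 sum_3 algebra_simps)
  also have "\<dots> \<longleftrightarrow> X ** M = mat 1"
    by (rule matrix_left_right_inverse)
  also have "\<dots> \<longleftrightarrow> (\<forall>i j. x$i * x$j - w$i * w$j + n$i * n$j = mink_coeff i j)"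
    by (auto simp: mink_coeff_def M_def X_def vec_eq_iff matrix_matrix_mult_def mat_def
        forall_3 sum_3 algebra_simps)
  finally show ?thesis .
qed

text \<open>The componentwise form in \<open>mink_frame_iff\<close> is a completeness relation;
  pairing it with \<open>v\<close> gives the expansion. The minus sign is the square of w.\<close>

lemma mink_frame_expand:
  assumes "mink_frame x w n"
  shows "v = mink v x *\<^sub>R x - mink v w *\<^sub>R w + mink v n *\<^sub>R n"
proof -
  have "mink v x * x$i - mink v w * w$i + mink v n * n$i = v$i" for i
  proof -
    have "mink v x * x$i - mink v w * w$i + mink v n * n$i =
        v$1 * (x$1 * x$i - w$1 * w$i + n$1 * n$i) + v$2 * (x$2 * x$i - w$2 * w$i + n$2 * n$i)
        - v$3 * (x$3 * x$i - w$3 * w$i + n$3 * n$i)"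
      by (simp add: mink_def algebra_simps)
    also have "\<dots> = v$1 * mink_coeff 1 i + v$2 * mink_coeff 2 i - v$3 * mink_coeff 3 i"
      using assms by (simp only: mink_frame_iff)
    also have "\<dots> = v$i"
      using exhaust_3[of i] by (auto simp: mink_coeff_def)
    finally show ?thesis .
  qed
  then show ?thesis by (simp add: vec_eq_iff)
qed

text \<open>The Euclidean cross product with its third entry negated, so that
  \<open>mink (mink_cross x w) y\<close> is the determinant with rows x, w, y.\<close>

definition mink_cross :: "real^3 \<Rightarrow> real^3 \<Rightarrow> real^3" where
  "mink_cross x w = vector [x$2 * w$3 - x$3 * w$2, x$3 * w$1 - x$1 * w$3, x$2 * w$1 - x$1 * w$2]"

lemma bounded_bilinear_mink_cross: "bounded_bilinear mink_cross"
  unfolding bilinear_conv_bounded_bilinear[symmetric]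
  by (auto simp: bilinear_def mink_cross_def vec_eq_iff forall_3 algebra_simps intro!: linearI)

text \<open>Lagrange's identity in this signature gives the square of the product as <x, w>^2 - <x,
  x> <w, w> = 1, and the determinant is that same square.\<close>

lemma mink_frame_mink_cross:
  assumes "mink x x = 1" "mink w w = -1" "mink x w = 0"
  shows "mink_frame x w (mink_cross x w)" "det (vector [x, w, mink_cross x w] :: real^3^3) = 1"
proof -
  have "mink (mink_cross x w) (mink_cross x w) = (mink x w)\<^sup>2 - mink x x * mink w w"
    by (simp add: mink_def mink_cross_def power2_eq_square algebra_simps)
  then have n: "mink (mink_cross x w) (mink_cross x w) = 1" using assms by simp
  have "mink x (mink_cross x w) = 0" "mink w (mink_cross x w) = 0"
    by (simp_all add: mink_def mink_cross_def algebra_simps)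
  with n assms show "mink_frame x w (mink_cross x w)" by (simp add: mink_frame_def)
  have "det (vector [x, w, mink_cross x w] :: real^3^3) = mink (mink_cross x w) (mink_cross x w)"
    by (simp add: det_3 mink_def mink_cross_def algebra_simps)
  with n show "det (vector [x, w, mink_cross x w] :: real^3^3) = 1" by simp
qed

text \<open>\<open>mink_cross x w\<close> is a multiple of n and both have square 1, so the
  determinant, which is their scalar product, is 1 or -1. This discreteness later fixes the
  orientation of a continuous frame.\<close>

lemma mink_frame_det:
  assumes "mink_frame x w n"
  shows "(det (vector [x, w, n] :: real^3^3))\<^sup>2 = 1"
proof -
  note f = mink_frame_simps[OF assms]
  have f': "mink_frame x w (mink_cross x w)" by (rule mink_frame_mink_cross) (simp_all add: f)
  have d: "det (vector [x, w, n] :: real^3^3) = mink (mink_cross x w) n"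
    by (simp add: det_3 mink_def mink_cross_def algebra_simps)
  have "mink_cross x w = mink (mink_cross x w) n *\<^sub>R n"
    using mink_frame_expand[OF assms, of "mink_cross x w"] mink_frame_simps[OF f'] by simp
  then have "mink (mink_cross x w) (mink_cross x w) =
      mink (mink (mink_cross x w) n *\<^sub>R n) (mink (mink_cross x w) n *\<^sub>R n)"
    by simp
  then have "1 = mink (mink_cross x w) n * mink (mink_cross x w) n"
    unfolding mink.scaleR_left mink.scaleR_right f mink_frame_simps[OF f'] by simp
  then show ?thesis by (simp add: d power2_eq_square)
qed

section \<open>Normal vectors of a surface with an adapted frame\<close>

lemma normal_vector_frame:
  assumes f: "mink_frame x w n"
    and z: "du z p = s *\<^sub>R x" "dv z p = b *\<^sub>R x + e *\<^sub>R w" "s > 0" "e > 0"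
  shows "normal_vector z p m \<longleftrightarrow> (\<exists>c. c \<noteq> 0 \<and> m = c *\<^sub>R n)"
proof
  assume m: "normal_vector z p m"
  then have "mink m x = 0" "mink m w = 0"
    using z by (auto simp: normal_vector_def mink_linear)
  with mink_frame_expand[OF f, of m] have "m = mink m n *\<^sub>R n" by simp
  moreover have "m \<noteq> 0" using m by (simp add: normal_vector_def)
  ultimately show "\<exists>c. c \<noteq> 0 \<and> m = c *\<^sub>R n" by (metis scaleR_eq_0_iff)
next
  have "n \<noteq> 0" using f by (auto simp: mink_frame_def mink_linear)
  then show "\<exists>c. c \<noteq> 0 \<and> m = c *\<^sub>R n \<Longrightarrow> normal_vector z p m"
    by (auto simp: normal_vector_def z mink_linear mink_frame_simps[OF f])
qed

text \<open>The tangent vectors are a triangular combination of x and w with positive diagonal s, e,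
  so the determinant with \<open>c *\<^sub>R n\<close> has the sign of c; this selects c = 1 from
  c^2 = 1.\<close>

lemma unit_normal_frame:
  assumes f: "mink_frame x w n" and d: "det (vector [x, w, n] :: real^3^3) > 0"
    and z: "du z p = s *\<^sub>R x" "dv z p = b *\<^sub>R x + e *\<^sub>R w" "s > 0" "e > 0"
  shows "unit_normal z p = n"
  unfolding unit_normal_def
proof (rule the_equality)
  have det: "det (vector [du z p, dv z p, c *\<^sub>R n] :: real^3^3) = c * (s * e * det (vector [x, w, n] :: real^3^3))" for c
    by (simp add: det_3 z algebra_simps)
  have pos: "s * e * det (vector [x, w, n] :: real^3^3) > 0" using d z by simp
  show "normal_vector z p n \<and> mink n n = 1 \<and> det (vector [du z p, dv z p, n] :: real^3^3) > 0"
    using normal_vector_frame[OF f z, of n] mink_frame_simps[OF f] det[of 1] pos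
    by (metis scaleR_one mult_1 zero_neq_one)
  fix m assume m: "normal_vector z p m \<and> mink m m = 1 \<and> det (vector [du z p, dv z p, m] :: real^3^3) > 0"
  then obtain c where c: "m = c *\<^sub>R n" using normal_vector_frame[OF f z, of m] by blast
  with m have "c * c = 1" by (simp add: mink_linear mink_frame_simps[OF f])
  moreover have "c > 0" using m det[of c] pos c by (simp add: zero_less_mult_iff)
  ultimately have "c = 1" by (simp add: square_eq_1_iff)
  with c show "m = n" by simp
qed

section \<open>The frame equations\<close>

text \<open>In a state \<open>(z, x, w, n)\<close>, \<open>z\<close> is the position, \<open>x\<close> and \<open>w\<close> are the space-like and time-like unit
  tangents, and \<open>n\<close> is the unit normal; the Gauss and Weingarten formulas have the form
  \<open>\<sigma>\<^sub>u = frame_mul A \<sigma>\<close>, \<open>\<sigma>\<^sub>v = frame_mul B \<sigma>\<close>.\<close>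

type_synonym frame_coeff = "real \<times> real \<times> real \<times> real \<times> real"
type_synonym frame_state = "(real^3) \<times> (real^3) \<times> (real^3) \<times> (real^3)"

definition frame_mul :: "frame_coeff \<Rightarrow> frame_state \<Rightarrow> frame_state" where
  "frame_mul = (\<lambda>(k1, k2, k3, k4, k5) (z, x, w, n).
     (k1 *\<^sub>R x + k2 *\<^sub>R w, k3 *\<^sub>R w + k4 *\<^sub>R n, k3 *\<^sub>R x + k5 *\<^sub>R n, k5 *\<^sub>R w - k4 *\<^sub>R x))"

lemma frame_mul_simps [simp]:
  "frame_mul (k1, k2, k3, k4, k5) (z, x, w, n) =
     (k1 *\<^sub>R x + k2 *\<^sub>R w, k3 *\<^sub>R w + k4 *\<^sub>R n, k3 *\<^sub>R x + k5 *\<^sub>R n, k5 *\<^sub>R w - k4 *\<^sub>R x)"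
  by (simp add: frame_mul_def)

lemma bounded_bilinear_frame_mul: "bounded_bilinear frame_mul"
  unfolding bilinear_conv_bounded_bilinear[symmetric]
  by (auto simp: bilinear_def frame_mul_def case_prod_unfold algebra_simps intro!: linearI)

definition frame_system where
  "frame_system W A B z x w n \<longleftrightarrow>
     (\<forall>p\<in>W. has_partials (\<lambda>p. (z p, x p, w p, n p)) (frame_mul (A p) (z p, x p, w p, n p))
        (frame_mul (B p) (z p, x p, w p, n p)) p)"

lemma frame_system_iff:
  "frame_system W (\<lambda>p. (A1 p, A2 p, A3 p, A4 p, A5 p)) (\<lambda>p. (B1 p, B2 p, B3 p, B4 p, B5 p)) z x w n \<longleftrightarrow>
   (\<forall>p\<in>W. has_partials z (A1 p *\<^sub>R x p + A2 p *\<^sub>R w p) (B1 p *\<^sub>R x p + B2 p *\<^sub>R w p) p \<and>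
      has_partials x (A3 p *\<^sub>R w p + A4 p *\<^sub>R n p) (B3 p *\<^sub>R w p + B4 p *\<^sub>R n p) p \<and>
      has_partials w (A3 p *\<^sub>R x p + A5 p *\<^sub>R n p) (B3 p *\<^sub>R x p + B5 p *\<^sub>R n p) p \<and>
      has_partials n (A5 p *\<^sub>R w p - A4 p *\<^sub>R x p) (B5 p *\<^sub>R w p - B4 p *\<^sub>R x p) p)"
  by (simp add: frame_system_def has_partials_Pair_iff)

lemma frame_system_cong:
  assumes "frame_system W A B z x w n" "\<And>p. p \<in> W \<Longrightarrow> A p = A' p" "\<And>p. p \<in> W \<Longrightarrow> B p = B' p"
  shows "frame_system W A' B' z x w n"
  using assms by (simp add: frame_system_def)

text \<open>A component of the tensor that contracts two frames over the frame index with the signs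
  1, -1, 1 and leaves the coordinate indices i, j free.\<close>

definition frame_pairing ::
  "real^3 \<Rightarrow> real^3 \<Rightarrow> real^3 \<Rightarrow> real^3 \<Rightarrow> real^3 \<Rightarrow> real^3 \<Rightarrow> 3 \<Rightarrow> 3 \<Rightarrow> real" where
  "frame_pairing x w n x' w' n' i j = x$i * x'$j - w$i * w'$j + n$i * n'$j"

text \<open>The last three coefficients act on the frame index as an infinitesimal isometry of
  signature 1, -1, 1, the same one for both frames, so the derivative of the pairing cancels.
  Applied to one solution paired with itself, this preserves the relations of
  \<open>mink_frame_iff\<close>.\<close>

lemma frame_pairing_constant:
  assumes W: "open W" "connected W" "p \<in> W" "q \<in> W"
    and sys: "frame_system W A B z x w n" "frame_system W A B z' x' w' n'"
  shows "frame_pairing (x p) (w p) (n p) (x' p) (w' p) (n' p) i j =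
         frame_pairing (x q) (w q) (n q) (x' q) (w' q) (n' q) i j"
proof (rule has_derivative_zero_unique_connected[OF W(1,2) _ W(3,4)])
  fix p assume p: "p \<in> W"
  obtain A1 A2 A3 A4 A5 where A: "A p = (A1, A2, A3, A4, A5)" by (cases "A p") auto
  obtain B1 B2 B3 B4 B5 where B: "B p = (B1, B2, B3, B4, B5)" by (cases "B p") auto
  note e = sys[unfolded frame_system_def, rule_format, OF p, unfolded A B frame_mul_simps
      has_partials_Pair_iff]
  note comp = e[THEN conjunct2, THEN conjunct1, THEN has_partials_vec_nth]
    e[THEN conjunct2, THEN conjunct2, THEN conjunct1, THEN has_partials_vec_nth]
    e[THEN conjunct2, THEN conjunct2, THEN conjunct2, THEN has_partials_vec_nth]
  have "has_partials (\<lambda>p. frame_pairing (x p) (w p) (n p) (x' p) (w' p) (n' p) i j) 0 0 p"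
    unfolding frame_pairing_def
    using has_partials_add[OF has_partials_diff[OF has_partials_mult[OF comp(1)[of i] comp(2)[of j]]
        has_partials_mult[OF comp(3)[of i] comp(4)[of j]]] has_partials_mult[OF comp(5)[of i] comp(6)[of j]]]
    by (simp add: algebra_simps)
  then show "((\<lambda>p. frame_pairing (x p) (w p) (n p) (x' p) (w' p) (n' p) i j) has_derivative (\<lambda>x. 0)) (at p)"
    by (simp add: has_partials_def)
qed

lemma frame_system_congruent:
  assumes W: "open W" "connected W" "p0 \<in> W"
    and sys: "frame_system W A B z x w n" "frame_system W A B z' x' w' n'"
    and frame: "\<And>p. p \<in> W \<Longrightarrow> mink_frame (x p) (w p) (n p)"
      "\<And>p. p \<in> W \<Longrightarrow> mink_frame (x' p) (w' p) (n' p)"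
    and det: "det (vector [x p0, w p0, n p0] :: real^3^3) = 1"
      "det (vector [x' p0, w' p0, n' p0] :: real^3^3) = 1"
  shows "\<exists>T. motion T \<and> (\<forall>p\<in>W. z' p = T (z p))"
proof -
  \<comment> \<open>The matrix of v |-> <x, v> x' - <w, v> w' + <n, v> n' at \<open>p0\<close>: the
    indices of the pairing are exchanged, and the sign for \<open>j = 3\<close> lowers an index by
    the scalar product.\<close>
  define Q :: "real^3^3" where
    "Q = (\<chi> i j. frame_pairing (x p0) (w p0) (n p0) (x' p0) (w' p0) (n' p0) j i * (if j = 3 then -1 else 1))"
  have Qv: "Q *v v = mink (x p) v *\<^sub>R x' p - mink (w p) v *\<^sub>R w' p + mink (n p) v *\<^sub>R n' p"
    if "p \<in> W" for v p
  proof -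
    have eq: "Q = (\<chi> i j. frame_pairing (x p) (w p) (n p) (x' p) (w' p) (n' p) j i * (if j = 3 then -1 else 1))"
      using frame_pairing_constant[OF W(1,2) that W(3) sys] by (simp add: Q_def)
    show ?thesis
      unfolding eq
      by (simp add: vec_eq_iff matrix_vector_mult_def sum_3 frame_pairing_def mink_def algebra_simps)
  qed
  have Qf: "Q *v x p = x' p" "Q *v w p = w' p" "Q *v n p = n' p" if "p \<in> W" for p
    using that by (simp_all add: Qv[OF that] mink_frame_simps[OF frame(1)])
  have iso: "mink (Q *v v) (Q *v u) = mink v u" for v u
  proof -
    note f = mink_frame_simps[OF frame(1)[OF W(3)]] mink_frame_simps[OF frame(2)[OF W(3)]]
    have "mink v u = mink (mink v (x p0) *\<^sub>R x p0 - mink v (w p0) *\<^sub>R w p0 + mink v (n p0) *\<^sub>R n p0)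
        (mink u (x p0) *\<^sub>R x p0 - mink u (w p0) *\<^sub>R w p0 + mink u (n p0) *\<^sub>R n p0)"
      using mink_frame_expand[OF frame(1)[OF W(3)]] by metis
    also have "\<dots> = mink v (x p0) * mink u (x p0) - mink v (w p0) * mink u (w p0) + mink v (n p0) * mink u (n p0)"
      by (simp add: mink_linear f)
    also have "\<dots> = mink (Q *v v) (Q *v u)"
      by (simp add: Qv[OF W(3)] mink_linear f mink_commute[of v] mink_commute[of u])
    finally show ?thesis ..
  qed
  have "vector [x' p0, w' p0, n' p0] = (vector [x p0, w p0, n p0] :: real^3^3) ** transpose Q"
    using Qf[OF W(3)]
    by (simp add: vec_eq_iff forall_3 matrix_matrix_mult_def matrix_vector_mult_def sum_3 transpose_def mult.commute)
  then have "det Q = 1"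
    using det by (simp add: det_mul det_transpose)
  \<comment> \<open>Q carries one frame to the other at every point and both positions have the same
    coefficients, so this difference has zero derivative.\<close>
  moreover have "z' p - Q *v z p = z' p0 - Q *v z p0" if "p \<in> W" for p
  proof (rule has_derivative_zero_unique_connected[OF W(1,2) _ that W(3)])
    fix p assume p: "p \<in> W"
    obtain A1 A2 A3 A4 A5 where A: "A p = (A1, A2, A3, A4, A5)" by (cases "A p") auto
    obtain B1 B2 B3 B4 B5 where B: "B p = (B1, B2, B3, B4, B5)" by (cases "B p") auto
    note e = sys[unfolded frame_system_def, rule_format, OF p, unfolded A B frame_mul_simps
        has_partials_Pair_iff, THEN conjunct1]
    have "has_partials (\<lambda>p. z' p - Q *v z p) 0 0 p"
      using has_partials_diff[OF e(2) bounded_linear.has_partials[OF matrix_vector_mul_bounded_linear[of Q] e(1)]]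
      by (simp add: matrix_vector_right_distrib matrix_vector_mult_scaleR Qf[OF p])
    then show "((\<lambda>p. z' p - Q *v z p) has_derivative (\<lambda>x. 0)) (at p)"
      by (simp add: has_partials_def)
  qed
  then have "\<forall>p\<in>W. z' p = Q *v z p + (z' p0 - Q *v z p0)"
    by (metis add.commute diff_add_cancel)
  ultimately show ?thesis
    using iso unfolding motion_def
    by (intro exI[of _ "\<lambda>v. Q *v v + (z' p0 - Q *v z p0)"]) blast
qed

section \<open>The scalar equations at a point\<close>

text \<open>\<open>A3\<close> and \<open>B3\<close> are the coefficients of w in x_u and x_v, and
  the hypotheses \<open>sv\<close> and \<open>B3\<close> are the x and w components of z_uv = z_vu.
  The formulas show that \<gamma>1 and \<gamma>2 encode just these two coefficients: A3 = q s
  \<gamma>1 and B3 = q (t \<gamma>2 - a_v / (1 + a^2)).\<close>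

lemma invariant_formulas:
  fixes a :: real
  assumes pos: "s > 0" "t > 0" "q > 0" and q: "q\<^sup>2 = 1 + a\<^sup>2"
    and sv: "sv = tu * a + t * au + t * q * A3"
    and B3: "s * B3 = t * a * A3 + tu * q + t * (a * au / q)"
  shows "- (1 / (1 + a\<^sup>2)) * (au / s + a * (tu / (s * t)) - sv / (s * t)) = A3 / (q * s)"
    and "(1 / (1 + a\<^sup>2)) * (av / t + a * (sv / (s * t)) + tu / (s * t)) = (B3 + av / q) / (q * t)"
proof -
  have eq: "au / s + a * (tu / (s * t)) - sv / (s * t) = - (q * A3 / s)"
    using pos by (simp add: sv field_simps)
  show "- (1 / (1 + a\<^sup>2)) * (au / s + a * (tu / (s * t)) - sv / (s * t)) = A3 / (q * s)"
    unfolding eq q[symmetric] using pos by (simp add: field_simps power2_eq_square)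
  have "q * (s * B3) = t * a * A3 * q + tu * q\<^sup>2 + t * a * au"
    unfolding B3 using pos by (simp add: field_simps power2_eq_square)
  then have "a * sv + tu = q * s * B3"
    unfolding q sv by (simp add: algebra_simps power2_eq_square)
  then have "av / t + a * (sv / (s * t)) + tu / (s * t) = av / t + q * s * B3 / (s * t)"
    by (simp add: add_divide_distrib[symmetric])
  also have "\<dots> = (av + q * B3) / t"
    using pos by (simp add: field_simps)
  finally have eq: "av / t + a * (sv / (s * t)) + tu / (s * t) = (av + q * B3) / t" .
  show "(1 / (1 + a\<^sup>2)) * (av / t + a * (sv / (s * t)) + tu / (s * t)) = (B3 + av / q) / (q * t)"
    unfolding eq q[symmetric] using pos by (simp add: field_simps power2_eq_square)
qed

text \<open>Eliminating the derivatives of \<open>s\<close> and \<open>t\<close> from the Codazzi equations leaves two linear equations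
  for \<open>1 / s\<close> and \<open>1 / t\<close>, whose solution is \<open>1 / \<Phi>\<close> and \<open>1 / \<Psi>\<close>. In the names of real variables a
  final \<open>u\<close> or \<open>v\<close> stands for a partial derivative.\<close>

lemma linear_from_codazzi:
  fixes a :: real
  assumes nz: "q > 0" "al \<noteq> 0" and q: "q\<^sup>2 = 1 + a\<^sup>2"
    and sv: "sv = tu * a + t * au + t * q * (q * s * g1)"
    and tu: "s * (q * (t * g2 - av / (1 + a\<^sup>2))) = t * a * (q * s * g1) + tu * q + t * (a * au / q)"
    and e: "q * s * g1 * (- (a * al * t / q)) = alu * t + al * tu + q * (t * g2 - av / (1 + a\<^sup>2)) * (al * s / q)"
    and f: "((alv * s + al * sv) * q - al * s * (a * av / q)) / q\<^sup>2 + q * s * g1 * (al * t) =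
       - (((au * al + a * alu) * t + a * al * tu) * q - a * al * t * (a * au / q)) / q\<^sup>2"
  shows "t * (s * g1 + au / (1 + a\<^sup>2)) = s * ((a * av / (1 + a\<^sup>2) - alv / al) / 2)"
    and "s * (t * g2 - av / (1 + a\<^sup>2)) = t * ((a * au / (1 + a\<^sup>2) - alu / al) / 2)"
proof -
  define c where "c = 1 + a\<^sup>2"
  have c: "c > 0" "c = q\<^sup>2" by (simp_all add: c_def q add_pos_nonneg)
  \<comment> \<open>Dividing the derivatives of a by c and those of \<alpha> by \<alpha> removes the
    denominators and leaves polynomial identities.\<close>
  define U V La Lb m P where "U = au / c" and "V = av / c" and "La = alu / al" and "Lb = alv / al"
    and "m = t * g2 - av / c" and "P = s * g1"
  have au: "au = c * U" and av: "av = c * V" and alu: "alu = al * La" and alv: "alv = al * Lb"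
    using c nz by (simp_all add: U_def V_def La_def Lb_def)
  have 1: "sv = tu * a + t * c * U + t * c * P"
    using sv by (simp add: au P_def c power2_eq_square mult_ac)
  have "q * (s * m) = q * (t * a * P + tu + t * a * U)"
    using tu nz unfolding c_def[symmetric] by (simp add: m_def P_def au c field_simps power2_eq_square)
  then have 2: "s * m = t * a * P + tu + t * a * U"
    using nz by simp
  have "al * (- (a * P * t)) = q * s * g1 * (- (a * al * t / q))"
    using nz by (simp add: P_def)
  also have "\<dots> = al * (La * t + tu + m * s)"
    unfolding e c_def[symmetric] m_def[symmetric] alu using nz by (simp add: algebra_simps)
  finally have "al * (- (a * P * t)) = al * (La * t + tu + m * s)" .
  then have 3: "- (a * P * t) = La * t + tu + m * s"
    using nz(2) mult_left_cancel by blast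
  have "al / q * (Lb * s + sv - s * a * V + c * P * t) =
      ((alv * s + al * sv) * q - al * s * (a * av / q)) / q\<^sup>2 + q * s * g1 * (al * t)"
    using nz by (simp add: alv av P_def c field_simps power2_eq_square)
  also have "\<dots> = al / q * (- (c * U * t + a * La * t + a * tu - a * a * t * U))"
    unfolding f using nz by (simp add: alu au c field_simps power2_eq_square)
  finally have 4: "Lb * s + sv - s * a * V + c * P * t = - (c * U * t + a * La * t + a * tu - a * a * t * U)"
    using nz mult_left_cancel[of "al / q"] by simp
  \<comment> \<open>Together 2 and 3 eliminate both \<open>tu\<close> and \<open>P\<close>; with 1
    and 4 added, \<open>P\<close> survives only in \<open>P + U\<close>.\<close>
  have "2 * (s * m) = t * (a * U - La)"
    using 2 3 by (simp add: algebra_simps)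
  then show "s * (t * g2 - av / (1 + a\<^sup>2)) = t * ((a * au / (1 + a\<^sup>2) - alu / al) / 2)"
    unfolding c_def[symmetric] m_def[symmetric] by (simp add: U_def La_def)
  have "2 * (t * (P + U)) = s * (a * V - Lb)"
    using 1 2 3 4 unfolding c_def by algebra
  then show "t * (s * g1 + au / (1 + a\<^sup>2)) = s * ((a * av / (1 + a\<^sup>2) - alv / al) / 2)"
    unfolding c_def[symmetric] P_def[symmetric] by (simp add: U_def V_def Lb_def mult_ac)
qed

text \<open>The conclusions are what the compatibility of mixed derivatives requires beyond the
  Gauss equation. Given \<open>I\<close> and \<open>II\<close>, the first two of them amount to the
  values \<open>svf\<close> and \<open>tuf\<close> of the derivatives of s and t, which is how the
  second and third equations of the theorem enter; the last two then follow from the formulas for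
  \<open>fu\<close> and \<open>fv\<close>.\<close>

lemma codazzi_from_linear:
  fixes a :: real
  assumes nz: "q > 0" "al \<noteq> 0" and q: "q\<^sup>2 = 1 + a\<^sup>2"
    and fu: "fu = (a * au / (1 + a\<^sup>2) - alu / al) / 2" and fv: "fv = (a * av / (1 + a\<^sup>2) - alv / al) / 2"
    and I: "t * (s * g1 + au / (1 + a\<^sup>2)) = s * fv"
    and II: "s * (t * g2 - av / (1 + a\<^sup>2)) = t * fu"
    and svf: "sv = s * fv + a * t * fu" and tuf: "tu = t * fu - a * s * fv"
  shows "sv = tu * a + t * au + t * q * (q * s * g1)"
    and "s * (q * (t * g2 - av / (1 + a\<^sup>2))) = t * a * (q * s * g1) + tu * q + t * (a * au / q)"
    and "q * s * g1 * (- (a * al * t / q)) = alu * t + al * tu + q * (t * g2 - av / (1 + a\<^sup>2)) * (al * s / q)"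
    and "((alv * s + al * sv) * q - al * s * (a * av / q)) / q\<^sup>2 + q * s * g1 * (al * t) =
       - (((au * al + a * alu) * t + a * al * tu) * q - a * al * t * (a * au / q)) / q\<^sup>2"
proof -
  define c where "c = 1 + a\<^sup>2"
  have c: "c > 0" "c = q\<^sup>2" by (simp_all add: c_def q add_pos_nonneg)
  define U V La Lb m P where "U = au / c" and "V = av / c" and "La = alu / al" and "Lb = alv / al"
    and "m = t * g2 - av / c" and "P = s * g1"
  have au: "au = c * U" and av: "av = c * V" and alu: "alu = al * La" and alv: "alv = al * Lb"
    using c nz by (simp_all add: U_def V_def La_def Lb_def)
  have fu': "2 * fu = a * U - La" and fv': "2 * fv = a * V - Lb"
    using fu fv unfolding c_def[symmetric] by (simp_all add: U_def V_def La_def Lb_def)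
  have I': "t * (P + U) = s * fv" and II': "s * m = t * fu"
    using I II unfolding c_def[symmetric] by (simp_all add: U_def P_def m_def)
  have 1: "sv = tu * a + t * c * U + t * c * P"
    using I' unfolding svf tuf c_def by algebra
  then show "sv = tu * a + t * au + t * q * (q * s * g1)"
    by (simp add: au P_def c power2_eq_square mult_ac)
  have 2: "s * m = t * a * P + tu + t * a * U"
    using I' II' unfolding tuf by algebra
  have "s * (q * m) = t * a * (q * P) + tu * q + t * a * q * U"
    using 2 by algebra
  then show "s * (q * (t * g2 - av / (1 + a\<^sup>2))) = t * a * (q * s * g1) + tu * q + t * (a * au / q)"
    unfolding c_def[symmetric] m_def[symmetric] using nz
    by (simp add: P_def au c power2_eq_square mult_ac)
  have 3: "- (a * P * t) = La * t + tu + m * s"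
    using 2 II' fu' by algebra
  then have "al * (- (a * P * t)) = al * (La * t + tu + m * s)" by simp
  then show "q * s * g1 * (- (a * al * t / q)) = alu * t + al * tu + q * (t * g2 - av / (1 + a\<^sup>2)) * (al * s / q)"
    unfolding c_def[symmetric] m_def[symmetric] using nz by (simp add: P_def alu field_simps)
  have 4: "Lb * s + sv - s * a * V + c * P * t = - (c * U * t + a * La * t + a * tu - a * a * t * U)"
    using 1 2 3 I' fv' unfolding c_def by algebra
  have "((alv * s + al * sv) * q - al * s * (a * av / q)) / q\<^sup>2 + q * s * g1 * (al * t) =
      al / q * (Lb * s + sv - s * a * V + c * P * t)"
    using nz by (simp add: alv av P_def c field_simps power2_eq_square)
  also have "\<dots> = - (((au * al + a * alu) * t + a * al * tu) * q - a * al * t * (a * au / q)) / q\<^sup>2"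
    unfolding 4 using nz by (simp add: alu au c field_simps power2_eq_square)
  finally show "((alv * s + al * sv) * q - al * s * (a * av / q)) / q\<^sup>2 + q * s * g1 * (al * t) =
       - (((au * al + a * alu) * t + a * al * tu) * q - a * al * t * (a * au / q)) / q\<^sup>2" .
qed

text \<open>One unknown is eliminated at a time. Products instead of Cramer's quotients keep
  \<open>au * av + c\<^sup>2 * fu * fv\<close>, about which nothing is assumed, out of the
  denominators.\<close>

lemma linear_equations_solution:
  fixes c :: real
  assumes nz: "s > 0" "t > 0" "c > 0"
    and I: "t * (s * g1 + au / c) = s * fv" and II: "s * (t * g2 - av / c) = t * fu"
  shows "c * (- av * g1 + c * fv * g2) \<noteq> 0 \<Longrightarrow> s = (au * av + c\<^sup>2 * fu * fv) / (c * (- av * g1 + c * fv * g2))"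
    and "c * (au * g2 + c * fu * g1) \<noteq> 0 \<Longrightarrow> t = (au * av + c\<^sup>2 * fu * fv) / (c * (au * g2 + c * fu * g1))"
proof -
  define U V where "U = au / c" and "V = av / c"
  have au: "au = c * U" and av: "av = c * V" using nz by (simp_all add: U_def V_def)
  have I': "t * (s * g1 + U) = s * fv" and II': "s * (t * g2 - V) = t * fu"
    using I II by (simp_all add: U_def V_def)
  have "t * (s * (c * (- av * g1 + c * fv * g2))) = t * (au * av + c\<^sup>2 * fu * fv)"
    using I' II' unfolding au av by algebra
  then have "s * (c * (- av * g1 + c * fv * g2)) = au * av + c\<^sup>2 * fu * fv" using nz by simp
  then show "c * (- av * g1 + c * fv * g2) \<noteq> 0 \<Longrightarrow> s = (au * av + c\<^sup>2 * fu * fv) / (c * (- av * g1 + c * fv * g2))"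
    by (metis nonzero_mult_div_cancel_right)
  have "s * (t * (c * (au * g2 + c * fu * g1))) = s * (au * av + c\<^sup>2 * fu * fv)"
    using I' II' unfolding au av by algebra
  then have "t * (c * (au * g2 + c * fu * g1)) = au * av + c\<^sup>2 * fu * fv" using nz by simp
  then show "c * (au * g2 + c * fu * g1) \<noteq> 0 \<Longrightarrow> t = (au * av + c\<^sup>2 * fu * fv) / (c * (au * g2 + c * fu * g1))"
    by (metis nonzero_mult_div_cancel_right)
qed

text \<open>Positivity of \<open>s\<close> makes the common numerator nonzero, so it can be
  cancelled. Since the numerator is common, the quotient of the denominators is
  \<open>t / s\<close>, which replaces the fractions in the second and third equations of the
  theorem.\<close>

lemma linear_equations_converse:
  fixes c :: real
  assumes c: "c > 0"
    and nz: "c * (- av * g1 + c * fv * g2) \<noteq> 0" "c * (au * g2 + c * fu * g1) \<noteq> 0"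
    and s: "s = (au * av + c\<^sup>2 * fu * fv) / (c * (- av * g1 + c * fv * g2))" "s > 0"
    and t: "t = (au * av + c\<^sup>2 * fu * fv) / (c * (au * g2 + c * fu * g1))" "t > 0"
  shows "t * (s * g1 + au / c) = s * fv" and "s * (t * g2 - av / c) = t * fu"
    and "(- av * g1 + c * fv * g2) / (au * g2 + c * fu * g1) = t / s"
proof -
  define N where "N = au * av + c\<^sup>2 * fu * fv"
  have N: "N \<noteq> 0" using s by (auto simp: N_def)
  define U V where "U = au / c" and "V = av / c"
  have au: "au = c * U" and av: "av = c * V" using c by (simp_all add: U_def V_def)
  have sN: "s * (c * (- av * g1 + c * fv * g2)) = N" and tN: "t * (c * (au * g2 + c * fu * g1)) = N"
    using s(1) t(1) nz by (simp_all add: N_def)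
  note sN' = sN[unfolded au av] and tN' = tN[unfolded au av]
  have "N * (t * (s * g1 + U)) - N * (s * fv) = t * s * g1 * N
      + t * U * (s * (c * (- (c * V) * g1 + c * fv * g2))) - s * fv * (t * (c * (c * U * g2 + c * fu * g1)))"
    unfolding sN' tN' by (simp add: algebra_simps)
  also have "\<dots> = 0"
    unfolding N_def au av by (simp add: algebra_simps power2_eq_square)
  finally have "N * (t * (s * g1 + U)) = N * (s * fv)" by simp
  then show "t * (s * g1 + au / c) = s * fv" using N by (simp add: U_def)
  have "N * (s * (t * g2 - V)) - N * (t * fu) = s * t * g2 * N
      - s * V * (t * (c * (c * U * g2 + c * fu * g1))) - t * fu * (s * (c * (- (c * V) * g1 + c * fv * g2)))"
    unfolding sN' tN' by (simp add: algebra_simps)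
  also have "\<dots> = 0"
    unfolding N_def au av by (simp add: algebra_simps power2_eq_square)
  finally have "N * (s * (t * g2 - V)) = N * (t * fu)" by simp
  then show "s * (t * g2 - av / c) = t * fu" using N by (simp add: V_def)
  have "s * (- av * g1 + c * fv * g2) = t * (au * g2 + c * fu * g1)"
  proof -
    have "c * (s * (- av * g1 + c * fv * g2)) = c * (t * (au * g2 + c * fu * g1))"
      by (metis sN tN mult.left_commute)
    then show ?thesis using c by simp
  qed
  then show "(- av * g1 + c * fv * g2) / (au * g2 + c * fu * g1) = t / s"
    using s(2) nz by (simp add: frac_eq_eq mult_ac)
qed

text \<open>The first equation of the theorem, rewritten as A3_v = B3_u + B4 A5 for A3 = q s
  \<gamma>1, B3 = q (t \<gamma>2 - a_v / (1 + a^2)), B4 = \<alpha> t, A5 = \<alpha> s / q. The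
  derivatives of s and t that arise are removed by \<open>sv\<close> and \<open>tu\<close>.\<close>

lemma gauss_equation:
  fixes a :: real
  assumes pos: "s > 0" "t > 0" "q > 0" and q: "q\<^sup>2 = 1 + a\<^sup>2"
    and sv: "sv = tu * a + t * au + t * q * (q * s * g1)"
    and tu: "s * (q * (t * g2 - av / (1 + a\<^sup>2))) = t * a * (q * s * g1) + tu * q + t * (a * au / q)"
    and gauss: "g2u / s - g1v / t - 2 * a * g1 * g2 - g1\<^sup>2 + g2\<^sup>2
          - g1 * (au / ((1 + a\<^sup>2) * s)) - g2 * (av / ((1 + a\<^sup>2) * t))
          - auv / ((1 + a\<^sup>2) * s * t) + a * au * av / ((1 + a\<^sup>2)\<^sup>2 * s * t) + al\<^sup>2 / (1 + a\<^sup>2) = 0"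
  shows "(a * av / q * s + q * sv) * g1 + q * s * g1v =
     a * au / q * (t * g2 - av / (1 + a\<^sup>2)) +
     q * (tu * g2 + t * g2u - (auv * (1 + a\<^sup>2) - av * (2 * a * au)) / (1 + a\<^sup>2)\<^sup>2) + al * t * (al * s / q)"
proof -
  define c where "c = 1 + a\<^sup>2"
  have c: "c > 0" "c = q\<^sup>2" by (simp_all add: c_def q add_pos_nonneg)
  define U V W where "U = au / c" and "V = av / c" and "W = auv / c"
  have au: "au = c * U" and av: "av = c * V" and auv: "auv = c * W"
    using c by (simp_all add: U_def V_def W_def)
  define b where "b = al\<^sup>2 / c"
  have al: "al * al = c * b" using c(1) by (simp add: b_def power2_eq_square)
  have 1: "sv = tu * a + t * c * U + t * c * s * g1"
    using sv by (simp add: au c power2_eq_square mult_ac)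
  have "q * (s * (t * g2 - V)) = q * (t * a * s * g1 + tu + t * a * U)"
    using tu pos unfolding c_def[symmetric] by (simp add: V_def au c field_simps power2_eq_square)
  then have 2: "s * (t * g2 - V) = t * a * s * g1 + tu + t * a * U"
    using pos by simp
  have g: "g2u / s - g1v / t - 2 * a * g1 * g2 - g1\<^sup>2 + g2\<^sup>2 - g1 * (U / s) - g2 * (V / t)
      - W / (s * t) + a * U * V / (s * t) + b = 0"
    using gauss unfolding c_def[symmetric] au av auv b_def using c(1) by (simp add: power2_eq_square)
  have "t * g2u - s * g1v + s * t * (- 2 * a * g1 * g2 - g1\<^sup>2 + g2\<^sup>2 + b) - t * g1 * U - s * g2 * V - W + a * U * V =
      s * t * (g2u / s - g1v / t - 2 * a * g1 * g2 - g1\<^sup>2 + g2\<^sup>2 - g1 * (U / s) - g2 * (V / t)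
      - W / (s * t) + a * U * V / (s * t) + b)"
    using pos by (simp add: field_simps)
  also have "\<dots> = 0" unfolding g by simp
  finally have 3: "t * g2u - s * g1v + s * t * (- 2 * a * g1 * g2 - g1\<^sup>2 + g2\<^sup>2 + b)
      - t * g1 * U - s * g2 * V - W + a * U * V = 0" .
  have 4: "(a * V * s + sv) * g1 + s * g1v =
      a * U * (t * g2 - V) + (tu * g2 + t * g2u - (W - V * 2 * a * U)) + s * t * b"
    using 1 2 3 unfolding c_def by algebra
  have e1: "(a * av / q * s + q * sv) * g1 + q * s * g1v = q * ((a * V * s + sv) * g1 + s * g1v)"
    using pos by (simp add: av c field_simps power2_eq_square)
  have e2: "(auv * c - av * (2 * a * au)) / c\<^sup>2 = W - V * 2 * a * U"
    using c(1) by (simp add: au av auv field_simps power2_eq_square)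
  have e3: "al * t * (al * s / q) = q * (s * t * b)"
  proof -
    have "al * t * (al * s / q) = (al * al) * s * t / q" by simp
    also have "\<dots> = q * (s * t * b)"
      unfolding al using pos by (simp add: c(2) power2_eq_square)
    finally show ?thesis .
  qed
  have e4: "a * au / q * (t * g2 - V) = q * (a * U * (t * g2 - V))"
    using pos by (simp add: au c power2_eq_square)
  show ?thesis
    unfolding c_def[symmetric] V_def[symmetric] e1 e2 e3 e4 4 by (simp add: algebra_simps)
qed

section \<open>Surfaces in asymptotic parameters and their frames\<close>

text \<open>The frame of a surface is \<open>x = z\<^sub>u / s\<close>, \<open>w = (z\<^sub>v / t - a x) / sqrt (1 + a\<^sup>2)\<close>, where \<open>s = sqrt E\<close> and
  \<open>t = sqrt (- G)\<close>; \<open>coeff_u\<close> and \<open>coeff_v\<close> are the coefficients of its frame equations.\<close>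

definition scale_of :: "(real \<times> real \<Rightarrow> real) \<Rightarrow> real \<times> real \<Rightarrow> real" where
  "scale_of a p = sqrt (1 + (a p)\<^sup>2)"

definition coeff_u where
  "coeff_u s \<gamma>1 a \<alpha> p =
     (s p, 0 :: real, scale_of a p * s p * \<gamma>1 p, 0 :: real, \<alpha> p * s p / scale_of a p)"

definition coeff_v where
  "coeff_v t \<gamma>2 a \<alpha> p =
     (t p * a p, t p * scale_of a p, scale_of a p * (t p * \<gamma>2 p - dv a p / (1 + (a p)\<^sup>2)),
      \<alpha> p * t p, - (a p * \<alpha> p * t p / scale_of a p))"

lemma scale_of_pos: "scale_of a p > 0"
  by (simp add: scale_of_def add_pos_nonneg)

lemma scale_of_square: "(scale_of a p)\<^sup>2 = 1 + (a p)\<^sup>2"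
  by (simp add: scale_of_def)

lemma smooth_on_scale_of: "open S \<Longrightarrow> smooth_on S a \<Longrightarrow> smooth_on S (scale_of a)"
  unfolding scale_of_def[abs_def]
  by (intro smooth_on_intros) (auto simp: add_pos_nonneg)

lemma has_partials_scale_of:
  assumes "has_partials a au av p"
  shows "has_partials (scale_of a) (a p * au / scale_of a p) (a p * av / scale_of a p) p"
proof -
  have "has_partials (\<lambda>q. 1 + (a q)\<^sup>2) (2 * (a p * au)) (2 * (a p * av)) p"
    using has_partials_add[OF has_partials_const[of 1] has_partials_mult[OF assms assms]]
    by (simp add: power2_eq_square mult_ac)
  from has_partials_sqrt[OF this] show ?thesis
    by (simp add: scale_of_def[abs_def] add_pos_nonneg)
qed

section \<open>Structure equations along a surface\<close>

lemma has_partials_mink_const: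
  assumes W: "open W" "p \<in> W" and c: "\<And>q. q \<in> W \<Longrightarrow> mink (g q) (h q) = c"
    and g: "has_partials g gu gv p" and h: "has_partials h hu hv p"
  shows "mink gu (h p) = - mink (g p) hu" "mink gv (h p) = - mink (g p) hv"
proof -
  have "has_partials (\<lambda>q. mink (g q) (h q)) 0 0 p"
    by (rule has_partials_cong[OF has_partials_const W]) (simp add: c)
  with mink.has_partials[OF g h]
  have "mink (g p) hu + mink gu (h p) = 0" "mink (g p) hv + mink gv (h p) = 0"
    by (auto simp: has_partials_iff)
  then show "mink gu (h p) = - mink (g p) hu" "mink gv (h p) = - mink (g p) hv"
    by simp_all
qed

text \<open>The differentiated orthonormality relations leave three free coefficients in each
  direction, the last three entries expected by \<open>frame_mul\<close>.\<close>

lemma moving_frame: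
  assumes W: "open W" "p \<in> W" and f: "\<forall>q\<in>W. mink_frame (x q) (w q) (n q)"
    and x: "has_partials x xu xv p" and w: "has_partials w wu wv p" and n: "has_partials n nu nv p"
  shows "xu = - mink xu (w p) *\<^sub>R w p + mink xu (n p) *\<^sub>R n p"
    and "xv = - mink xv (w p) *\<^sub>R w p + mink xv (n p) *\<^sub>R n p"
    and "wu = - mink xu (w p) *\<^sub>R x p + mink wu (n p) *\<^sub>R n p"
    and "wv = - mink xv (w p) *\<^sub>R x p + mink wv (n p) *\<^sub>R n p"
    and "nu = mink wu (n p) *\<^sub>R w p - mink xu (n p) *\<^sub>R x p"
    and "nv = mink wv (n p) *\<^sub>R w p - mink xv (n p) *\<^sub>R x p"
proof -
  note fs = mink_frame_simps[OF bspec[OF f]]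
  note c = has_partials_mink_const[OF W]
  note d = c[OF fs(1) x x] c[OF fs(2) w w] c[OF fs(3) n n] c[OF fs(4) x w] c[OF fs(5) x n] c[OF fs(6) w n]
  note e = mink_frame_expand[OF bspec[OF f W(2)]]
  have 1: "mink xu (x p) = 0" "mink xv (x p) = 0" "mink wu (w p) = 0" "mink wv (w p) = 0"
    "mink nu (n p) = 0" "mink nv (n p) = 0"
    using d(1-6) by (simp_all add: mink_commute)
  have 2: "mink wu (x p) = - mink xu (w p)" "mink wv (x p) = - mink xv (w p)"
    "mink nu (x p) = - mink xu (n p)" "mink nv (x p) = - mink xv (n p)"
    "mink nu (w p) = - mink wu (n p)" "mink nv (w p) = - mink wv (n p)"
    using d(7-12) by (simp_all add: mink_commute)
  show "xu = - mink xu (w p) *\<^sub>R w p + mink xu (n p) *\<^sub>R n p"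
    using e[of xu] by (simp add: 1 2)
  show "xv = - mink xv (w p) *\<^sub>R w p + mink xv (n p) *\<^sub>R n p"
    using e[of xv] by (simp add: 1 2)
  show "wu = - mink xu (w p) *\<^sub>R x p + mink wu (n p) *\<^sub>R n p"
    using e[of wu] by (simp add: 1 2)
  show "wv = - mink xv (w p) *\<^sub>R x p + mink wv (n p) *\<^sub>R n p"
    using e[of wv] by (simp add: 1 2)
  show "nu = mink wu (n p) *\<^sub>R w p - mink xu (n p) *\<^sub>R x p"
    using e[of nu] by (simp add: 1 2)
  show "nv = mink wv (n p) *\<^sub>R w p - mink xv (n p) *\<^sub>R x p"
    using e[of nv] by (simp add: 1 2)
qed

lemma surface_frame:
  fixes \<gamma>1 \<gamma>2 a \<alpha> :: "real \<times> real \<Rightarrow> real"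
  assumes W: "open W" and adm: "admissible_surface W z" and inv: "has_invariants W z \<gamma>1 \<gamma>2 a \<alpha>"
    and nz: "\<And>p. p \<in> W \<Longrightarrow> \<alpha> p \<noteq> 0"
  obtains x w n where
    "frame_system W (coeff_u (sqrt_E z) \<gamma>1 a \<alpha>) (coeff_v (sqrt_mG z) \<gamma>2 a \<alpha>) z x w n"
    "\<And>p. p \<in> W \<Longrightarrow> mink_frame (x p) (w p) (n p)"
    "\<And>p. p \<in> W \<Longrightarrow> det (vector [x p, w p, n p] :: real^3^3) = 1"
    "\<And>p. p \<in> W \<Longrightarrow> sqrt_E z p > 0" "\<And>p. p \<in> W \<Longrightarrow> sqrt_mG z p > 0"
    "\<And>p. p \<in> W \<Longrightarrow> sqrt_mG z p * (sqrt_E z p * \<gamma>1 p + du a p / (1 + (a p)\<^sup>2)) =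
        sqrt_E z p * ((a p * dv a p / (1 + (a p)\<^sup>2) - dv \<alpha> p / \<alpha> p) / 2)"
    "\<And>p. p \<in> W \<Longrightarrow> sqrt_E z p * (sqrt_mG z p * \<gamma>2 p - dv a p / (1 + (a p)\<^sup>2)) =
        sqrt_mG z p * ((a p * du a p / (1 + (a p)\<^sup>2) - du \<alpha> p / \<alpha> p) / 2)"
proof -
  define s t q where "s = sqrt_E z" and "t = sqrt_mG z" and "q = scale_of a"
  have z: "smooth_on W z" and asym: "\<And>p. p \<in> W \<Longrightarrow> coeff_L z p = 0" "\<And>p. p \<in> W \<Longrightarrow> coeff_N z p = 0"
    and EG: "\<And>p. p \<in> W \<Longrightarrow> coeff_E z p > 0" "\<And>p. p \<in> W \<Longrightarrow> coeff_G z p < 0"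
    using adm by (auto simp: admissible_surface_def timelike_surface_def regular_surface_def
        asymptotic_parameters_def)
  have a_eq: "inv_a z p = a p" and \<alpha>_eq: "inv_alpha z p = \<alpha> p" and g1: "inv_gamma1 z p = \<gamma>1 p"
    and g2: "inv_gamma2 z p = \<gamma>2 p" if "p \<in> W" for p
    using inv that by (auto simp: has_invariants_def)
  note sm = smooth_on_intros mink.smooth_on W z
  have sE: "smooth_on W (coeff_E z)" "smooth_on W (coeff_F z)" "smooth_on W (coeff_G z)"
    unfolding coeff_E_def[abs_def] coeff_F_def[abs_def] coeff_G_def[abs_def] by (intro sm)+
  have pos: "s p > 0" "t p > 0" "q p > 0" if "p \<in> W" for p
    using EG[OF that] by (simp_all add: s_def t_def q_def sqrt_E_def sqrt_mG_def scale_of_pos)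
  have ss: "smooth_on W s" and st: "smooth_on W t"
    unfolding s_def t_def sqrt_E_def[abs_def] sqrt_mG_def[abs_def]
    by (intro sm sE; simp add: EG)+
  \<comment> \<open>Smoothness of \<open>a\<close> is not a hypothesis here; it is read off the
    surface through \<open>inv_a\<close>.\<close>
  have "smooth_on W (inv_a z)"
    unfolding inv_a_def[abs_def] s_def[symmetric] t_def[symmetric]
    by (intro sm sE ss st) (use pos in \<open>force simp: less_le\<close>)
  then have sa: "smooth_on W a" by (rule smooth_on_cong[OF _ W a_eq])
  have sq: "smooth_on W q" unfolding q_def by (rule smooth_on_scale_of[OF W sa])
  \<comment> \<open>Gram-Schmidt on z_u, z_v in this order; q enters because z_v / t - a x has
    square -(1 + a^2). The cross product makes n smooth and the orientation positive by
    construction.\<close>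
  define x w n where "x p = (1 / s p) *\<^sub>R du z p"
    and "w p = (1 / q p) *\<^sub>R ((1 / t p) *\<^sub>R dv z p - a p *\<^sub>R x p)"
    and "n p = mink_cross (x p) (w p)" for p
  have pos': "s p \<noteq> 0" "t p \<noteq> 0" "q p \<noteq> 0" if "p \<in> W" for p
    using pos[OF that] by auto
  have sx: "smooth_on W x" unfolding x_def[abs_def] by (intro sm ss pos')
  have sw: "smooth_on W w" unfolding w_def[abs_def] by (intro sm ss st sq sa sx pos')
  have sn: "smooth_on W n"
    unfolding n_def[abs_def] by (rule bounded_bilinear.smooth_on[OF bounded_bilinear_mink_cross W sx sw])
  have zu: "du z p = s p *\<^sub>R x p" and zv: "dv z p = (t p * a p) *\<^sub>R x p + (t p * q p) *\<^sub>R w p"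
    if "p \<in> W" for p
    using pos'[OF that] by (simp_all add: x_def w_def scaleR_diff_right)
  have Es: "coeff_E z p = (s p)\<^sup>2" and Gt: "coeff_G z p = - (t p)\<^sup>2" if "p \<in> W" for p
    using EG[OF that] by (simp_all add: s_def t_def sqrt_E_def sqrt_mG_def)
  have Fa: "coeff_F z p = a p * (s p * t p)" if "p \<in> W" for p
    using a_eq[OF that] pos[OF that] by (auto simp: inv_a_def s_def t_def field_simps)
  have xx: "mink (x p) (x p) = 1" and xw: "mink (x p) (w p) = 0" and ww: "mink (w p) (w p) = -1"
    if "p \<in> W" for p
  proof -
    note p = pos'[OF that]
    define y where "y = (1 / t p) *\<^sub>R dv z p"
    show xx: "mink (x p) (x p) = 1"
      using Es[OF that] p by (simp add: x_def mink_linear coeff_E_def power2_eq_square)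
    have xy: "mink (x p) y = a p"
      using Fa[OF that] p by (simp add: x_def y_def mink_linear coeff_F_def)
    have yy: "mink y y = -1"
      using Gt[OF that] p by (simp add: y_def mink_linear coeff_G_def power2_eq_square)
    have w: "w p = (1 / q p) *\<^sub>R (y - a p *\<^sub>R x p)" by (simp add: w_def y_def)
    show "mink (x p) (w p) = 0" by (simp add: w mink_linear xx xy)
    define r where "r = y - a p *\<^sub>R x p"
    have "mink r r = - (q p)\<^sup>2"
      unfolding q_def r_def scale_of_square
      using xy by (simp add: mink_linear xx yy mink_commute[of y "x p"] power2_eq_square algebra_simps)
    then show "mink (w p) (w p) = -1" using p
      unfolding w r_def[symmetric] by (simp add: mink.scaleR_left mink.scaleR_right power2_eq_square)
  qed
  have fr: "mink_frame (x p) (w p) (n p)" and det: "det (vector [x p, w p, n p] :: real^3^3) = 1"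
    if "p \<in> W" for p
    using mink_frame_mink_cross[OF xx ww xw] that by (simp_all add: n_def)
  have un: "unit_normal z p = n p" if "p \<in> W" for p
    by (rule unit_normal_frame[OF fr[OF that] _ zu[OF that] zv[OF that]])
      (use det[OF that] pos[OF that] in auto)
  have fr': "\<forall>p\<in>W. mink_frame (x p) (w p) (n p)" using fr by blast
  note hp = smooth_on_has_partials
  define A3 A4 A5 B3 B4 B5 where "A3 p = - mink (du x p) (w p)" and "A4 p = mink (du x p) (n p)"
    and "A5 p = mink (du w p) (n p)" and "B3 p = - mink (dv x p) (w p)" and "B4 p = mink (dv x p) (n p)"
    and "B5 p = mink (dv w p) (n p)" for p
  note mf = moving_frame[OF W _ fr' hp[OF sx] hp[OF sw] hp[OF sn], folded A3_def A4_def A5_def B3_def B4_def B5_def]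
  \<comment> \<open>\<open>A4\<close> vanishes because L = 0, \<open>B4\<close> comes from M and
    \<open>B5\<close> from N = 0; \<open>A5\<close> and the last two equations are the n, x and w
    components of z_uv = z_vu.\<close>
  have main: "A4 p = 0 \<and> B4 p = \<alpha> p * t p \<and> B5 p = - (a p * \<alpha> p * t p / q p) \<and> A5 p = \<alpha> p * s p / q p \<and>
      dv s p = du t p * a p + t p * du a p + t p * q p * A3 p \<and>
      s p * B3 p = t p * a p * A3 p + du t p * q p + t p * (a p * du a p / q p)"
    if p: "p \<in> W" for p
  proof -
    note f = mink_frame_simps[OF fr[OF p]]
    note m = mf[OF p p p p]
    have qd: "has_partials q (a p * du a p / q p) (a p * dv a p / q p) p"
      unfolding q_def by (rule has_partials_scale_of[OF hp[OF sa p]])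
    have zz: "has_partials (du z) (s p *\<^sub>R du x p + du s p *\<^sub>R x p) (s p *\<^sub>R dv x p + dv s p *\<^sub>R x p) p"
      by (rule has_partials_cong[OF has_partials_scaleR[OF hp[OF ss p] hp[OF sx p]] W p]) (simp add: zu)
    define Ra Rb where "Ra = du (dv z) p" and "Rb = dv (dv z) p"
    have zz': "has_partials (dv z)
       ((t p * a p) *\<^sub>R du x p + (t p * du a p + du t p * a p) *\<^sub>R x p +
        ((t p * q p) *\<^sub>R du w p + (t p * (a p * du a p / q p) + du t p * q p) *\<^sub>R w p))
       ((t p * a p) *\<^sub>R dv x p + (t p * dv a p + dv t p * a p) *\<^sub>R x p +
        ((t p * q p) *\<^sub>R dv w p + (t p * (a p * dv a p / q p) + dv t p * q p) *\<^sub>R w p)) p"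
      by (rule has_partials_cong[OF has_partials_add[OF
            has_partials_scaleR[OF has_partials_mult[OF hp[OF st p] hp[OF sa p]] hp[OF sx p]]
            has_partials_scaleR[OF has_partials_mult[OF hp[OF st p] qd] hp[OF sw p]]] W p]) (simp add: zv)
    have comm: "s p *\<^sub>R dv x p + dv s p *\<^sub>R x p =
       (t p * a p) *\<^sub>R du x p + (t p * du a p + du t p * a p) *\<^sub>R x p +
        ((t p * q p) *\<^sub>R du w p + (t p * (a p * du a p / q p) + du t p * q p) *\<^sub>R w p)"
      using dv_du_commute[OF W p z] has_partials_dv[OF zz] has_partials_du[OF zz'] by simp
    have ip: "mink (du x p) (x p) = 0" "mink (dv x p) (x p) = 0" "mink (du w p) (x p) = A3 p"
       "mink (dv w p) (x p) = B3 p" "mink (du w p) (w p) = 0" "mink (dv w p) (w p) = 0"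
      by (subst m; simp add: mink_linear f)+
    have ip': "mink (du x p) (w p) = - A3 p" "mink (dv x p) (w p) = - B3 p"
      "mink (du x p) (n p) = A4 p" "mink (dv x p) (n p) = B4 p"
      "mink (du w p) (n p) = A5 p" "mink (dv w p) (n p) = B5 p"
      by (simp_all add: A3_def A4_def A5_def B3_def B4_def B5_def)
    have "coeff_L z p = s p * A4 p"
      unfolding coeff_L_def has_partials_du[OF zz] un[OF p] mink_commute[of "n p"]
      by (simp add: mink_linear f ip')
    then have A4: "A4 p = 0" using asym(1)[OF p] pos[OF p] by simp
    have "coeff_M z p = s p * B4 p"
      unfolding coeff_M_def has_partials_dv[OF zz] un[OF p] mink_commute[of "n p"]
      by (simp add: mink_linear f ip')
    then have B4: "B4 p = \<alpha> p * t p"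
      using \<alpha>_eq[OF p] pos'[OF p] unfolding inv_alpha_def s_def[symmetric] t_def[symmetric]
      by (auto simp: field_simps)
    have "coeff_N z p = t p * a p * B4 p + t p * q p * B5 p"
      unfolding coeff_N_def has_partials_dv[OF zz'] un[OF p] mink_commute[of "n p"]
      by (simp add: mink_linear f ip')
    then have "t p * (q p * B5 p) = t p * (- (a p * B4 p))" using asym(2)[OF p] by simp
    then have "q p * B5 p = - (a p * B4 p)" using pos'[OF p] mult_left_cancel by blast
    then have B5: "B5 p = - (a p * \<alpha> p * t p / q p)"
      using pos'[OF p] by (simp add: B4 field_simps)
    have 1: "dv s p = du t p * a p + t p * du a p + t p * q p * A3 p"
      using arg_cong[OF comm, of "\<lambda>v. mink v (x p)"] by (simp add: mink_linear f ip ip')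
    have 2: "s p * B3 p = t p * a p * A3 p + du t p * q p + t p * (a p * du a p / q p)"
      using arg_cong[OF comm, of "\<lambda>v. mink v (w p)"] by (simp add: mink_linear f ip ip')
    have "s p * B4 p = t p * q p * A5 p"
      using arg_cong[OF comm, of "\<lambda>v. mink v (n p)"] by (simp add: mink_linear f ip ip' A4)
    then have "t p * (s p * \<alpha> p) = t p * (q p * A5 p)" by (simp add: B4 mult_ac)
    then have "s p * \<alpha> p = q p * A5 p" using pos'[OF p] mult_left_cancel by blast
    then have A5: "A5 p = \<alpha> p * s p / q p"
      using pos'[OF p] by (simp add: field_simps)
    show ?thesis using A4 B4 B5 A5 1 2 by blast
  qed
  have A3: "A3 p = q p * s p * \<gamma>1 p" and B3: "B3 p = q p * (t p * \<gamma>2 p - dv a p / (1 + (a p)\<^sup>2))"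
    if p: "p \<in> W" for p
  proof -
    have da: "du (inv_a z) p = du a p" "dv (inv_a z) p = dv a p"
      using has_partials_cong[OF hp[OF sa p] W p a_eq[symmetric]] by (simp_all add: has_partials_iff)
    have qq: "(q p)\<^sup>2 = 1 + (a p)\<^sup>2" by (simp add: q_def scale_of_square)
    have m: "dv s p = du t p * a p + t p * du a p + t p * q p * A3 p"
      "s p * B3 p = t p * a p * A3 p + du t p * q p + t p * (a p * du a p / q p)"
      using main[OF p] by auto
    have "\<gamma>1 p = A3 p / (q p * s p)"
      unfolding invariant_formulas(1)[OF pos[OF p] qq m, symmetric]
      using g1[OF p] by (simp add: inv_gamma1_def da a_eq[OF p] s_def t_def)
    then show "A3 p = q p * s p * \<gamma>1 p" using pos'[OF p] by simp
    have "\<gamma>2 p = (B3 p + dv a p / q p) / (q p * t p)"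
      unfolding invariant_formulas(2)[OF pos[OF p] qq m, symmetric]
      using g2[OF p] by (simp add: inv_gamma2_def da a_eq[OF p] s_def t_def)
    then show "B3 p = q p * (t p * \<gamma>2 p - dv a p / (1 + (a p)\<^sup>2))"
      unfolding qq[symmetric] using pos'[OF p] by (simp add: field_simps power2_eq_square)
  qed
  have frame_sys: "frame_system W (coeff_u s \<gamma>1 a \<alpha>) (coeff_v t \<gamma>2 a \<alpha>) z x w n"
    unfolding coeff_u_def[abs_def] coeff_v_def[abs_def] frame_system_iff q_def[symmetric]
  proof (intro ballI)
    fix p assume p: "p \<in> W"
    note m = mf[OF p p p p]
    note [simp] = main[OF p, THEN conjunct1] A3[OF p, symmetric] B3[OF p, symmetric]
    have e: "A5 p = \<alpha> p * s p / q p" "B4 p = \<alpha> p * t p" "B5 p = - (a p * \<alpha> p * t p / q p)"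
      using main[OF p] by blast+
    show "has_partials z (s p *\<^sub>R x p + 0 *\<^sub>R w p) ((t p * a p) *\<^sub>R x p + (t p * q p) *\<^sub>R w p) p \<and>
      has_partials x ((q p * s p * \<gamma>1 p) *\<^sub>R w p + 0 *\<^sub>R n p)
        ((q p * (t p * \<gamma>2 p - dv a p / (1 + (a p)\<^sup>2))) *\<^sub>R w p + (\<alpha> p * t p) *\<^sub>R n p) p \<and>
      has_partials w ((q p * s p * \<gamma>1 p) *\<^sub>R x p + (\<alpha> p * s p / q p) *\<^sub>R n p)
        ((q p * (t p * \<gamma>2 p - dv a p / (1 + (a p)\<^sup>2))) *\<^sub>R x p + - (a p * \<alpha> p * t p / q p) *\<^sub>R n p) p \<and>
      has_partials n ((\<alpha> p * s p / q p) *\<^sub>R w p - 0 *\<^sub>R x p)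
        (- (a p * \<alpha> p * t p / q p) *\<^sub>R w p - (\<alpha> p * t p) *\<^sub>R x p) p"
      unfolding e[symmetric] A3[OF p, symmetric] B3[OF p, symmetric]
      using hp[OF z p] hp[OF sx p] hp[OF sw p] hp[OF sn p] m
      by (simp add: zu[OF p] zv[OF p])
  qed
  \<comment> \<open>\<open>unit_normal\<close> is given by a description, so smoothness of \<alpha>
    is obtained from the frame instead.\<close>
  have \<alpha>_smooth: "smooth_on W \<alpha>"
  proof (rule smooth_on_cong[OF _ W])
    show "smooth_on W (\<lambda>p. B4 p / t p)"
      unfolding B4_def by (intro sm sx sn st pos')
    show "B4 p / t p = \<alpha> p" if "p \<in> W" for p
      using main[OF that] pos'[OF that] by simp
  qed
  have codazzi: "t p * (s p * \<gamma>1 p + du a p / (1 + (a p)\<^sup>2)) =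
        s p * ((a p * dv a p / (1 + (a p)\<^sup>2) - dv \<alpha> p / \<alpha> p) / 2) \<and>
      s p * (t p * \<gamma>2 p - dv a p / (1 + (a p)\<^sup>2)) =
        t p * ((a p * du a p / (1 + (a p)\<^sup>2) - du \<alpha> p / \<alpha> p) / 2)" if p: "p \<in> W" for p
  proof -
    note f = mink_frame_simps[OF fr[OF p]]
    note m = mf[OF p p p p]
    note mp = main[OF p]
    have qd: "has_partials q (a p * du a p / q p) (a p * dv a p / q p) p"
      unfolding q_def by (rule has_partials_scale_of[OF hp[OF sa p]])
    have dB4: "has_partials B4 (\<alpha> p * du t p + du \<alpha> p * t p) (\<alpha> p * dv t p + dv \<alpha> p * t p) p"
      by (rule has_partials_cong[OF has_partials_mult[OF hp[OF \<alpha>_smooth p] hp[OF st p]] W p])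
        (use main in simp)
    have dA4: "has_partials A4 0 0 p"
      by (rule has_partials_cong[OF has_partials_const W p]) (use main in simp)
    have dA5: "dv A5 p = ((dv \<alpha> p * s p + \<alpha> p * dv s p) * q p - \<alpha> p * s p * (a p * dv a p / q p)) / (q p)\<^sup>2"
      using has_partials_dv[OF has_partials_cong[OF has_partials_divide[OF
          has_partials_mult[OF hp[OF \<alpha>_smooth p] hp[OF ss p]] qd pos'(3)[OF p]] W p, of A5]] main
      by (simp add: add.commute)
    have dB5: "du B5 p = - (((du a p * \<alpha> p + a p * du \<alpha> p) * t p + a p * \<alpha> p * du t p) * q p
        - a p * \<alpha> p * t p * (a p * du a p / q p)) / (q p)\<^sup>2"
    proof -
      note d = has_partials_minus[OF has_partials_divide[OF has_partials_mult[OF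
            has_partials_mult[OF hp[OF sa p] hp[OF \<alpha>_smooth p]] hp[OF st p]] qd pos'(3)[OF p]]]
      have "- (a r * \<alpha> r * t r / q r) = B5 r" if "r \<in> W" for r
        using main[OF that] by argo
      from has_partials_du[OF has_partials_cong[OF d W p this]] show ?thesis
        by (simp only: minus_divide_left add.commute)
    qed
    \<comment> \<open>\<open>A4\<close> and \<open>B4\<close>, and below \<open>A5\<close> and
      \<open>B5\<close>, are scalar products with n; in the difference of their cross derivatives
      the second derivatives of x, respectively w, cancel by symmetry. What remains are the Codazzi
      equations.\<close>
    have "has_partials B4 (mink (dv x p) (du n p) + mink (du (dv x) p) (n p))
        (mink (dv x p) (dv n p) + mink (dv (dv x) p) (n p)) p"
      unfolding B4_def by (rule mink.has_partials[OF hp[OF smooth_on_dv[OF sx] p] hp[OF sn p]])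
    moreover have "has_partials A4 (mink (du x p) (du n p) + mink (du (du x) p) (n p))
        (mink (du x p) (dv n p) + mink (dv (du x) p) (n p)) p"
      unfolding A4_def by (rule mink.has_partials[OF hp[OF smooth_on_du[OF sx] p] hp[OF sn p]])
    ultimately have e: "\<alpha> p * du t p + du \<alpha> p * t p = mink (dv x p) (du n p) - mink (du x p) (dv n p)"
      using dA4 dB4 dv_du_commute[OF W p sx] by (simp add: has_partials_iff)
    have nu: "du n p = A5 p *\<^sub>R w p" and nv: "dv n p = B5 p *\<^sub>R w p - B4 p *\<^sub>R x p"
      and xu: "du x p = A3 p *\<^sub>R w p" and xv: "dv x p = B3 p *\<^sub>R w p + B4 p *\<^sub>R n p"
      and wu: "du w p = A3 p *\<^sub>R x p + A5 p *\<^sub>R n p" and wv: "dv w p = B3 p *\<^sub>R x p + B5 p *\<^sub>R n p"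
      using m mp by simp_all
    have e': "A3 p * B5 p = \<alpha> p * du t p + du \<alpha> p * t p + B3 p * A5 p"
      unfolding e nu nv xu xv by (simp add: mink_linear f)
    have "has_partials A5 (mink (du w p) (du n p) + mink (du (du w) p) (n p))
        (mink (du w p) (dv n p) + mink (dv (du w) p) (n p)) p"
      unfolding A5_def by (rule mink.has_partials[OF hp[OF smooth_on_du[OF sw] p] hp[OF sn p]])
    moreover have "has_partials B5 (mink (dv w p) (du n p) + mink (du (dv w) p) (n p))
        (mink (dv w p) (dv n p) + mink (dv (dv w) p) (n p)) p"
      unfolding B5_def by (rule mink.has_partials[OF hp[OF smooth_on_dv[OF sw] p] hp[OF sn p]])
    ultimately have "dv A5 p - du B5 p = mink (du w p) (dv n p) - mink (dv w p) (du n p)"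
      using dv_du_commute[OF W p sw] by (simp add: has_partials_iff)
    then have f': "dv A5 p + A3 p * B4 p = du B5 p"
      unfolding nu nv wu wv by (simp add: mink_linear f algebra_simps)
    have qq: "(q p)\<^sup>2 = 1 + (a p)\<^sup>2" by (simp add: q_def scale_of_square)
    have B4: "B4 p = \<alpha> p * t p" and B5: "B5 p = - (a p * \<alpha> p * t p / q p)" and A5: "A5 p = \<alpha> p * s p / q p"
      and 1: "dv s p = du t p * a p + t p * du a p + t p * q p * A3 p"
      and 2: "s p * B3 p = t p * a p * A3 p + du t p * q p + t p * (a p * du a p / q p)"
      using mp by blast+
    have e'': "q p * s p * \<gamma>1 p * (- (a p * \<alpha> p * t p / q p)) = du \<alpha> p * t p + \<alpha> p * du t p +
        q p * (t p * \<gamma>2 p - dv a p / (1 + (a p)\<^sup>2)) * (\<alpha> p * s p / q p)"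
      using e' unfolding B5 A5 A3[OF p] B3[OF p] by (simp only: add.commute)
    show ?thesis
      using linear_from_codazzi[OF pos(3)[OF p] nz[OF p] qq 1[unfolded A3[OF p]] 2[unfolded A3[OF p] B3[OF p]] e''
        f'[unfolded dA5 dB5 A3[OF p] B4]] by (rule conjI)
  qed
  show ?thesis
    by (rule that[of x w n]) (use frame_sys fr det pos codazzi in \<open>auto simp: s_def t_def\<close>)
qed

text \<open>The frame equations give E = s^2, F = s t a, G = -t^2, M = s t \<alpha> and L = N = 0,
  hence K = \<alpha>^2 / (1 + a^2) and H = a \<alpha> / (1 + a^2), so that K - H^2 = \<alpha>^2 / (1
  + a^2)^2 > 0. The hypotheses \<open>sv\<close> and \<open>tu\<close> are those under which
  \<open>invariant_formulas\<close> returns \<gamma>1 and \<gamma>2.\<close>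

lemma frame_surface:
  fixes \<gamma>1 \<gamma>2 a \<alpha> s t :: "real \<times> real \<Rightarrow> real"
  assumes W: "open W" and z: "smooth_on W z"
    and sys: "frame_system W (coeff_u s \<gamma>1 a \<alpha>) (coeff_v t \<gamma>2 a \<alpha>) z x w n"
    and fr: "\<And>p. p \<in> W \<Longrightarrow> mink_frame (x p) (w p) (n p)"
    and det: "\<And>p. p \<in> W \<Longrightarrow> det (vector [x p, w p, n p] :: real^3^3) > 0"
    and pos: "\<And>p. p \<in> W \<Longrightarrow> s p > 0" "\<And>p. p \<in> W \<Longrightarrow> t p > 0"
    and smooth: "smooth_on W s" "smooth_on W t" "smooth_on W a"
    and \<alpha>: "\<And>p. p \<in> W \<Longrightarrow> \<alpha> p \<noteq> 0"
    and sv: "\<And>p. p \<in> W \<Longrightarrow>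
      dv s p = du t p * a p + t p * du a p + t p * scale_of a p * (scale_of a p * s p * \<gamma>1 p)"
    and tu: "\<And>p. p \<in> W \<Longrightarrow> s p * (scale_of a p * (t p * \<gamma>2 p - dv a p / (1 + (a p)\<^sup>2))) =
      t p * a p * (scale_of a p * s p * \<gamma>1 p) + du t p * scale_of a p + t p * (a p * du a p / scale_of a p)"
  shows "admissible_surface W z" "has_invariants W z \<gamma>1 \<gamma>2 a \<alpha>"
proof -
  define q where "q = scale_of a"
  have q: "q p > 0" "(q p)\<^sup>2 = 1 + (a p)\<^sup>2" for p by (simp_all add: q_def scale_of_pos scale_of_square)
  note hp = smooth_on_has_partials
  note sys' = sys[unfolded coeff_u_def[abs_def] coeff_v_def[abs_def] frame_system_iff, folded q_def]
  have zu: "du z p = s p *\<^sub>R x p" and zv: "dv z p = (t p * a p) *\<^sub>R x p + (t p * q p) *\<^sub>R w p"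
    if "p \<in> W" for p
    using sys' that by (auto simp: has_partials_iff)
  have hx: "has_partials x ((q p * s p * \<gamma>1 p) *\<^sub>R w p)
      ((q p * (t p * \<gamma>2 p - dv a p / (1 + (a p)\<^sup>2))) *\<^sub>R w p + (\<alpha> p * t p) *\<^sub>R n p) p"
    and hw: "has_partials w ((q p * s p * \<gamma>1 p) *\<^sub>R x p + (\<alpha> p * s p / q p) *\<^sub>R n p)
        ((q p * (t p * \<gamma>2 p - dv a p / (1 + (a p)\<^sup>2))) *\<^sub>R x p + - (a p * \<alpha> p * t p / q p) *\<^sub>R n p) p"
    if "p \<in> W" for p
    using sys' that by auto
  have tq: "t p * q p > 0" if "p \<in> W" for p using pos[OF that] q[of p] by simp
  have un: "unit_normal z p = n p" if "p \<in> W" for p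
    by (rule unit_normal_frame[OF fr[OF that] det[OF that] zu[OF that] zv[OF that] pos(1)[OF that] tq[OF that]])
  have E: "coeff_E z p = (s p)\<^sup>2" and F: "coeff_F z p = s p * t p * a p" and G: "coeff_G z p = - (t p)\<^sup>2"
    and L: "coeff_L z p = 0" and M: "coeff_M z p = s p * t p * \<alpha> p" and N: "coeff_N z p = 0" if p: "p \<in> W" for p
  proof -
    note f = mink_frame_simps[OF fr[OF p]]
    show "coeff_E z p = (s p)\<^sup>2" "coeff_F z p = s p * t p * a p"
      by (simp_all add: coeff_E_def coeff_F_def zu[OF p] zv[OF p] mink_linear f power2_eq_square)
    have "coeff_G z p = (t p)\<^sup>2 * ((a p)\<^sup>2 - (q p)\<^sup>2)"
      by (simp add: coeff_G_def zv[OF p] mink_linear f power2_eq_square algebra_simps)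
    then show "coeff_G z p = - (t p)\<^sup>2" by (simp add: q)
    have qd: "has_partials q (a p * du a p / q p) (a p * dv a p / q p) p"
      unfolding q_def by (rule has_partials_scale_of[OF hp[OF smooth(3) p]])
    note zz = has_partials_cong[OF has_partials_scaleR[OF hp[OF smooth(1) p] hx[OF p]] W p zu[symmetric]]
    note zz' = has_partials_cong[OF has_partials_add[OF
            has_partials_scaleR[OF has_partials_mult[OF hp[OF smooth(2) p] hp[OF smooth(3) p]] hx[OF p]]
            has_partials_scaleR[OF has_partials_mult[OF hp[OF smooth(2) p] qd] hw[OF p]]] W p zv[symmetric]]
    show "coeff_L z p = 0" "coeff_M z p = s p * t p * \<alpha> p"
      by (simp_all add: coeff_L_def coeff_M_def un[OF p] has_partials_du[OF zz] has_partials_dv[OF zz] mink_linear f)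
    show "coeff_N z p = 0"
      using q(1)[of p] by (simp add: coeff_N_def un[OF p] has_partials_dv[OF zz'] mink_linear f)
  qed
  have sE: "sqrt_E z p = s p" and sG: "sqrt_mG z p = t p" if "p \<in> W" for p
    using pos[OF that] by (simp_all add: sqrt_E_def sqrt_mG_def E[OF that] G[OF that])
  have ia: "inv_a z p = a p" and i\<alpha>: "inv_alpha z p = \<alpha> p" if "p \<in> W" for p
    using pos[OF that] by (simp_all add: inv_a_def inv_alpha_def sE[OF that] sG[OF that] F[OF that] M[OF that])
  show "has_invariants W z \<gamma>1 \<gamma>2 a \<alpha>"
    unfolding has_invariants_def
  proof (intro ballI conjI ia i\<alpha>)
    fix p assume p: "p \<in> W"
    have d: "du (inv_a z) p = du a p" "dv (inv_a z) p = dv a p" "dv (sqrt_E z) p = dv s p"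
      "du (sqrt_mG z) p = du t p"
      using has_partials_cong[OF hp[OF smooth(3) p] W p ia[symmetric]]
        has_partials_cong[OF hp[OF smooth(1) p] W p sE[symmetric]]
        has_partials_cong[OF hp[OF smooth(2) p] W p sG[symmetric]]
      by (simp_all add: has_partials_iff)
    note i = invariant_formulas[OF pos(1)[OF p] pos(2)[OF p] q[of p] sv[OF p, folded q_def] tu[OF p, folded q_def]]
    have "inv_gamma1 z p = q p * s p * \<gamma>1 p / (q p * s p)"
      unfolding inv_gamma1_def d sE[OF p] sG[OF p] ia[OF p] by (rule i)
    then show "inv_gamma1 z p = \<gamma>1 p" using pos[OF p] q(1)[of p] by simp
    have "inv_gamma2 z p = (q p * (t p * \<gamma>2 p - dv a p / (1 + (a p)\<^sup>2)) + dv a p / q p) / (q p * t p)"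
      unfolding inv_gamma2_def d sE[OF p] sG[OF p] ia[OF p] by (rule i)
    also have "\<dots> = \<gamma>2 p"
      unfolding q(2)[symmetric] using pos[OF p] q(1)[of p] by (simp add: field_simps power2_eq_square)
    finally show "inv_gamma2 z p = \<gamma>2 p" .
  qed
  show "admissible_surface W z"
    unfolding admissible_surface_def timelike_surface_def regular_surface_def asymptotic_parameters_def
  proof (intro conjI ballI allI impI z L N)
    fix p assume p: "p \<in> W"
    note f = mink_frame_simps[OF fr[OF p]]
    have "linear (frechet_derivative z (at p))"
      using smooth_on_differentiable[OF z p] frechet_derivative_works has_derivative_linear by blast
    moreover have "h = 0" if "frechet_derivative z (at p) h = 0" for h
    proof -
      have 0: "fst h *\<^sub>R (s p *\<^sub>R x p) + snd h *\<^sub>R ((t p * a p) *\<^sub>R x p + (t p * q p) *\<^sub>R w p) = 0"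
        using that unfolding has_partials_frechet[OF hp[OF z p]] zu[OF p] zv[OF p] by simp
      from arg_cong[OF 0, of "\<lambda>v. mink v (w p)"] have "snd h = 0"
        using tq[OF p] by (auto simp: mink_linear f)
      with arg_cong[OF 0, of "\<lambda>v. mink v (x p)"] have "fst h = 0"
        using pos(1)[OF p] by (simp add: mink_linear f)
      with \<open>snd h = 0\<close> show ?thesis by (simp add: prod_eq_iff)
    qed
    ultimately show "inj (frechet_derivative z (at p))"
      by (simp add: linear_injective_0)
    show "spacelike m" if "normal_vector z p m" for m
    proof -
      obtain c where c: "c \<noteq> 0" "m = c *\<^sub>R n p"
        using normal_vector_frame[OF fr[OF p] zu[OF p] zv[OF p] pos(1)[OF p] tq[OF p], of m,
            THEN iffD1, OF \<open>normal_vector z p m\<close>] by (elim exE conjE)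
      have "mink m m = c * c"
        unfolding c(2) mink.scaleR_left mink.scaleR_right f by simp
      moreover have "c * c > 0" using c(1) by (auto simp: zero_less_mult_iff)
      ultimately show ?thesis unfolding spacelike_def by simp
    qed
    show "coeff_E z p > 0" "coeff_G z p < 0" using pos[OF p] by (simp_all add: E[OF p] G[OF p])
    define c where "c = 1 + (a p)\<^sup>2"
    have c: "c > 0" by (simp add: c_def add_pos_nonneg)
    have D: "coeff_E z p * coeff_G z p - (coeff_F z p)\<^sup>2 = - (s p * t p)\<^sup>2 * c"
      by (simp add: E[OF p] F[OF p] G[OF p] c_def power2_eq_square algebra_simps)
    define r where "r = s p * t p"
    have r: "r \<noteq> 0" using pos[OF p] by (simp add: r_def)
    have "gauss_curvature z p = (- (r\<^sup>2 * (\<alpha> p)\<^sup>2)) / (- (r\<^sup>2 * c))"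
      unfolding gauss_curvature_def D by (simp add: L[OF p] M[OF p] r_def power_mult_distrib)
    also have "\<dots> = (\<alpha> p)\<^sup>2 / c" using r by simp
    finally have K: "gauss_curvature z p = (\<alpha> p)\<^sup>2 / c" .
    have "mean_curvature z p = (- 2 * r\<^sup>2) * (a p * \<alpha> p) / ((- 2 * r\<^sup>2) * c)"
      unfolding mean_curvature_def D by (simp add: L[OF p] M[OF p] N[OF p] F[OF p] r_def power2_eq_square mult_ac)
    also have "\<dots> = a p * \<alpha> p / c" using r by simp
    finally have H: "mean_curvature z p = a p * \<alpha> p / c" .
    have "gauss_curvature z p - (mean_curvature z p)\<^sup>2 = (\<alpha> p)\<^sup>2 * (c - (a p)\<^sup>2) / c\<^sup>2"
      unfolding K H using c by (simp add: field_simps power2_eq_square)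
    also have "\<dots> = (\<alpha> p)\<^sup>2 / c\<^sup>2" by (simp add: c_def)
    also have "\<dots> > 0" using \<alpha>[OF p] c by simp
    finally show "gauss_curvature z p - (mean_curvature z p)\<^sup>2 > 0" .
  qed
qed

text \<open>The integrability condition in coefficients, with the second and fourth entries of the
  u-coefficients zero. The first three identities are the components of the equation for the
  position, the fourth is the Gauss equation and the last two are the Codazzi equations.\<close>

lemma frame_mul_compat:
  assumes "A1v = B1u + B2 * A3" "A1 * B3 = B2u + B1 * A3" "A1 * B4 = B2 * A5" "A3v = B3u + B4 * A5"
    "A3 * B5 = B4u + B3 * A5" "A5v + A3 * B4 = B5u"
  shows "frame_mul (A1v, 0, A3v, 0, A5v) \<xi> + frame_mul (A1, 0, A3, 0, A5) (frame_mul (B1, B2, B3, B4, B5) \<xi>) =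
    frame_mul (B1u, B2u, B3u, B4u, B5u) \<xi> + frame_mul (B1, B2, B3, B4, B5) (frame_mul (A1, 0, A3, 0, A5) \<xi>)"
proof (cases \<xi>)
  case (fields z x w n)
  have 1: "A1v * X + A1 * (B3 * Y + B4 * Z) = B1u * X + B2u * Y + (B1 * (A3 * Y) + B2 * (A3 * X + A5 * Z))"
    and 2: "A3v * Y + A3 * (B3 * X + B5 * Z) = B3u * Y + B4u * Z + (B3 * (A3 * X + A5 * Z) + B4 * (A5 * Y))"
    and 3: "A3v * X + A5v * Z + (A3 * (B3 * Y + B4 * Z) + A5 * (B5 * Y - B4 * X)) =
        B3u * X + B5u * Z + (B3 * (A3 * Y) + B5 * (A5 * Y))"
    and 4: "A5v * Y + A5 * (B3 * X + B5 * Z) = B5u * Y - B4u * X + (B5 * (A3 * X + A5 * Z) - B4 * (A3 * Y))"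
    for X Y Z
    using assms by algebra+
  show ?thesis
    unfolding fields using 1 2 3 4 by (simp add: vec_eq_iff)
qed

section \<open>Derivatives and smoothness of the coefficients\<close>

lemma dv_coeff_u:
  assumes s: "has_partials s su sv p" and g: "has_partials \<gamma>1 g1u g1v p"
    and a: "has_partials a au av p" and al: "has_partials \<alpha> alu alv p"
  shows "dv (coeff_u s \<gamma>1 a \<alpha>) p = (sv, 0,
    (a p * av / scale_of a p * s p + scale_of a p * sv) * \<gamma>1 p + scale_of a p * s p * g1v, 0,
    ((alv * s p + \<alpha> p * sv) * scale_of a p - \<alpha> p * s p * (a p * av / scale_of a p)) / (scale_of a p)\<^sup>2)"
proof -
  have nz: "scale_of a p \<noteq> 0" using scale_of_pos[of a p] by simp
  note q = has_partials_scale_of[OF a]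
  note d = has_partials_Pair[OF s has_partials_Pair[OF has_partials_const[of 0]
        has_partials_Pair[OF has_partials_mult[OF has_partials_mult[OF q s] g]
        has_partials_Pair[OF has_partials_const[of 0] has_partials_divide[OF has_partials_mult[OF al s] q nz]]]]]
  show ?thesis
    unfolding coeff_u_def[abs_def] has_partials_dv[OF d] by (simp add: add.commute)
qed

lemma du_coeff_v:
  assumes t: "has_partials t tu tv p" and g: "has_partials \<gamma>2 g2u g2v p"
    and a: "has_partials a au (dv a p) p" and av: "has_partials (dv a) avu avv p" and al: "has_partials \<alpha> alu alv p"
  shows "du (coeff_v t \<gamma>2 a \<alpha>) p = (tu * a p + t p * au, tu * scale_of a p + t p * (a p * au / scale_of a p),
    a p * au / scale_of a p * (t p * \<gamma>2 p - dv a p / (1 + (a p)\<^sup>2)) +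
     scale_of a p * (tu * \<gamma>2 p + t p * g2u - (avu * (1 + (a p)\<^sup>2) - dv a p * (2 * a p * au)) / (1 + (a p)\<^sup>2)\<^sup>2),
    alu * t p + \<alpha> p * tu,
    - (((au * \<alpha> p + a p * alu) * t p + a p * \<alpha> p * tu) * scale_of a p
       - a p * \<alpha> p * t p * (a p * au / scale_of a p)) / (scale_of a p)\<^sup>2)"
proof -
  have nz: "scale_of a p \<noteq> 0" "1 + (a p)\<^sup>2 \<noteq> 0"
    using scale_of_pos[of a p] scale_of_square[of a p] by auto
  note q = has_partials_scale_of[OF a]
  have c: "has_partials (\<lambda>p. 1 + (a p)\<^sup>2) (2 * a p * au) (2 * a p * dv a p) p"
    using has_partials_add[OF has_partials_const[of 1] has_partials_mult[OF a a]]
    by (simp add: power2_eq_square mult_ac)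
  note d = has_partials_Pair[OF has_partials_mult[OF t a] has_partials_Pair[OF has_partials_mult[OF t q]
        has_partials_Pair[OF has_partials_mult[OF q has_partials_diff[OF has_partials_mult[OF t g]
            has_partials_divide[OF av c nz(2)]]]
        has_partials_Pair[OF has_partials_mult[OF al t]
          has_partials_minus[OF has_partials_divide[OF has_partials_mult[OF has_partials_mult[OF a al] t] q nz(1)]]]]]]
  show ?thesis
    unfolding coeff_v_def[abs_def] has_partials_du[OF d] by (simp only: minus_divide_left add.commute)
qed

lemma smooth_on_coeff_u:
  assumes "open S" "smooth_on S s" "smooth_on S \<gamma>1" "smooth_on S a" "smooth_on S \<alpha>"
  shows "smooth_on S (coeff_u s \<gamma>1 a \<alpha>)"
proof -
  have "scale_of a p \<noteq> 0" for p using scale_of_pos[of a p] by simp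
  then show ?thesis
    unfolding coeff_u_def[abs_def]
    by (intro smooth_on_Pair smooth_on_intros smooth_on_scale_of assms)
qed

lemma smooth_on_coeff_v:
  assumes "open S" "smooth_on S t" "smooth_on S \<gamma>2" "smooth_on S a" "smooth_on S \<alpha>"
  shows "smooth_on S (coeff_v t \<gamma>2 a \<alpha>)"
proof -
  have "scale_of a p \<noteq> 0" "1 + (a p)\<^sup>2 \<noteq> 0" for p
    using scale_of_pos[of a p] scale_of_square[of a p] by auto
  then show ?thesis
    unfolding coeff_v_def[abs_def]
    by (intro smooth_on_Pair smooth_on_intros smooth_on_scale_of assms)
qed

text \<open>Writing the absolute value of \<alpha> as the square root of \<alpha>^2 treats both
  signs at once.\<close>

lemma has_partials_log_ratio:
  assumes a: "has_partials a au av p" and al: "has_partials \<alpha> alu alv p" and nz: "\<alpha> p \<noteq> 0"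
  shows "has_partials (\<lambda>p. 1 / 2 * (ln (sqrt (1 + (a p)\<^sup>2)) - ln \<bar>\<alpha> p\<bar>))
    ((a p * au / (1 + (a p)\<^sup>2) - alu / \<alpha> p) / 2) ((a p * av / (1 + (a p)\<^sup>2) - alv / \<alpha> p) / 2) p"
proof -
  have q: "a p * d / scale_of a p / scale_of a p = a p * d / (1 + (a p)\<^sup>2)" for d
    using scale_of_square[of a p] by (simp add: power2_eq_square)
  have 1: "has_partials (\<lambda>p. ln (sqrt (1 + (a p)\<^sup>2))) (a p * au / (1 + (a p)\<^sup>2)) (a p * av / (1 + (a p)\<^sup>2)) p"
    using has_partials_ln[OF has_partials_scale_of[OF a] scale_of_pos] unfolding q by (simp add: scale_of_def)
  have "\<bar>\<alpha> p\<bar> > 0" "(\<alpha> p)\<^sup>2 > 0" using nz by simp_all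
  have "has_partials (\<lambda>p. (\<alpha> p)\<^sup>2) (2 * \<alpha> p * alu) (2 * \<alpha> p * alv) p"
    using has_partials_mult[OF al al] by (simp add: power2_eq_square mult_ac)
  from has_partials_ln[OF has_partials_sqrt[OF this \<open>(\<alpha> p)\<^sup>2 > 0\<close>]]
  have "has_partials (\<lambda>p. ln \<bar>\<alpha> p\<bar>) (2 * \<alpha> p * alu / (2 * \<bar>\<alpha> p\<bar>) / \<bar>\<alpha> p\<bar>) (2 * \<alpha> p * alv / (2 * \<bar>\<alpha> p\<bar>) / \<bar>\<alpha> p\<bar>) p"
    using \<open>\<bar>\<alpha> p\<bar> > 0\<close> by simp
  moreover have "2 * \<alpha> p * d / (2 * \<bar>\<alpha> p\<bar>) / \<bar>\<alpha> p\<bar> = d / \<alpha> p" for d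
    using nz by (simp add: abs_if)
  ultimately have 2: "has_partials (\<lambda>p. ln \<bar>\<alpha> p\<bar>) (alu / \<alpha> p) (alv / \<alpha> p) p" by simp
  from has_partials_mult[OF has_partials_const[of "1/2"] has_partials_diff[OF 1 2]] show ?thesis
    by simp
qed

lemma smooth_on_log_ratio:
  fixes a \<alpha> :: "'a::real_normed_vector \<Rightarrow> real"
  assumes "open S" "smooth_on S a" "smooth_on S \<alpha>" "\<And>p. p \<in> S \<Longrightarrow> \<alpha> p \<noteq> 0"
  shows "smooth_on S (\<lambda>p. 1 / 2 * (ln (sqrt (1 + (a p)\<^sup>2)) - ln \<bar>\<alpha> p\<bar>))"
  unfolding real_sqrt_abs[symmetric]
  by (intro smooth_on_intros assms(1-3)) (use assms(4) in \<open>auto simp: add_pos_nonneg\<close>)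

section \<open>Uniqueness up to a motion and local existence\<close>

theorem theorem3p1:
  fixes D :: "(real \<times> real) set" and u0 v0 :: real
    and \<gamma>1 \<gamma>2 a \<alpha> f \<Phi> \<Psi> :: "real \<times> real \<Rightarrow> real"
  assumes D: "open D" "(u0, v0) \<in> D"
    and smooth: "smooth_on D \<gamma>1" "smooth_on D \<gamma>2" "smooth_on D a" "smooth_on D \<alpha>"
    and f: "f = (\<lambda>p. 1 / 2 * (ln (sqrt (1 + (a p)\<^sup>2)) - ln \<bar>\<alpha> p\<bar>))"
    and \<Phi>: "\<Phi> = (\<lambda>p. (du a p * dv a p + (1 + (a p)\<^sup>2)\<^sup>2 * du f p * dv f p) /
                 ((1 + (a p)\<^sup>2) * (- dv a p * \<gamma>1 p + (1 + (a p)\<^sup>2) * dv f p * \<gamma>2 p)))"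
    and \<Psi>: "\<Psi> = (\<lambda>p. (du a p * dv a p + (1 + (a p)\<^sup>2)\<^sup>2 * du f p * dv f p) /
                 ((1 + (a p)\<^sup>2) * (du a p * \<gamma>2 p + (1 + (a p)\<^sup>2) * du f p * \<gamma>1 p)))"
    and \<alpha>_nz: "\<forall>p\<in>D. \<alpha> p \<noteq> 0"
    and \<Phi>_den_nz: "\<forall>p\<in>D. (1 + (a p)\<^sup>2) * (- dv a p * \<gamma>1 p + (1 + (a p)\<^sup>2) * dv f p * \<gamma>2 p) \<noteq> 0"
    and \<Psi>_den_nz: "\<forall>p\<in>D. (1 + (a p)\<^sup>2) * (du a p * \<gamma>2 p + (1 + (a p)\<^sup>2) * du f p * \<gamma>1 p) \<noteq> 0"
    and pos: "\<forall>p\<in>D. \<Phi> p > 0" "\<forall>p\<in>D. \<Psi> p > 0"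
    and eq1: "\<forall>p\<in>D.
          du \<gamma>2 p / \<Phi> p - dv \<gamma>1 p / \<Psi> p - 2 * a p * \<gamma>1 p * \<gamma>2 p - (\<gamma>1 p)\<^sup>2 + (\<gamma>2 p)\<^sup>2
          - \<gamma>1 p * (du a p / ((1 + (a p)\<^sup>2) * \<Phi> p))
          - \<gamma>2 p * (dv a p / ((1 + (a p)\<^sup>2) * \<Psi> p))
          - dv (du a) p / ((1 + (a p)\<^sup>2) * \<Phi> p * \<Psi> p)
          + a p * du a p * dv a p / ((1 + (a p)\<^sup>2)\<^sup>2 * \<Phi> p * \<Psi> p)
          + (\<alpha> p)\<^sup>2 / (1 + (a p)\<^sup>2) = 0"
    and eq2: "\<forall>p\<in>D.
          dv (\<lambda>q. ln (\<Phi> q)) p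
          + a p * du f p * ((dv a p * \<gamma>1 p - (1 + (a p)\<^sup>2) * dv f p * \<gamma>2 p) /
                            (du a p * \<gamma>2 p + (1 + (a p)\<^sup>2) * du f p * \<gamma>1 p)) = dv f p"
    and eq3: "\<forall>p\<in>D.
          du (\<lambda>q. ln (\<Psi> q)) p
          + a p * dv f p * ((du a p * \<gamma>2 p + (1 + (a p)\<^sup>2) * du f p * \<gamma>1 p) /
                            (- dv a p * \<gamma>1 p + (1 + (a p)\<^sup>2) * dv f p * \<gamma>2 p)) = du f p"
  shows "(\<exists>W z. open W \<and> connected W \<and> (u0, v0) \<in> W \<and> W \<subseteq> D \<and>
            admissible_surface W z \<and> has_invariants W z \<gamma>1 \<gamma>2 a \<alpha>) \<and>
         (\<forall>W z1 z2. open W \<and> connected W \<and> (u0, v0) \<in> W \<and> W \<subseteq> D \<and>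
            admissible_surface W z1 \<and> has_invariants W z1 \<gamma>1 \<gamma>2 a \<alpha> \<and>
            admissible_surface W z2 \<and> has_invariants W z2 \<gamma>1 \<gamma>2 a \<alpha> \<longrightarrow>
            (\<exists>T. motion T \<and> (\<forall>p\<in>W. z2 p = T (z1 p))))"
proof -
  let ?c = "\<lambda>p. 1 + (a p)\<^sup>2"
  note hp = smooth_on_has_partials
  note sm = smooth_on_intros D(1) smooth
  have c: "?c p > 0" for p by (simp add: add_pos_nonneg)
  have hf: "has_partials f ((a p * du a p / ?c p - du \<alpha> p / \<alpha> p) / 2) ((a p * dv a p / ?c p - dv \<alpha> p / \<alpha> p) / 2) p"
    if "p \<in> D" for p
    unfolding f using that \<alpha>_nz by (intro has_partials_log_ratio hp[OF smooth(3)] hp[OF smooth(4)]) auto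
  have fu: "du f p = (a p * du a p / ?c p - du \<alpha> p / \<alpha> p) / 2"
    and fv: "dv f p = (a p * dv a p / ?c p - dv \<alpha> p / \<alpha> p) / 2" if "p \<in> D" for p
    using hf[OF that] by (simp_all add: has_partials_iff)
  have sf: "smooth_on D f"
    unfolding f using \<alpha>_nz by (intro smooth_on_log_ratio D(1) smooth) auto
  have s\<Phi>: "smooth_on D \<Phi>"
    unfolding \<Phi> by (intro sm sf) (rule \<Phi>_den_nz[rule_format])
  have s\<Psi>: "smooth_on D \<Psi>"
    unfolding \<Psi> by (intro sm sf) (rule \<Psi>_den_nz[rule_format])
  have \<Phi>_eq: "\<Phi> p = (du a p * dv a p + (?c p)\<^sup>2 * du f p * dv f p) / (?c p * (- dv a p * \<gamma>1 p + ?c p * dv f p * \<gamma>2 p))"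
    and \<Psi>_eq: "\<Psi> p = (du a p * dv a p + (?c p)\<^sup>2 * du f p * dv f p) / (?c p * (du a p * \<gamma>2 p + ?c p * du f p * \<gamma>1 p))" for p
    by (simp_all add: \<Phi> \<Psi>)
  have compare: "sqrt_E z p = \<Phi> p \<and> sqrt_mG z p = \<Psi> p"
    if "p \<in> D" and pos: "sqrt_E z p > 0" "sqrt_mG z p > 0"
      and I: "sqrt_mG z p * (sqrt_E z p * \<gamma>1 p + du a p / ?c p) =
        sqrt_E z p * ((a p * dv a p / ?c p - dv \<alpha> p / \<alpha> p) / 2)"
      and II: "sqrt_E z p * (sqrt_mG z p * \<gamma>2 p - dv a p / ?c p) =
        sqrt_mG z p * ((a p * du a p / ?c p - du \<alpha> p / \<alpha> p) / 2)" for z p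
    using linear_equations_solution[OF pos c I[folded fv[OF \<open>p \<in> D\<close>]] II[folded fu[OF \<open>p \<in> D\<close>]]]
      \<Phi>_den_nz \<Psi>_den_nz \<open>p \<in> D\<close> unfolding \<Phi>_eq \<Psi>_eq by blast
  have unique: "\<exists>T. motion T \<and> (\<forall>p\<in>W. z2 p = T (z1 p))"
    if W: "open W" "connected W" "(u0, v0) \<in> W" "W \<subseteq> D"
      and z1: "admissible_surface W z1" "has_invariants W z1 \<gamma>1 \<gamma>2 a \<alpha>"
      and z2: "admissible_surface W z2" "has_invariants W z2 \<gamma>1 \<gamma>2 a \<alpha>" for W z1 z2
  proof -
    have nz: "\<alpha> p \<noteq> 0" if "p \<in> W" for p using that W(4) \<alpha>_nz by blast
    \<comment> \<open>An elimination rule applied to both surfaces: once \<open>compare\<close> has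
      identified s and t, the frame satisfies a system that no longer depends on the
      surface.\<close>
    have frame: thesis if z: "admissible_surface W z" "has_invariants W z \<gamma>1 \<gamma>2 a \<alpha>"
      and *: "\<And>x w n. frame_system W (coeff_u \<Phi> \<gamma>1 a \<alpha>) (coeff_v \<Psi> \<gamma>2 a \<alpha>) z x w n \<Longrightarrow>
        (\<And>p. p \<in> W \<Longrightarrow> mink_frame (x p) (w p) (n p)) \<Longrightarrow>
        (\<And>p. p \<in> W \<Longrightarrow> det (vector [x p, w p, n p] :: real^3^3) = 1) \<Longrightarrow> thesis" for z thesis
    proof (rule surface_frame[OF W(1) z nz])
      fix x w n
      assume sys: "frame_system W (coeff_u (sqrt_E z) \<gamma>1 a \<alpha>) (coeff_v (sqrt_mG z) \<gamma>2 a \<alpha>) z x w n"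
        and fr: "\<And>p. p \<in> W \<Longrightarrow> mink_frame (x p) (w p) (n p)"
          "\<And>p. p \<in> W \<Longrightarrow> det (vector [x p, w p, n p] :: real^3^3) = 1"
        and s: "\<And>p. p \<in> W \<Longrightarrow> sqrt_E z p > 0" "\<And>p. p \<in> W \<Longrightarrow> sqrt_mG z p > 0"
        and l: "\<And>p. p \<in> W \<Longrightarrow> sqrt_mG z p * (sqrt_E z p * \<gamma>1 p + du a p / ?c p) =
            sqrt_E z p * ((a p * dv a p / ?c p - dv \<alpha> p / \<alpha> p) / 2)"
          "\<And>p. p \<in> W \<Longrightarrow> sqrt_E z p * (sqrt_mG z p * \<gamma>2 p - dv a p / ?c p) =
            sqrt_mG z p * ((a p * du a p / ?c p - du \<alpha> p / \<alpha> p) / 2)"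
      have "sqrt_E z p = \<Phi> p" "sqrt_mG z p = \<Psi> p" if "p \<in> W" for p
        using compare[OF subsetD[OF W(4) that] s[OF that] l[OF that]] by blast+
      then have "frame_system W (coeff_u \<Phi> \<gamma>1 a \<alpha>) (coeff_v \<Psi> \<gamma>2 a \<alpha>) z x w n"
        by (intro frame_system_cong[OF sys]) (simp_all add: coeff_u_def coeff_v_def)
      then show thesis using fr by (rule *)
    qed
    obtain x1 w1 n1 where f1: "frame_system W (coeff_u \<Phi> \<gamma>1 a \<alpha>) (coeff_v \<Psi> \<gamma>2 a \<alpha>) z1 x1 w1 n1"
      "\<And>p. p \<in> W \<Longrightarrow> mink_frame (x1 p) (w1 p) (n1 p)"
      "\<And>p. p \<in> W \<Longrightarrow> det (vector [x1 p, w1 p, n1 p] :: real^3^3) = 1"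
      by (rule frame[OF z1], rule that)
    obtain x2 w2 n2 where f2: "frame_system W (coeff_u \<Phi> \<gamma>1 a \<alpha>) (coeff_v \<Psi> \<gamma>2 a \<alpha>) z2 x2 w2 n2"
      "\<And>p. p \<in> W \<Longrightarrow> mink_frame (x2 p) (w2 p) (n2 p)"
      "\<And>p. p \<in> W \<Longrightarrow> det (vector [x2 p, w2 p, n2 p] :: real^3^3) = 1"
      by (rule frame[OF z2], rule that)
    show ?thesis
      by (rule frame_system_congruent[OF W(1-3) f1(1) f2(1) f1(2) f2(2) f1(3)[OF W(3)] f2(3)[OF W(3)]])
  qed
  \<comment> \<open>The second and third equations, solved for the derivatives of \<Phi> and \<Psi>;
    their fractions are -\<Psi> / \<Phi> and \<Phi> / \<Psi>, since \<Phi> and \<Psi> have the same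
    numerator.\<close>
  have derivs: "dv \<Phi> p = \<Phi> p * dv f p + a p * \<Psi> p * du f p" "du \<Psi> p = \<Psi> p * du f p - a p * \<Phi> p * dv f p"
    and I: "\<Psi> p * (\<Phi> p * \<gamma>1 p + du a p / ?c p) = \<Phi> p * dv f p"
    and II: "\<Phi> p * (\<Psi> p * \<gamma>2 p - dv a p / ?c p) = \<Psi> p * du f p" if p: "p \<in> D" for p
  proof -
    note le = linear_equations_converse[OF c \<Phi>_den_nz[rule_format, OF p] \<Psi>_den_nz[rule_format, OF p]
        \<Phi>_eq pos(1)[rule_format, OF p] \<Psi>_eq pos(2)[rule_format, OF p]]
    show "\<Psi> p * (\<Phi> p * \<gamma>1 p + du a p / ?c p) = \<Phi> p * dv f p"
      "\<Phi> p * (\<Psi> p * \<gamma>2 p - dv a p / ?c p) = \<Psi> p * du f p"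
      using le(1,2) by blast+
    have nz: "\<Phi> p \<noteq> 0" "\<Psi> p \<noteq> 0" "\<Phi> p > 0" "\<Psi> p > 0" using pos p by force+
    define X Y where "X = du a p * \<gamma>2 p + ?c p * du f p * \<gamma>1 p" and "Y = - dv a p * \<gamma>1 p + ?c p * dv f p * \<gamma>2 p"
    have YX: "Y / X = \<Psi> p / \<Phi> p" using le(3) by (simp add: X_def Y_def)
    then have XY: "X / Y = \<Phi> p / \<Psi> p" by (metis inverse_divide)
    have 1: "(dv a p * \<gamma>1 p - ?c p * dv f p * \<gamma>2 p) / X = - (\<Psi> p / \<Phi> p)"
      unfolding YX[symmetric] minus_divide_left by (simp add: Y_def)
    have "dv (\<lambda>q. ln (\<Phi> q)) p = dv \<Phi> p / \<Phi> p" "du (\<lambda>q. ln (\<Psi> q)) p = du \<Psi> p / \<Psi> p"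
      using has_partials_ln[OF hp[OF s\<Phi> p] nz(3)] has_partials_ln[OF hp[OF s\<Psi> p] nz(4)]
      by (simp_all add: has_partials_iff)
    with eq2[rule_format, OF p] eq3[rule_format, OF p]
    have "dv \<Phi> p / \<Phi> p + a p * du f p * (- (\<Psi> p / \<Phi> p)) = dv f p"
      and "du \<Psi> p / \<Psi> p + a p * dv f p * (\<Phi> p / \<Psi> p) = du f p"
      unfolding X_def[symmetric] Y_def[symmetric] 1 XY by simp_all
    then show "dv \<Phi> p = \<Phi> p * dv f p + a p * \<Psi> p * du f p" "du \<Psi> p = \<Psi> p * du f p - a p * \<Phi> p * dv f p"
      using nz by (simp_all add: field_simps)
  qed
  have compat: "frame_mul (dv (coeff_u \<Phi> \<gamma>1 a \<alpha>) p) \<xi> + frame_mul (coeff_u \<Phi> \<gamma>1 a \<alpha> p) (frame_mul (coeff_v \<Psi> \<gamma>2 a \<alpha> p) \<xi>) =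
      frame_mul (du (coeff_v \<Psi> \<gamma>2 a \<alpha>) p) \<xi> + frame_mul (coeff_v \<Psi> \<gamma>2 a \<alpha> p) (frame_mul (coeff_u \<Phi> \<gamma>1 a \<alpha> p) \<xi>)"
    if p: "p \<in> D" for p \<xi>
  proof -
    note co = codazzi_from_linear[OF scale_of_pos[of a p] \<alpha>_nz[rule_format, OF p] scale_of_square[of a p]
        fu[OF p] fv[OF p] I[OF p] II[OF p] derivs[OF p]]
    have q: "scale_of a p \<noteq> 0" using scale_of_pos[of a p] by simp
    show ?thesis
      unfolding dv_coeff_u[OF hp[OF s\<Phi> p] hp[OF smooth(1) p] hp[OF smooth(3) p] hp[OF smooth(4) p]]
        du_coeff_v[OF hp[OF s\<Psi> p] hp[OF smooth(2) p] hp[OF smooth(3) p]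
          hp[OF smooth_on_dv[OF smooth(3)] p] hp[OF smooth(4) p]]
      unfolding coeff_u_def coeff_v_def
    proof (rule frame_mul_compat)
      show "(a p * dv a p / scale_of a p * \<Phi> p + scale_of a p * dv \<Phi> p) * \<gamma>1 p + scale_of a p * \<Phi> p * dv \<gamma>1 p =
        a p * du a p / scale_of a p * (\<Psi> p * \<gamma>2 p - dv a p / ?c p) +
        scale_of a p * (du \<Psi> p * \<gamma>2 p + \<Psi> p * du \<gamma>2 p -
          (du (dv a) p * ?c p - dv a p * (2 * a p * du a p)) / (?c p)\<^sup>2) + \<alpha> p * \<Psi> p * (\<alpha> p * \<Phi> p / scale_of a p)"
        \<comment> \<open>The first equation contains \<open>dv (du a)\<close>, the differentiated
          coefficient \<open>du (dv a)\<close>; symmetry identifies them.\<close>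
        using gauss_equation[OF pos(1)[rule_format, OF p] pos(2)[rule_format, OF p] scale_of_pos scale_of_square
            co(1,2) eq1[rule_format, OF p, unfolded dv_du_commute[OF D(1) p smooth(3)]]]
        by (simp only: mult.assoc)
      show "dv \<Phi> p = du \<Psi> p * a p + \<Psi> p * du a p + \<Psi> p * scale_of a p * (scale_of a p * \<Phi> p * \<gamma>1 p)"
        by (rule co)
      show "\<Phi> p * (scale_of a p * (\<Psi> p * \<gamma>2 p - dv a p / ?c p)) =
          du \<Psi> p * scale_of a p + \<Psi> p * (a p * du a p / scale_of a p) + \<Psi> p * a p * (scale_of a p * \<Phi> p * \<gamma>1 p)"
        using co(2) by (simp only: add_ac)
      show "\<Phi> p * (\<alpha> p * \<Psi> p) = \<Psi> p * scale_of a p * (\<alpha> p * \<Phi> p / scale_of a p)"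
        using q by simp
      show "scale_of a p * \<Phi> p * \<gamma>1 p * - (a p * \<alpha> p * \<Psi> p / scale_of a p) =
          du \<alpha> p * \<Psi> p + \<alpha> p * du \<Psi> p + scale_of a p * (\<Psi> p * \<gamma>2 p - dv a p / ?c p) * (\<alpha> p * \<Phi> p / scale_of a p)"
        by (rule co)
      show "((dv \<alpha> p * \<Phi> p + \<alpha> p * dv \<Phi> p) * scale_of a p - \<alpha> p * \<Phi> p * (a p * dv a p / scale_of a p)) / (scale_of a p)\<^sup>2
          + scale_of a p * \<Phi> p * \<gamma>1 p * (\<alpha> p * \<Psi> p) =
        - (((du a p * \<alpha> p + a p * du \<alpha> p) * \<Psi> p + a p * \<alpha> p * du \<Psi> p) * scale_of a p
          - a p * \<alpha> p * \<Psi> p * (a p * du a p / scale_of a p)) / (scale_of a p)\<^sup>2"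
        by (rule co)
    qed
  qed
  \<comment> \<open>The time-like unit vector is the third coordinate vector; the normal is minus
    the second one, so that the frame (e1, e3, n0) has determinant 1.\<close>
  define e1 e3 n0 :: "real^3" where "e1 = vector [1, 0, 0]" and "e3 = vector [0, 0, 1]" and "n0 = vector [0, -1, 0]"
  obtain l r k m \<sigma> where R: "u0 \<in> {l<..<r}" "v0 \<in> {k<..<m}" "{l..r} \<times> {k..m} \<subseteq> D"
    and c\<sigma>: "continuous_on ({l..r} \<times> {k..m}) \<sigma>" and init: "\<sigma> (l, k) = (0, e1, e3, n0)"
    and \<sigma>: "\<And>p. p \<in> {l<..<r} \<times> {k<..<m} \<Longrightarrow>
      has_partials \<sigma> (frame_mul (coeff_u \<Phi> \<gamma>1 a \<alpha> p) (\<sigma> p)) (frame_mul (coeff_v \<Psi> \<gamma>2 a \<alpha> p) (\<sigma> p)) p"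
    by (rule linear_total_system[OF bounded_bilinear_frame_mul D
          smooth_on_coeff_u[OF D(1) s\<Phi> smooth(1,3,4)] smooth_on_coeff_v[OF D(1) s\<Psi> smooth(2,3,4)] compat,
          where ?\<xi>0.0 = "(0, e1, e3, n0)"], assumption, rule that)
  define W R where "W = {l<..<r} \<times> {k<..<m}" and "R = {l..r} \<times> {k..m}"
  have W: "open W" "connected W" "(u0, v0) \<in> W" "W \<subseteq> R" "W \<subseteq> D" "closure W = R" "(l, k) \<in> R" "connected R"
    using R by (auto simp: W_def R_def open_Times connected_Times closure_Times)
  define z x w n where "z p = fst (\<sigma> p)" and "x p = fst (snd (\<sigma> p))" and "w p = fst (snd (snd (\<sigma> p)))"
    and "n p = snd (snd (snd (\<sigma> p)))" for p
  have \<sigma>_eq: "\<sigma> p = (z p, x p, w p, n p)" for p by (simp add: z_def x_def w_def n_def)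
  have sys: "frame_system W (coeff_u \<Phi> \<gamma>1 a \<alpha>) (coeff_v \<Psi> \<gamma>2 a \<alpha>) z x w n"
    unfolding frame_system_def \<sigma>_eq[symmetric] using \<sigma> by (simp add: W_def)
  have cont: "continuous_on R x" "continuous_on R w" "continuous_on R n"
    using c\<sigma> unfolding x_def w_def n_def R_def by (auto intro!: continuous_intros)
  have init': "x (l, k) = e1" "w (l, k) = e3" "n (l, k) = n0"
    using init by (simp_all add: x_def w_def n_def)
  have fr: "mink_frame (x p) (w p) (n p)" if p: "p \<in> R" for p
    unfolding mink_frame_iff
  proof (intro allI)
    fix i j
    \<comment> \<open>The equations, and with them constancy of the pairing, are available on the
      open rectangle; continuity on its closure reaches the corner with the initial values.\<close>
    let ?g = "\<lambda>p. frame_pairing (x p) (w p) (n p) (x p) (w p) (n p) i j"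
    have cg: "continuous_on (closure W) ?g"
      unfolding W(6) frame_pairing_def by (intro continuous_intros cont)
    have "?g q = ?g (u0, v0)" if "q \<in> R" for q
      by (rule continuous_constant_on_closure[OF cg frame_pairing_constant[OF W(1,2) _ W(3) sys sys]])
        (use that in \<open>simp_all only: W(6)\<close>)
    from this[OF p] this[OF W(7)] have "?g p = ?g (l, k)" by (rule trans[OF _ sym])
    also have "\<dots> = mink_coeff i j"
      using exhaust_3[of i] exhaust_3[of j]
      by (auto simp: init' frame_pairing_def mink_coeff_def e1_def e3_def n0_def)
    finally show "x p $ i * x p $ j - w p $ i * w p $ j + n p $ i * n p $ j = mink_coeff i j"
      by (simp add: frame_pairing_def)
  qed
  have det: "det (vector [x p, w p, n p] :: real^3^3) = 1" if p: "p \<in> R" for p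
  proof -
    let ?d = "\<lambda>p. det (vector [x p, w p, n p] :: real^3^3)"
    have "continuous_on R ?d"
      unfolding det_3 vector_3 by (intro continuous_intros cont)
    \<comment> \<open>By orthonormality the determinant takes only the values 1 and -1; on the
      connected rectangle it keeps the value 1 that it has at the corner.\<close>
    moreover have "?d ` R \<subseteq> {1, -1}"
      using mink_frame_det[OF fr] by (auto simp: power2_eq_1_iff)
    ultimately have "?d constant_on R"
      using W(8) by (intro continuous_finite_range_constant) (auto intro: finite_subset)
    then have "?d p = ?d (l, k)" using p W(7) unfolding constant_on_def by metis
    also have "\<dots> = 1" by (simp add: init' det_3 e1_def e3_def n0_def)
    finally show ?thesis .
  qed
  have sz: "smooth_on W z"
    unfolding z_def
  proof (rule bounded_linear.smooth_on[OF bounded_linear_fst W(1)])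
    show "smooth_on W \<sigma>"
      by (rule linear_total_system_smooth[OF bounded_bilinear_frame_mul W(1)
            smooth_on_subset[OF smooth_on_coeff_u[OF D(1) s\<Phi> smooth(1,3,4)] W(5)]
            smooth_on_subset[OF smooth_on_coeff_v[OF D(1) s\<Psi> smooth(2,3,4)] W(5)]])
        (rule \<sigma>, simp add: W_def)
  qed
  have WR: "p \<in> R" "p \<in> D" if "p \<in> W" for p using that W(4,5) by auto
  have "admissible_surface W z" "has_invariants W z \<gamma>1 \<gamma>2 a \<alpha>"
  proof -
    have f: "det (vector [x p, w p, n p] :: real^3^3) > 0" "\<Phi> p > 0" "\<Psi> p > 0" "\<alpha> p \<noteq> 0" if "p \<in> W" for p
      using det[OF WR(1)[OF that]] pos \<alpha>_nz WR(2)[OF that] by auto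
    note fs = frame_surface[OF W(1) sz sys fr[OF WR(1)] f(1-3) smooth_on_subset[OF s\<Phi> W(5)]
        smooth_on_subset[OF s\<Psi> W(5)] smooth_on_subset[OF smooth(3) W(5)] f(4)]
    have co': "dv \<Phi> p = du \<Psi> p * a p + \<Psi> p * du a p + \<Psi> p * scale_of a p * (scale_of a p * \<Phi> p * \<gamma>1 p)"
      "\<Phi> p * (scale_of a p * (\<Psi> p * \<gamma>2 p - dv a p / ?c p)) =
        \<Psi> p * a p * (scale_of a p * \<Phi> p * \<gamma>1 p) + du \<Psi> p * scale_of a p + \<Psi> p * (a p * du a p / scale_of a p)"
      if "p \<in> W" for p
    proof -
      have p: "p \<in> D" by (rule WR(2)[OF that])
      note co = codazzi_from_linear[OF scale_of_pos[of a p] \<alpha>_nz[rule_format, OF p] scale_of_square[of a p]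
        fu[OF p] fv[OF p] I[OF p] II[OF p] derivs[OF p]]
      show "dv \<Phi> p = du \<Psi> p * a p + \<Psi> p * du a p + \<Psi> p * scale_of a p * (scale_of a p * \<Phi> p * \<gamma>1 p)"
        "\<Phi> p * (scale_of a p * (\<Psi> p * \<gamma>2 p - dv a p / ?c p)) =
          \<Psi> p * a p * (scale_of a p * \<Phi> p * \<gamma>1 p) + du \<Psi> p * scale_of a p + \<Psi> p * (a p * du a p / scale_of a p)"
        by (rule co)+
    qed
    show "admissible_surface W z" "has_invariants W z \<gamma>1 \<gamma>2 a \<alpha>"
      by (rule fs; (assumption | rule co'; assumption))+
  qed
  then show ?thesis using W(1,2,3,5) unique by blast
qed

end
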